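(* Let $(M,g)$ be a closed Riemannian manifold of dimension $n$ with volume $1$, let $f\in C^1(M,(0,\infty))$ satisfy $\int_M f\,dx=1$, and let $u_t$ be the solution of $\frac{\partial}{\partial t}u=\frac12\Delta u$, $u_0=f$. Assume that there is a $k\in\mathbb{R}$ such that $\mathrm{Ric}\ge k\,\mathrm{Id}$. (i) If $k>0$, then $\frac{d}{dt}\mathrm{Ent}(u_t)$ decays exponentially as $t\to\infty$, i.e. there are constants $C,c>0$ such that $\frac{d}{dt}\mathrm{Ent}(u_t)\le Ce^{-ct}$ for all $t>0$. (ii) If $k<0$, then $\frac{d}{dt}\mathrm{Ent}(u_t)$ is asymptotically dominated by $-nk/2$ as $t\to\infty$, i.e. $\limsup_{t\to\infty}\frac{d}{dt}\mathrm{Ent}(u_t)\le-\frac{nk}{2}$.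
   Context: $dx$ is the Riemannian volume measure on $M$, $\Delta$ is the Laplace–Beltrami operator, and $\mathrm{Ric}$ is the Ricci curvature tensor; $\mathrm{Ric}\ge k\,\mathrm{Id}$ means $\mathrm{Ric}(X,X)\ge k|X|^2$ for all tangent vectors $X$. The entropy is $\mathrm{Ent}(u_t)=-\int_M u_t\log u_t\,dx$; its time derivative is nonnegative. *)

theory Defs
  imports "HOL-Analysis.Analysis"
begin

section \<open>Functions of class \<open>C\<^sup>k\<close> on open subsets of Euclidean space\<close>

definition partial_at :: "'a::euclidean_space \<Rightarrow> ('a \<Rightarrow> 'b::real_normed_vector) \<Rightarrow> 'a \<Rightarrow> 'b"
  where "partial_at b f x = frechet_derivative f (at x) b"

text \<open>Only meant for open sets \<^term>\<open>S\<close>: the derivatives are taken in the ambient space.\<close>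

primrec Ck_on :: "nat \<Rightarrow> ('a::euclidean_space \<Rightarrow> 'b::real_normed_vector) \<Rightarrow> 'a set \<Rightarrow> bool"
  where
    "Ck_on 0 f S \<longleftrightarrow> continuous_on S f"
  | "Ck_on (Suc k) f S \<longleftrightarrow>
       (\<forall>x\<in>S. f differentiable (at x)) \<and> (\<forall>b\<in>Basis. Ck_on k (partial_at b f) S)"

definition smooth_on :: "('a::euclidean_space \<Rightarrow> 'b::real_normed_vector) \<Rightarrow> 'a set \<Rightarrow> bool"
  where "smooth_on f S \<longleftrightarrow> (\<forall>k. Ck_on k f S)"


section \<open>Smooth manifolds\<close>

text \<open>
  A manifold is a topological space \<^typ>\<open>'m\<close> with a smooth atlas. A chart is a pair of an
  open set and a coordinate map; the values of the coordinate map outside of that set are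
  irrelevant. The dimension is \<open>CARD('n)\<close>, hence at least 1.
\<close>

type_synonym ('m, 'n) chart = "'m set \<times> ('m \<Rightarrow> real ^ 'n)"

abbreviation dom_of :: "('m, 'n::finite) chart \<Rightarrow> 'm set"
  where "dom_of c \<equiv> fst c"

abbreviation coord :: "('m, 'n::finite) chart \<Rightarrow> 'm \<Rightarrow> real ^ 'n"
  where "coord c \<equiv> snd c"

definition cod_of :: "('m, 'n::finite) chart \<Rightarrow> (real ^ 'n) set"
  where "cod_of c = coord c ` dom_of c"

definition inv_coord :: "('m, 'n::finite) chart \<Rightarrow> real ^ 'n \<Rightarrow> 'm"
  where "inv_coord c = inv_into (dom_of c) (coord c)"

definition transition :: "('m, 'n::finite) chart \<Rightarrow> ('m, 'n) chart \<Rightarrow> real ^ 'n \<Rightarrow> real ^ 'n"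
  where "transition c c' = coord c' \<circ> inv_coord c"

definition is_chart :: "('m::topological_space, 'n::finite) chart \<Rightarrow> bool"
  where "is_chart c \<longleftrightarrow>
    open (dom_of c) \<and> open (cod_of c) \<and>
    homeomorphism (dom_of c) (cod_of c) (coord c) (inv_coord c)"

definition smooth_atlas :: "('m::topological_space, 'n::finite) chart set \<Rightarrow> bool"
  where "smooth_atlas A \<longleftrightarrow>
    (\<forall>c\<in>A. is_chart c) \<and> (\<Union>c\<in>A. dom_of c) = UNIV \<and>
    (\<forall>c\<in>A. \<forall>c'\<in>A. smooth_on (transition c c') (coord c ` (dom_of c \<inter> dom_of c')))"

definition Ck_function :: "('m, 'n::finite) chart set \<Rightarrow> nat \<Rightarrow> ('m \<Rightarrow> real) \<Rightarrow> bool"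
  where "Ck_function A k f \<longleftrightarrow> (\<forall>c\<in>A. Ck_on k (f \<circ> inv_coord c) (cod_of c))"


section \<open>Riemannian metrics\<close>

text \<open>
  A metric is given by its matrix of components \<open>g\<^sub>i\<^sub>j\<close> in each chart, as a function of the
  coordinates; the last condition is the transformation law of a covariant 2-tensor.
\<close>

type_synonym ('m, 'n) metric = "('m, 'n) chart \<Rightarrow> real ^ 'n \<Rightarrow> real ^ 'n ^ 'n"

definition riemannian_metric ::
    "('m::topological_space, 'n::finite) chart set \<Rightarrow> ('m, 'n) metric \<Rightarrow> bool"
  where "riemannian_metric A g \<longleftrightarrow>
    (\<forall>c\<in>A. smooth_on (g c) (cod_of c)) \<and>
    (\<forall>c\<in>A. \<forall>x\<in>cod_of c. transpose (g c x) = g c x \<and> (\<forall>v. v \<noteq> 0 \<longrightarrow> v \<bullet> (g c x *v v) > 0)) \<and>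
    (\<forall>c\<in>A. \<forall>c'\<in>A. \<forall>x\<in>coord c ` (dom_of c \<inter> dom_of c').
       let J = matrix (frechet_derivative (transition c c') (at x))
       in g c x = transpose J ** g c' (transition c c' x) ** J)"

text \<open>
  Closed: compact and without boundary (all charts map to open subsets of \<open>\<real>\<^sup>n\<close>). Second
  countability follows from compactness. Connectedness is not required.
\<close>

definition closed_riemannian_manifold ::
    "('m::t2_space, 'n::finite) chart set \<Rightarrow> ('m, 'n) metric \<Rightarrow> bool"
  where "closed_riemannian_manifold A g \<longleftrightarrow>
    smooth_atlas A \<and> riemannian_metric A g \<and> compact (UNIV :: 'm set)"

text \<open>The Borel measure with density \<open>sqrt (det g)\<close> with respect to Lebesgue measure in every chart; as the chart
  domains cover the manifold, these conditions determine it uniquely.\<close>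

definition riemannian_volume ::
    "('m::topological_space, 'n::finite) chart set \<Rightarrow> ('m, 'n) metric \<Rightarrow> 'm measure \<Rightarrow> bool"
  where "riemannian_volume A g \<mu> \<longleftrightarrow>
    sets \<mu> = sets borel \<and>
    (\<forall>c\<in>A. \<forall>B\<in>sets borel. B \<subseteq> dom_of c \<longrightarrow>
       emeasure \<mu> B = (\<integral>\<^sup>+ x \<in> coord c ` B. ennreal (sqrt (det (g c x))) \<partial>lborel))"


section \<open>Laplace--Beltrami operator and Ricci curvature in local coordinates\<close>

abbreviation partial :: "'n::finite \<Rightarrow> (real ^ 'n \<Rightarrow> real) \<Rightarrow> real ^ 'n \<Rightarrow> real"
  where "partial i \<equiv> partial_at (axis i 1)"

text \<open>In the following definitions, \<^term>\<open>G\<close> is the matrix of the metric in a fixed chart.\<close>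

definition laplacian_coord ::
    "(real ^ 'n \<Rightarrow> real ^ 'n ^ 'n) \<Rightarrow> (real ^ 'n::finite \<Rightarrow> real) \<Rightarrow> real ^ 'n \<Rightarrow> real"
  where "laplacian_coord G h x =
    (\<Sum>i\<in>UNIV. partial i (\<lambda>y. \<Sum>j\<in>UNIV. sqrt (det (G y)) * matrix_inv (G y) $ i $ j * partial j h y) x)
      / sqrt (det (G x))"

text \<open>\<^term>\<open>christoffel G l i j\<close> is \<open>\<Gamma>\<^sup>l\<^sub>i\<^sub>j\<close>.\<close>

definition christoffel ::
    "(real ^ 'n \<Rightarrow> real ^ 'n ^ 'n) \<Rightarrow> 'n::finite \<Rightarrow> 'n \<Rightarrow> 'n \<Rightarrow> real ^ 'n \<Rightarrow> real"
  where "christoffel G l i j x =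
    (\<Sum>m\<in>UNIV. matrix_inv (G x) $ l $ m *
       (partial i (\<lambda>y. G y $ j $ m) x + partial j (\<lambda>y. G y $ i $ m) x - partial m (\<lambda>y. G y $ i $ j) x)) / 2"

text \<open>\<^term>\<open>riemann_curvature G l k i j\<close> is the component along the \<open>l\<close>-th coordinate field of
  \<open>R(\<partial>\<^sub>i, \<partial>\<^sub>j) \<partial>\<^sub>k\<close>, where \<open>R(X, Y) = [\<nabla>\<^sub>X, \<nabla>\<^sub>Y] - \<nabla>\<^bsub>[X, Y]\<^esub>\<close>.\<close>

definition riemann_curvature ::
    "(real ^ 'n \<Rightarrow> real ^ 'n ^ 'n) \<Rightarrow> 'n::finite \<Rightarrow> 'n \<Rightarrow> 'n \<Rightarrow> 'n \<Rightarrow> real ^ 'n \<Rightarrow> real"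
  where "riemann_curvature G l k i j x =
    partial i (christoffel G l j k) x - partial j (christoffel G l i k) x
    + (\<Sum>m\<in>UNIV. christoffel G l i m x * christoffel G m j k x
                - christoffel G l j m x * christoffel G m i k x)"

text \<open>\<open>Ric(Y, Z)\<close> is the trace of \<open>X \<mapsto> R(X, Y) Z\<close>.\<close>

definition ricci :: "(real ^ 'n \<Rightarrow> real ^ 'n ^ 'n) \<Rightarrow> real ^ 'n::finite \<Rightarrow> real ^ 'n ^ 'n"
  where "ricci G x = (\<chi> j k. \<Sum>l\<in>UNIV. riemann_curvature G l k l j x)"

definition ricci_bounded_below ::
    "('m, 'n::finite) chart set \<Rightarrow> ('m, 'n) metric \<Rightarrow> real \<Rightarrow> bool"
  where "ricci_bounded_below A g k \<longleftrightarrow>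
    (\<forall>c\<in>A. \<forall>x\<in>cod_of c. \<forall>v. v \<bullet> (ricci (g c) x *v v) \<ge> k * (v \<bullet> (g c x *v v)))"

text \<open>The value at \<^term>\<open>p\<close> does not depend on the choice of a chart \<^term>\<open>c\<close> around \<^term>\<open>p\<close>.\<close>

definition laplace_beltrami ::
    "('m, 'n::finite) metric \<Rightarrow> ('m, 'n) chart \<Rightarrow> ('m \<Rightarrow> real) \<Rightarrow> 'm \<Rightarrow> real"
  where "laplace_beltrami g c u p = laplacian_coord (g c) (u \<circ> inv_coord c) (coord c p)"


section \<open>Heat flow and entropy\<close>

text \<open>
  The class \<open>C\<^sup>1\<^sup>,\<^sup>2\<close> on \<open>(0, \<infinity>) \<times> M\<close>: in every chart, one time derivative and two space
  derivatives exist and are jointly continuous.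
\<close>

definition C12_function ::
    "('m, 'n::finite) chart set \<Rightarrow> (real \<Rightarrow> 'm \<Rightarrow> real) \<Rightarrow> bool"
  where "C12_function A u \<longleftrightarrow>
    (\<forall>c\<in>A. let F = (\<lambda>t. u t \<circ> inv_coord c); D = {0<..} \<times> cod_of c in
       (\<forall>t>0. Ck_on 2 (F t) (cod_of c)) \<and>
       (\<forall>t>0. \<forall>x\<in>cod_of c. (\<lambda>s. F s x) differentiable (at t)) \<and>
       continuous_on D (\<lambda>(t, x). F t x) \<and>
       continuous_on D (\<lambda>(t, x). deriv (\<lambda>s. F s x) t) \<and>
       (\<forall>i. continuous_on D (\<lambda>(t, x). partial i (F t) x)) \<and>
       (\<forall>i j. continuous_on D (\<lambda>(t, x). partial i (partial j (F t)) x)))"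

text \<open>Classical solutions of the initial value problem for \<open>\<partial>u/\<partial>t = \<Delta>u / 2\<close>. Only the values
  \<^term>\<open>u t\<close> with \<open>t \<ge> 0\<close> are relevant, and these are uniquely determined by \<^term>\<open>f\<close>.\<close>

definition heat_solution ::
    "('m::topological_space, 'n::finite) chart set \<Rightarrow> ('m, 'n) metric \<Rightarrow>
     ('m \<Rightarrow> real) \<Rightarrow> (real \<Rightarrow> 'm \<Rightarrow> real) \<Rightarrow> bool"
  where "heat_solution A g f u \<longleftrightarrow>
    continuous_on ({0..} \<times> UNIV) (\<lambda>(t, p). u t p) \<and>
    C12_function A u \<and>
    (\<forall>t>0. \<forall>c\<in>A. \<forall>p\<in>dom_of c.
       ((\<lambda>s. u s p) has_real_derivative (1 / 2 * laplace_beltrami g c (u t) p)) (at t)) \<and>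
    u 0 = f"

definition Ent :: "'m measure \<Rightarrow> ('m \<Rightarrow> real) \<Rightarrow> real"
  where "Ent \<mu> u = - (\<integral>p. u p * ln (u p) \<partial>\<mu>)"

end

theory Submission
  imports Defs
begin

text \<open>
  Write \<open>e(t) = \<integral>|\<nabla>u\<^sub>t|\<^sup>2\<close>. The minimum principle gives \<open>u \<ge> m > 0\<close>, so that
  \<open>d/dt Ent(u\<^sub>t) = 1/2 \<integral>|\<nabla>u\<^sub>t|\<^sup>2 / u\<^sub>t \<le> e(t) / (2m)\<close>, and it suffices to control \<open>e\<close>.
  Symmetry of the Laplacian shows that \<open>\<integral>u\<^sub>s u\<^sub>t\<close> depends only on \<open>s + t\<close>, also for \<open>s = 0\<close>.
  Differentiating this identity yields \<open>e(t) = \<integral>\<langle>\<nabla>f, \<nabla>u\<^bsub>2t\<^esub>\<rangle>\<close>, whence \<open>e \<le> e(0)\<close>, and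
  \<open>e(t) = -2 \<integral>u\<^bsub>2t-s\<^esub> \<partial>\<^sub>su\<^sub>s\<close>, whence \<open>e'(s) = -4 \<integral>(\<partial>\<^sub>su\<^sub>s)\<^sup>2 \<le> 0\<close>. As the integral of \<open>e\<close> is
  bounded by \<open>\<integral>u\<^sup>2\<close>, monotonicity gives \<open>e(t) = O(1/t)\<close>; together with the Poincare inequality
  it gives exponential decay.
\<close>

section \<open>Functions of class \<open>C\<^sup>1\<close> on Euclidean space\<close>

text \<open>The regularity of solutions shapes the argument: for t > 0 they are C^1 in time and C^2
  in space, at t = 0 only continuity is given, and no mixed derivative in time and space is
  available. Hence e cannot be differentiated under the integral sign. Products of the solution at
  two different times avoid this: only time derivatives are taken, and Green's identity between a
  C^1 and a C^2 function turns them into products of first derivatives. Allowing one of the two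
  times to be 0 brings in the C^1 initial value directly, where no convergence of gradients as t ->
  0 is known. The Dirichlet form does not see functions that are constant on clopen pieces, so the
  integral of u^2 need not tend to zero and has to be compared with its conserved part. For negative
  k the number -nk/2 is positive, so any rate that tends to zero finally falls below it.\<close>

definition grad :: "(real ^ 'n \<Rightarrow> real) \<Rightarrow> real ^ 'n::finite \<Rightarrow> real ^ 'n"
  where "grad h x = (\<chi> i. partial i h x)"

text \<open>Agrees with \<open>Ck_on 1\<close>; collecting the partial derivatives in one vector
  turns the rules of calculus into identities of gradients.\<close>

definition C1_on :: "(real ^ 'n::finite \<Rightarrow> real) \<Rightarrow> (real ^ 'n) set \<Rightarrow> bool"
  where "C1_on h S \<longleftrightarrow> (\<forall>x\<in>S. h differentiable (at x)) \<and> continuous_on S (grad h)"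

lemma has_derivative_grad:
  assumes "h differentiable (at x)"
  shows "(h has_derivative (\<lambda>y. grad h x \<bullet> y)) (at x)"
proof -
  let ?D = "frechet_derivative h (at x)"
  have D: "(h has_derivative ?D) (at x)"
    using assms frechet_derivative_works by blast
  then have lin: "linear ?D"
    by (rule has_derivative_linear)
  have "?D y = grad h x \<bullet> y" for y
  proof -
    have "?D y = ?D (\<Sum>i\<in>UNIV. (y $ i) *\<^sub>R axis i 1)"
      using basis_expansion[of y] by (simp add: scalar_mult_eq_scaleR)
    also have "\<dots> = (\<Sum>i\<in>UNIV. y $ i * ?D (axis i 1))"
      by (simp add: linear_sum[OF lin] linear_cmul[OF lin])
    finally show ?thesis
      by (simp add: grad_def partial_at_def inner_vec_def mult.commute)
  qed
  then have "?D = (\<lambda>y. grad h x \<bullet> y)" by blast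
  with D show ?thesis by simp
qed

lemma grad_eqI:
  assumes "(h has_derivative (\<lambda>y. d \<bullet> y)) (at x)"
  shows "grad h x = d"
proof -
  have "frechet_derivative h (at x) = (\<lambda>y. d \<bullet> y)"
    using frechet_derivative_at[OF assms] by simp
  then show ?thesis
    by (simp add: grad_def partial_at_def vec_eq_iff inner_axis)
qed

lemma grad_nth: "grad h x $ i = partial i h x"
  by (simp add: grad_def)

lemma C1_onI:
  assumes "\<And>x. x \<in> S \<Longrightarrow> (h has_derivative (\<lambda>y. D x \<bullet> y)) (at x)" "continuous_on S D"
  shows "C1_on h S"
proof -
  have "continuous_on S (grad h)"
    using assms(2) grad_eqI[OF assms(1)] by (metis (no_types, lifting) continuous_on_cong)
  then show ?thesis
    using assms(1) by (auto simp: C1_on_def differentiable_def)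
qed

lemma C1_onD:
  assumes "C1_on h S" "x \<in> S"
  shows "(h has_derivative (\<lambda>y. grad h x \<bullet> y)) (at x)"
  using assms has_derivative_grad by (auto simp: C1_on_def)

lemma C1_on_grad: "C1_on h S \<Longrightarrow> continuous_on S (grad h)"
  by (simp add: C1_on_def)

lemma C1_on_continuous: "C1_on h S \<Longrightarrow> continuous_on S h"
  by (simp add: C1_on_def continuous_at_imp_continuous_on differentiable_imp_continuous_within)

lemma C1_on_union:
  assumes "open S" "open T" "C1_on h S" "C1_on h T"
  shows "C1_on h (S \<union> T)"
  using assms by (auto simp: C1_on_def intro: continuous_on_open_Un)

lemma grad_cong_open:
  assumes "open S" "x \<in> S" "\<And>y. y \<in> S \<Longrightarrow> h y = h' y"
  shows "grad h x = grad h' x"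
proof -
  \<comment> \<open>Both functions have the same derivatives at x, so the choice inside
    \<open>frechet_derivative\<close> returns the same map, whether or not they are
    differentiable.\<close>
  have "(h has_derivative D) (at x) \<longleftrightarrow> (h' has_derivative D) (at x)" for D
    using assms by (metis has_derivative_transform_within_open)
  then have "frechet_derivative h (at x) = frechet_derivative h' (at x)"
    by (simp add: frechet_derivative_def)
  then show ?thesis by (simp add: grad_def partial_at_def)
qed

lemma C1_on_cong:
  assumes "open S" "\<And>y. y \<in> S \<Longrightarrow> h y = h' y" "C1_on h S"
  shows "C1_on h' S"
proof (rule C1_onI[where D = "grad h"])
  show "(h' has_derivative (\<lambda>y. grad h x \<bullet> y)) (at x)" if "x \<in> S" for x
    using has_derivative_transform_within_open[OF C1_onD[OF assms(3) that] assms(1) that] assms(2)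
    by simp
qed (use assms in \<open>simp add: C1_on_def\<close>)

lemma C1_on_const: "C1_on (\<lambda>x. c) S"
  by (rule C1_onI[where D = "\<lambda>_. 0"]) auto

lemma grad_const: "grad (\<lambda>x. c) x = 0"
  by (rule grad_eqI) simp

lemma
  assumes "C1_on h S" "C1_on k S"
  shows C1_on_add: "C1_on (\<lambda>x. h x + k x) S"
    and grad_add: "x \<in> S \<Longrightarrow> grad (\<lambda>x. h x + k x) x = grad h x + grad k x"
proof -
  have *: "((\<lambda>x. h x + k x) has_derivative (\<lambda>y. (grad h x + grad k x) \<bullet> y)) (at x)" if "x \<in> S" for x
    using has_derivative_add[OF C1_onD[OF assms(1) that] C1_onD[OF assms(2) that]]
    by (simp add: inner_add_left)
  show "C1_on (\<lambda>x. h x + k x) S"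
    by (rule C1_onI[OF *]) (use assms in \<open>auto intro!: continuous_intros dest: C1_on_grad\<close>)
  show "x \<in> S \<Longrightarrow> grad (\<lambda>x. h x + k x) x = grad h x + grad k x"
    by (rule grad_eqI[OF *])
qed

lemma
  assumes "C1_on h S" "C1_on k S"
  shows C1_on_mult: "C1_on (\<lambda>x. h x * k x) S"
    and grad_mult: "x \<in> S \<Longrightarrow> grad (\<lambda>x. h x * k x) x = h x *\<^sub>R grad k x + k x *\<^sub>R grad h x"
proof -
  have *: "((\<lambda>x. h x * k x) has_derivative (\<lambda>y. (h x *\<^sub>R grad k x + k x *\<^sub>R grad h x) \<bullet> y)) (at x)"
    if "x \<in> S" for x
    using has_derivative_mult[OF C1_onD[OF assms(1) that] C1_onD[OF assms(2) that]]
    by (simp add: inner_add_left mult.commute)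
  show "C1_on (\<lambda>x. h x * k x) S"
    by (rule C1_onI[OF *])
       (use assms in \<open>auto intro!: continuous_intros dest: C1_on_grad C1_on_continuous\<close>)
  show "x \<in> S \<Longrightarrow> grad (\<lambda>x. h x * k x) x = h x *\<^sub>R grad k x + k x *\<^sub>R grad h x"
    by (rule grad_eqI[OF *])
qed

lemma
  fixes F F' :: "real \<Rightarrow> real"
  assumes h: "C1_on h S" and F: "\<And>x. x \<in> S \<Longrightarrow> (F has_real_derivative F' (h x)) (at (h x))"
    and cont: "continuous_on (h ` S) F'"
  shows C1_on_compose: "C1_on (\<lambda>x. F (h x)) S"
    and grad_compose: "x \<in> S \<Longrightarrow> grad (\<lambda>x. F (h x)) x = F' (h x) *\<^sub>R grad h x"
proof -
  have *: "((\<lambda>x. F (h x)) has_derivative (\<lambda>y. (F' (h x) *\<^sub>R grad h x) \<bullet> y)) (at x)"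
    if "x \<in> S" for x
    using has_derivative_compose[OF C1_onD[OF h that] F[OF that, unfolded has_field_derivative_def]]
    by simp
  have "continuous_on S (\<lambda>x. F' (h x))"
    using continuous_on_compose2[OF cont C1_on_continuous[OF h]] by auto
  then show "C1_on (\<lambda>x. F (h x)) S"
    by (intro C1_onI[OF *]) (use h in \<open>auto intro!: continuous_intros dest: C1_on_grad\<close>)
  show "x \<in> S \<Longrightarrow> grad (\<lambda>x. F (h x)) x = F' (h x) *\<^sub>R grad h x"
    by (rule grad_eqI[OF *])
qed

lemma C1_on_sum: "(\<And>i. i \<in> I \<Longrightarrow> C1_on (h i) S) \<Longrightarrow> C1_on (\<lambda>x. \<Sum>i\<in>I. h i x) S"
  by (induction I rule: infinite_finite_induct) (auto intro: C1_on_const C1_on_add)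

lemma C1_on_prod: "(\<And>i. i \<in> I \<Longrightarrow> C1_on (h i) S) \<Longrightarrow> C1_on (\<lambda>x. \<Prod>i\<in>I. h i x) S"
  by (induction I rule: infinite_finite_induct) (auto intro: C1_on_const C1_on_mult)

lemma Ck_on_1_iff:
  fixes h :: "real ^ 'n::finite \<Rightarrow> real"
  shows "Ck_on 1 h S \<longleftrightarrow> C1_on h S"
proof -
  have "(\<forall>b\<in>Basis. continuous_on S (partial_at b h)) \<longleftrightarrow> continuous_on S (grad h)"
    unfolding continuous_on_componentwise[of S "grad h"]
    by (auto simp: Basis_vec_def grad_def inner_axis)
  then show ?thesis by (auto simp: C1_on_def)
qed

lemma Ck_on_2D:
  fixes h :: "real ^ 'n::finite \<Rightarrow> real"
  assumes "Ck_on 2 h S"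
  shows "C1_on h S" "C1_on (partial i h) S"
proof -
  have C: "\<forall>b\<in>Basis. Ck_on 1 (partial_at b h) S" and d: "\<forall>x\<in>S. h differentiable (at x)"
    using assms by (auto simp: numeral_2_eq_2)
  have *: "C1_on (partial_at b h) S" if "b \<in> Basis" for b
    using C that Ck_on_1_iff by blast
  show "C1_on (partial i h) S"
    by (rule *) simp
  have "Ck_on 1 h S"
    using d * by (auto intro: C1_on_continuous)
  then show "C1_on h S" by (simp only: Ck_on_1_iff)
qed

section \<open>Determinants and inverses of matrix-valued functions\<close>

lemma C1_on_det:
  fixes G :: "real ^ 'n::finite \<Rightarrow> real ^ 'm ^ 'm::finite"
  assumes "\<And>i j. C1_on (\<lambda>x. G x $ i $ j) S"
  shows "C1_on (\<lambda>x. det (G x)) S"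
  unfolding det_def by (intro C1_on_sum C1_on_mult C1_on_const C1_on_prod assms)

lemma
  fixes M :: "'a::semiring_1 ^ 'n ^ 'm"
  assumes "invertible M"
  shows matrix_inv_right: "M ** matrix_inv M = mat 1"
    and matrix_inv_left: "matrix_inv M ** M = mat 1"
  using someI_ex[OF assms[unfolded invertible_def]] by (simp_all add: matrix_inv_def)

text \<open>Cramer's rule for a column of the identity. It expresses the inverse through
  determinants, so that its regularity follows from that of polynomials in the entries.\<close>

lemma matrix_inv_nth:
  fixes M :: "real ^ 'n ^ 'n::finite"
  assumes "det M \<noteq> 0"
  shows "matrix_inv M $ i $ j = det (\<chi> k l. if l = i then axis j 1 $ k else M $ k $ l) * inverse (det M)"
proof -
  have "M ** matrix_inv M = mat 1"
    using assms matrix_inv_right invertible_det_nz by blast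
  then have "M *v (matrix_inv M *v axis j 1) = axis j 1"
    by (simp add: matrix_vector_mul_assoc)
  then have "matrix_inv M *v axis j 1
      = (\<chi> i. det (\<chi> k l. if l = i then axis j 1 $ k else M $ k $ l) / det M)"
    using cramer[OF assms] by blast
  moreover have "(matrix_inv M *v axis j 1) $ i = matrix_inv M $ i $ j"
    by (simp add: matrix_vector_mul_component inner_axis)
  ultimately show ?thesis by (simp add: divide_inverse)
qed

lemma C1_on_matrix_inv:
  fixes G :: "real ^ 'n::finite \<Rightarrow> real ^ 'm ^ 'm::finite"
  assumes S: "open S" and G: "\<And>i j. C1_on (\<lambda>x. G x $ i $ j) S" and det: "\<And>x. x \<in> S \<Longrightarrow> det (G x) \<noteq> 0"
  shows "C1_on (\<lambda>x. matrix_inv (G x) $ i $ j) S"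
proof -
  have "C1_on (\<lambda>x. det (\<chi> k l. if l = i then axis j 1 $ k else G x $ k $ l) * inverse (det (G x))) S"
  proof (intro C1_on_mult C1_on_det)
    show "C1_on (\<lambda>x. (\<chi> k l. if l = i then axis j 1 $ k else G x $ k $ l) $ k $ l) S" for k l
      using G C1_on_const by (cases "l = i") auto
    show "C1_on (\<lambda>x. inverse (det (G x))) S"
      by (rule C1_on_compose[OF C1_on_det[OF G], where F' = "\<lambda>y. - inverse (y ^ 2)"])
         (use det in \<open>auto intro!: derivative_eq_intros continuous_intros simp: power2_eq_square\<close>)
  qed
  then show ?thesis
    by (rule C1_on_cong[OF S, rotated]) (simp add: matrix_inv_nth det)
qed

section \<open>The divergence theorem and the Poincare inequality on balls\<close>

text \<open>Lebesgue measure is translation invariant, so every difference quotient of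
  \<open>Y\<close> in direction \<open>b\<close> has integral zero; dominated convergence passes
  this on to the derivative.\<close>

lemma integral_directional_derivative_eq_0:
  fixes Y Y' :: "'a::euclidean_space \<Rightarrow> real"
  assumes deriv: "\<And>x. ((\<lambda>t. Y (x + t *\<^sub>R b)) has_real_derivative Y' x) (at 0)"
    and cont: "continuous_on UNIV Y" "continuous_on UNIV Y'"
    and K: "compact K" "\<And>x. x \<notin> K \<Longrightarrow> Y x = 0" "\<And>x. x \<notin> K \<Longrightarrow> Y' x = 0"
  shows "integral\<^sup>L lborel Y' = 0"
proof -
  define q where "q n x = (Y (x + inverse (real (Suc n)) *\<^sub>R b) - Y x) / inverse (real (Suc n))" for n x
  have [measurable]: "Y \<in> borel_measurable borel" "Y' \<in> borel_measurable borel"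
    using cont by (auto intro: borel_measurable_continuous_onI)
  have Y: "integrable lborel Y"
  proof -
    have "integrable lborel (\<lambda>x. indicator K x *\<^sub>R Y x)"
      using K cont by (intro borel_integrable_compact) (auto intro: continuous_on_subset)
    also have "(\<lambda>x. indicator K x *\<^sub>R Y x) = Y"
      using K(2) by (intro ext) (auto split: split_indicator)
    finally show ?thesis .
  qed
  have shift: "integrable lborel (\<lambda>x. Y (x + c))" "(\<integral>x. Y (x + c) \<partial>lborel) = (\<integral>x. Y x \<partial>lborel)" for c
  proof -
    have "integrable (distr lborel borel ((+) c)) Y" using Y by (simp add: lborel_distr_plus)
    then show "integrable lborel (\<lambda>x. Y (x + c))"
      by (subst (asm) integrable_distr_eq) (auto simp: add.commute)
    have "(\<integral>x. Y x \<partial>lborel) = (\<integral>x. Y x \<partial>distr lborel borel ((+) c))"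
      by (simp add: lborel_distr_plus)
    also have "\<dots> = (\<integral>x. Y (x + c) \<partial>lborel)"
      by (subst integral_distr) (auto simp: add.commute)
    finally show "(\<integral>x. Y (x + c) \<partial>lborel) = (\<integral>x. Y x \<partial>lborel)" by simp
  qed
  have q0: "integral\<^sup>L lborel (q n) = 0" for n
    unfolding q_def using shift[of "inverse (real (Suc n)) *\<^sub>R b"] Y by simp
  obtain M where M: "\<And>x. \<bar>Y' x\<bar> \<le> M" "M \<ge> 0"
  proof -
    have "bounded (Y' ` K)"
      using K cont by (intro compact_imp_bounded compact_continuous_image) (auto intro: continuous_on_subset)
    then obtain M where M: "M > 0" "\<forall>x\<in>K. \<bar>Y' x\<bar> \<le> M"
      by (auto simp: bounded_pos)
    then have "\<bar>Y' x\<bar> \<le> M" for x by (cases "x \<in> K") (auto simp: K)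
    with M that show thesis by force
  qed
  obtain r where r: "K \<subseteq> cball 0 r"
    using compact_imp_bounded[OF K(1)] by (force simp: bounded_pos)
  have quot: "\<exists>z. 0 < z \<and> z < h \<and> (Y (x + h *\<^sub>R b) - Y x) / h = Y' (x + z *\<^sub>R b)" if "h > 0" for h x
  proof -
    have der: "((\<lambda>t. Y (x + t *\<^sub>R b)) has_real_derivative Y' (x + s *\<^sub>R b)) (at s)" for s
    proof -
      have "((\<lambda>t. Y (x + s *\<^sub>R b + t *\<^sub>R b)) has_real_derivative Y' (x + s *\<^sub>R b)) (at (s + - s))"
        using deriv[of "x + s *\<^sub>R b"] by simp
      then have "((\<lambda>t. Y (x + s *\<^sub>R b + (t + (- s)) *\<^sub>R b)) has_real_derivative Y' (x + s *\<^sub>R b)) (at s)"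
        by (rule DERIV_shift[THEN iffD1])
      then show ?thesis by (simp add: algebra_simps)
    qed
    obtain z where "0 < z" "z < h" "Y (x + h *\<^sub>R b) - Y (x + 0 *\<^sub>R b) = (h - 0) * Y' (x + z *\<^sub>R b)"
      using MVT2[OF \<open>h > 0\<close>, of "\<lambda>t. Y (x + t *\<^sub>R b)" "\<lambda>s. Y' (x + s *\<^sub>R b)"] der by blast
    with that show ?thesis by (intro exI[of _ z]) (auto simp: field_simps)
  qed
  \<comment> \<open>By the mean value theorem \<open>q n x\<close> is a value of \<open>Y'\<close>
    at a point at distance at most \<open>norm b\<close> from x, so it is bounded by
    \<open>M\<close> and vanishes outside the enlarged ball.\<close>
  have "(\<lambda>n. integral\<^sup>L lborel (q n)) \<longlonglongrightarrow> integral\<^sup>L lborel Y'"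
  proof (rule integral_dominated_convergence[where w = "\<lambda>x. M * indicator (cball 0 (r + norm b)) x"])
    show "integrable (lborel :: 'a measure) (\<lambda>x. M * indicator (cball 0 (r + norm b)) x)"
      using emeasure_bounded_finite[OF bounded_cball, of "0 :: 'a" "r + norm b"]
      by (intro integrable_mult_right integrable_real_indicator) auto
    show "AE x in lborel. (\<lambda>n. q n x) \<longlonglongrightarrow> Y' x"
    proof (rule AE_I2)
      fix x
      have lim: "((\<lambda>t. (Y (x + t *\<^sub>R b) - Y x) / t) \<longlongrightarrow> Y' x) (at 0)"
        using deriv[of x] by (simp add: has_field_derivative_iff)
      have "filterlim (\<lambda>n. inverse (real (Suc n))) (at 0) sequentially"
        unfolding filterlim_at using LIMSEQ_inverse_real_of_nat by simp
      from filterlim_compose[OF lim this] show "(\<lambda>n. q n x) \<longlonglongrightarrow> Y' x"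
        by (simp add: q_def)
    qed
    show "AE x in lborel. norm (q n x) \<le> M * indicator (cball 0 (r + norm b)) x" for n
    proof (rule AE_I2)
      fix x
      obtain z where z: "0 < z" "z < inverse (real (Suc n))" "q n x = Y' (x + z *\<^sub>R b)"
        using quot[of "inverse (real (Suc n))" x] by (auto simp: q_def)
      have "z \<le> 1" using z(2) by (smt (verit) inverse_le_1_iff of_nat_Suc of_nat_0_le_iff)
      show "norm (q n x) \<le> M * indicator (cball 0 (r + norm b)) x"
      proof (cases "x \<in> cball 0 (r + norm b)")
        case True then show ?thesis using M z by simp
      next
        case False
        have "norm x \<le> norm (x + z *\<^sub>R b) + norm (z *\<^sub>R b)"
          by (metis add_diff_cancel_right' norm_triangle_ineq4)
        also have "norm (z *\<^sub>R b) \<le> norm b" using z \<open>z \<le> 1\<close> by (simp add: mult_left_le_one_le)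
        finally have "x + z *\<^sub>R b \<notin> K" using False r by auto
        then show ?thesis using z K False by simp
      qed
    qed
  qed (simp_all add: q_def[abs_def])
  then show ?thesis by (simp add: q0 LIMSEQ_const_iff)
qed

section \<open>The Poincare inequality on Euclidean balls\<close>

lemma nn_integral_affine_le:
  fixes \<gamma> :: "'a::euclidean_space \<Rightarrow> ennreal"
  assumes [measurable]: "\<gamma> \<in> borel_measurable borel" and c: "c \<ge> 1 / 2"
  shows "(\<integral>\<^sup>+y. \<gamma> (t + c *\<^sub>R y) \<partial>lborel) \<le> 2 ^ DIM('a) * (\<integral>\<^sup>+y. \<gamma> y \<partial>lborel)"
proof -
  let ?X = "\<integral>\<^sup>+y. \<gamma> (t + c *\<^sub>R y) \<partial>lborel"
  have "(\<integral>\<^sup>+y. \<gamma> y \<partial>lborel)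
      = (\<integral>\<^sup>+y. \<gamma> y \<partial>density (distr lborel borel (\<lambda>x. t + c *\<^sub>R x)) (\<lambda>_. \<bar>c\<bar> ^ DIM('a)))"
    using lborel_affine[of c t] c by simp
  also have "\<dots> = ennreal (\<bar>c\<bar> ^ DIM('a)) * ?X"
    by (simp add: nn_integral_density nn_integral_cmult nn_integral_distr)
  finally have eq: "(\<integral>\<^sup>+y. \<gamma> y \<partial>lborel) = ennreal (\<bar>c\<bar> ^ DIM('a)) * ?X" .
  \<comment> \<open>The Jacobian factor \<open>\<bar>c\<bar> ^ DIM('a)\<close> may be as small as
    \<open>(1/2) ^ DIM('a)\<close>; this is the origin of \<open>2 ^ DIM('a)\<close>.\<close>
  have "1 \<le> (2 * \<bar>c\<bar>) ^ DIM('a)" using c by (intro one_le_power) auto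
  then have "?X \<le> ennreal ((2 * \<bar>c\<bar>) ^ DIM('a)) * ?X"
    by (metis ennreal_1 ennreal_leI mult_1 mult_right_mono zero_le)
  also have "\<dots> = 2 ^ DIM('a) * (ennreal (\<bar>c\<bar> ^ DIM('a)) * ?X)"
    by (simp add: power_mult_distrib ennreal_mult ennreal_power flip: mult.assoc ennreal_numeral)
  finally show ?thesis by (simp add: eq)
qed

text \<open>The fundamental theorem of calculus along the segment, followed by the Cauchy-Schwarz
  inequality in the parameter s.\<close>

lemma square_diff_le_segment_integral:
  assumes w: "C1_on w S" and seg: "closed_segment x y \<subseteq> S"
  shows "ennreal ((w x - w y)\<^sup>2) \<le> ennreal ((norm (y - x))\<^sup>2) *
    (\<integral>\<^sup>+s. indicator {0..1} s * ennreal ((norm (grad w ((1 - s) *\<^sub>R x + s *\<^sub>R y)))\<^sup>2) \<partial>lborel)"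
proof -
  let ?p = "\<lambda>s::real. (1 - s) *\<^sub>R x + s *\<^sub>R y"
  let ?I = "\<lambda>f::real \<Rightarrow> real. integral\<^sup>L lborel (\<lambda>s. indicator {0..1} s *\<^sub>R f s)"
  define q where "q s = norm (grad w (?p s))" for s
  have p: "?p s \<in> S" if "s \<in> {0..1}" for s
    using that seg by (auto simp: closed_segment_def)
  have cg: "continuous_on {0..1} (\<lambda>s. grad w (?p s))"
    by (rule continuous_on_compose2[OF C1_on_grad[OF w]]) (auto intro!: continuous_intros p)
  have cq: "continuous_on {0..1} q"
    unfolding q_def by (intro continuous_intros cg)
  have int: "integrable lborel (\<lambda>s. indicator {0..1} s *\<^sub>R f s)" if "continuous_on {0..1} f" for f :: "real \<Rightarrow> real"
    using that by (intro borel_integrable_compact) auto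
  have der: "((\<lambda>s. w (?p s)) has_vector_derivative (grad w (?p s) \<bullet> (y - x))) (at s within {0..1})"
    if "0 \<le> s" "s \<le> 1" for s
  proof -
    have "(?p has_derivative (\<lambda>h. h *\<^sub>R (y - x))) (at s within {0..1})"
      by (auto intro!: derivative_eq_intros simp: algebra_simps)
    from has_derivative_compose[OF this C1_onD[OF w p]] that show ?thesis
      by (simp add: has_vector_derivative_def)
  qed
  have "w y - w x = ?I (\<lambda>s. grad w (?p s) \<bullet> (y - x))"
    using integral_FTC_Icc[OF zero_le_one der] cg by (simp add: continuous_intros)
  then have "\<bar>w y - w x\<bar> = \<bar>?I (\<lambda>s. grad w (?p s) \<bullet> (y - x))\<bar>" by simp
  also have "\<dots> \<le> ?I (\<lambda>s. \<bar>grad w (?p s) \<bullet> (y - x)\<bar>)"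
    using integral_abs_bound[of lborel "\<lambda>s. indicator {0..1} s *\<^sub>R (grad w (?p s) \<bullet> (y - x))"]
    by (simp add: abs_mult)
  also have "\<dots> \<le> ?I (\<lambda>s. q s * norm (y - x))"
    unfolding q_def
    by (intro integral_mono int continuous_intros cg scaleR_left_mono Cauchy_Schwarz_ineq2) auto
  also have "\<dots> = norm (y - x) * ?I q"
    by (subst integral_mult_right_zero[symmetric]) (simp add: mult_ac)
  finally have 1: "(w x - w y)\<^sup>2 \<le> (norm (y - x))\<^sup>2 * (?I q)\<^sup>2"
    by (metis abs_ge_zero abs_minus_commute power2_abs power_mono power_mult_distrib)
  \<comment> \<open>Nonnegativity of the variance of \<open>q\<close> on the unit interval: the
    square of the mean is at most the mean of the square.\<close>
  have "0 \<le> ?I (\<lambda>s. (q s - ?I q)\<^sup>2)"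
    by (intro Bochner_Integration.integral_nonneg) auto
  also have "?I (\<lambda>s. (q s - ?I q)\<^sup>2) = ?I (\<lambda>s. (q s)\<^sup>2 + ((- 2 * ?I q) * q s + (?I q)\<^sup>2))"
    by (simp add: power2_diff algebra_simps)
  also have "\<dots> = ?I (\<lambda>s. (q s)\<^sup>2) + ((- 2 * ?I q) * ?I q + (?I q)\<^sup>2)"
  proof -
    have "?I (\<lambda>s. (q s)\<^sup>2 + ((- 2 * ?I q) * q s + (?I q)\<^sup>2))
        = ?I (\<lambda>s. (q s)\<^sup>2) + ?I (\<lambda>s. ((- 2 * ?I q) * q s + (?I q)\<^sup>2))"
      unfolding scaleR_add_right[of _ "(q _)\<^sup>2"]
      by (intro Bochner_Integration.integral_add int continuous_intros cq)
    also have "?I (\<lambda>s. ((- 2 * ?I q) * q s + (?I q)\<^sup>2)) = ?I (\<lambda>s. (- 2 * ?I q) * q s) + ?I (\<lambda>s. (?I q)\<^sup>2)"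
      unfolding scaleR_add_right
      by (intro Bochner_Integration.integral_add int continuous_intros cq)
    also have "?I (\<lambda>s. (- 2 * ?I q) * q s) = (- 2 * ?I q) * ?I q"
      by (subst integral_mult_right_zero[symmetric]) (simp add: mult_ac)
    finally show ?thesis by simp
  qed
  finally have "(?I q)\<^sup>2 \<le> ?I (\<lambda>s. (q s)\<^sup>2)"
    by (simp add: power2_eq_square)
  then have "(w x - w y)\<^sup>2 \<le> (norm (y - x))\<^sup>2 * ?I (\<lambda>s. (q s)\<^sup>2)"
    using 1 by (meson mult_left_mono order_trans zero_le_power2)
  then have "ennreal ((w x - w y)\<^sup>2) \<le> ennreal ((norm (y - x))\<^sup>2) * ennreal (?I (\<lambda>s. (q s)\<^sup>2))"
    by (simp add: ennreal_leI flip: ennreal_mult')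
  also have "ennreal (?I (\<lambda>s. (q s)\<^sup>2)) = (\<integral>\<^sup>+s. ennreal (indicator {0..1} s *\<^sub>R (q s)\<^sup>2) \<partial>lborel)"
    by (intro nn_integral_eq_integral[symmetric] int continuous_intros cq) auto
  also have "\<dots> = (\<integral>\<^sup>+s. indicator {0..1} s * ennreal ((q s)\<^sup>2) \<partial>lborel)"
    by (intro nn_integral_cong) (auto split: split_indicator)
  finally show ?thesis by (simp add: q_def)
qed

text \<open>After the segment estimate, \<open>\<gamma>\<close> is evaluated at (1 - s) x + s y. One
  of the two coefficients is at least 1/2, and integrating in that variable first costs only
  \<open>2 ^ CARD('n)\<close>, uniformly in s. The factor \<open>4 * r\<^sup>2\<close> bounds the
  squared distance of two points of the ball.\<close>

lemma double_integral_square_diff_le: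
  fixes w :: "real ^ 'n::finite \<Rightarrow> real"
  assumes w: "C1_on w S" and B: "ball z r \<subseteq> S" "r > 0"
  defines "\<gamma> \<equiv> \<lambda>x. indicator (ball z r) x * ennreal ((norm (grad w x))\<^sup>2)"
  shows "(\<integral>\<^sup>+x. (\<integral>\<^sup>+y. indicator (ball z r) x * indicator (ball z r) y * ennreal ((w x - w y)\<^sup>2) \<partial>lborel) \<partial>lborel)
    \<le> ennreal (4 * r\<^sup>2) * (2 ^ CARD('n) * emeasure lborel (ball z r) * (\<integral>\<^sup>+x. \<gamma> x \<partial>lborel))"
proof -
  let ?B = "ball z r" and ?i = "indicator (ball z r) :: real ^ 'n \<Rightarrow> ennreal"
  define P where "P s x y = ?i x * ?i y * \<gamma> ((1 - s) *\<^sub>R x + s *\<^sub>R y)" for s x y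
  have [measurable]: "\<gamma> \<in> borel_measurable borel"
  proof -
    have "(\<lambda>x. indicator ?B x *\<^sub>R (norm (grad w x))\<^sup>2) \<in> borel_measurable borel"
      using continuous_on_subset[OF C1_on_grad[OF w] B(1)]
      by (intro borel_measurable_continuous_on_indicator continuous_intros) auto
    then have "(\<lambda>x. ennreal (indicator ?B x *\<^sub>R (norm (grad w x))\<^sup>2)) \<in> borel_measurable borel"
      by measurable
    also have "(\<lambda>x. ennreal (indicator ?B x *\<^sub>R (norm (grad w x))\<^sup>2)) = \<gamma>"
      by (auto simp: \<gamma>_def split: split_indicator)
    finally show ?thesis .
  qed
  define j where "j = ?i"
  have [measurable]: "j \<in> borel_measurable borel"
    unfolding j_def by (rule borel_measurable_indicator) simp
  have P_j: "P s x y = j x * j y * \<gamma> ((1 - s) *\<^sub>R x + s *\<^sub>R y)" for s x y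
    by (simp add: P_def j_def)
  have pt: "?i x * ?i y * ennreal ((w x - w y)\<^sup>2)
      \<le> ennreal (4 * r\<^sup>2) * (\<integral>\<^sup>+s. indicator {0..1} s * P s x y \<partial>lborel)" for x y
  proof (cases "x \<in> ?B \<and> y \<in> ?B")
    case True
    have conv: "(1 - s) *\<^sub>R x + s *\<^sub>R y \<in> ?B" if "s \<in> {0..1}" for s
      using True that convexD_alt[OF convex_ball, of x z r y s] by auto
    have "closed_segment x y \<subseteq> S"
      using B conv by (auto simp: closed_segment_def)
    note square_diff_le_segment_integral[OF w this]
    also have "(\<integral>\<^sup>+s. indicator {0..1} s * ennreal ((norm (grad w ((1 - s) *\<^sub>R x + s *\<^sub>R y)))\<^sup>2) \<partial>lborel)
        = (\<integral>\<^sup>+s. indicator {0..1} s * P s x y \<partial>lborel)"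
      using True conv by (intro nn_integral_cong) (auto simp: P_def \<gamma>_def split: split_indicator)
    also have "ennreal ((norm (y - x))\<^sup>2) \<le> ennreal (4 * r\<^sup>2)"
    proof -
      have "norm (y - x) \<le> 2 * r"
        using True dist_triangle2[of y x z] by (auto simp: dist_norm norm_minus_commute)
      then have "(norm (y - x))\<^sup>2 \<le> (2 * r)\<^sup>2" by (intro power_mono) auto
      then show ?thesis by (intro ennreal_leI) (simp add: power2_eq_square)
    qed
    finally show ?thesis using True by (simp add: mult_right_mono)
  qed (auto split: split_indicator)
  have J: "(\<integral>\<^sup>+x. (\<integral>\<^sup>+y. P s x y \<partial>lborel) \<partial>lborel) \<le> 2 ^ CARD('n) * emeasure lborel ?B * (\<integral>\<^sup>+x. \<gamma> x \<partial>lborel)"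
    for s
  proof -
    let ?c = "2 ^ CARD('n) * (\<integral>\<^sup>+x. \<gamma> x \<partial>lborel)"
    have half: "(\<integral>\<^sup>+x. (\<integral>\<^sup>+y. ?i x * ?i y * \<gamma> ((1 - s) *\<^sub>R x + s *\<^sub>R y) \<partial>lborel) \<partial>lborel) \<le> emeasure lborel ?B * ?c"
      if s: "s \<ge> 1/2" for s
    proof -
      have "(\<integral>\<^sup>+y. ?i x * ?i y * \<gamma> ((1 - s) *\<^sub>R x + s *\<^sub>R y) \<partial>lborel) \<le> ?i x * ?c" for x
      proof -
        have "(\<integral>\<^sup>+y. ?i x * ?i y * \<gamma> ((1 - s) *\<^sub>R x + s *\<^sub>R y) \<partial>lborel)
            \<le> (\<integral>\<^sup>+y. ?i x * \<gamma> ((1 - s) *\<^sub>R x + s *\<^sub>R y) \<partial>lborel)"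
          by (intro nn_integral_mono) (auto split: split_indicator)
        also have "\<dots> = ?i x * (\<integral>\<^sup>+y. \<gamma> ((1 - s) *\<^sub>R x + s *\<^sub>R y) \<partial>lborel)"
          by (intro nn_integral_cmult) measurable
        also have "\<dots> \<le> ?i x * ?c"
          using nn_integral_affine_le[of \<gamma> s "(1 - s) *\<^sub>R x"] s by (intro mult_left_mono) auto
        finally show ?thesis .
      qed
      then have "(\<integral>\<^sup>+x. (\<integral>\<^sup>+y. ?i x * ?i y * \<gamma> ((1 - s) *\<^sub>R x + s *\<^sub>R y) \<partial>lborel) \<partial>lborel)
          \<le> (\<integral>\<^sup>+x. ?i x * ?c \<partial>lborel)"
        by (intro nn_integral_mono)
      also have "\<dots> = emeasure lborel ?B * ?c"
        by (subst nn_integral_multc) (auto intro!: borel_measurable_indicator)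
      finally show ?thesis .
    qed
    show ?thesis
    proof (cases "s \<ge> 1/2")
      case True
      then show ?thesis using half[of s] by (simp add: P_def mult_ac)
    next
      case False
      \<comment> \<open>Exchanging x and y exchanges s and 1 - s, and 1 - s exceeds 1/2
        here.\<close>
      have "(\<integral>\<^sup>+x. (\<integral>\<^sup>+y. P s x y \<partial>lborel) \<partial>lborel) = (\<integral>\<^sup>+y. (\<integral>\<^sup>+x. P s x y \<partial>lborel) \<partial>lborel)"
        by (rule lborel_pair.Fubini'[symmetric]) (unfold P_j case_prod_beta, measurable)
      also have "\<dots> = (\<integral>\<^sup>+y. (\<integral>\<^sup>+x. ?i y * ?i x * \<gamma> ((1 - (1 - s)) *\<^sub>R y + (1 - s) *\<^sub>R x) \<partial>lborel) \<partial>lborel)"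
        by (simp add: P_def mult_ac add.commute)
      also have "\<dots> \<le> emeasure lborel ?B * ?c" using False by (intro half) auto
      finally show ?thesis by (simp add: mult_ac)
    qed
  qed
  have "(\<integral>\<^sup>+x. (\<integral>\<^sup>+y. ?i x * ?i y * ennreal ((w x - w y)\<^sup>2) \<partial>lborel) \<partial>lborel)
      \<le> (\<integral>\<^sup>+x. (\<integral>\<^sup>+y. ennreal (4 * r\<^sup>2) * (\<integral>\<^sup>+s. indicator {0..1} s * P s x y \<partial>lborel) \<partial>lborel) \<partial>lborel)"
    by (intro nn_integral_mono pt)
  also have "\<dots> = ennreal (4 * r\<^sup>2) * (\<integral>\<^sup>+x. (\<integral>\<^sup>+y. (\<integral>\<^sup>+s. indicator {0..1} s * P s x y \<partial>lborel) \<partial>lborel) \<partial>lborel)"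
    by (simp add: nn_integral_cmult P_j)
  also have "(\<integral>\<^sup>+x. (\<integral>\<^sup>+y. (\<integral>\<^sup>+s. indicator {0..1::real} s * P s x y \<partial>lborel) \<partial>lborel) \<partial>lborel)
      = (\<integral>\<^sup>+x. (\<integral>\<^sup>+s. (\<integral>\<^sup>+y. indicator {0..1::real} s * P s x y \<partial>lborel) \<partial>lborel) \<partial>lborel)"
    by (intro nn_integral_cong lborel_pair.Fubini') (unfold P_j case_prod_beta, measurable)
  also have "\<dots> = (\<integral>\<^sup>+s. (\<integral>\<^sup>+x. (\<integral>\<^sup>+y. indicator {0..1::real} s * P s x y \<partial>lborel) \<partial>lborel) \<partial>lborel)"
    by (intro lborel_pair.Fubini') (unfold P_j case_prod_beta, measurable)
  also have "\<dots> = (\<integral>\<^sup>+s. indicator {0..1::real} s * (\<integral>\<^sup>+x. (\<integral>\<^sup>+y. P s x y \<partial>lborel) \<partial>lborel) \<partial>lborel)"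
    by (simp add: nn_integral_cmult P_j)
  also have "\<dots> \<le> (\<integral>\<^sup>+s. indicator {0..1::real} s *
      (2 ^ CARD('n) * emeasure lborel ?B * (\<integral>\<^sup>+x. \<gamma> x \<partial>lborel)) \<partial>lborel)"
    by (intro nn_integral_mono mult_left_mono J) auto
  also have "\<dots> = 2 ^ CARD('n) * emeasure lborel ?B * (\<integral>\<^sup>+x. \<gamma> x \<partial>lborel)"
    by (simp add: nn_integral_multc)
  finally show ?thesis by (simp add: mult_left_mono)
qed

lemma integrable_indicator_ball:
  fixes f :: "'a::euclidean_space \<Rightarrow> real"
  assumes "continuous_on (cball z r) f"
  shows "integrable lborel (\<lambda>x. indicator (ball z r) x * f x)"
proof -
  have "integrable lborel (\<lambda>x. indicator (ball z r) x *\<^sub>R (indicator (cball z r) x *\<^sub>R f x))"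
    using assms by (intro integrable_mult_indicator borel_integrable_compact) auto
  also have "(\<lambda>x. indicator (ball z r) x *\<^sub>R (indicator (cball z r) x *\<^sub>R f x)) = (\<lambda>x. indicator (ball z r) x * f x)"
    by (auto split: split_indicator)
  finally show ?thesis .
qed

text \<open>The integral of (w x - w y)^2 over all pairs is 2 \<open>V\<close> times the integral of
  (w - a)^2, where a is the mean of w. Cancelling 2 \<open>V\<close> in the estimate for pairs
  leaves the stated constant.\<close>

lemma poincare_ball:
  fixes w :: "real ^ 'n::finite \<Rightarrow> real"
  assumes w: "C1_on w S" and B: "cball z r \<subseteq> S" "r > 0"
  shows "\<exists>a. (\<integral>x. indicator (ball z r) x * (w x - a)\<^sup>2 \<partial>lborel)
    \<le> 2 ^ (CARD('n) + 1) * r\<^sup>2 * (\<integral>x. indicator (ball z r) x * (norm (grad w x))\<^sup>2 \<partial>lborel)"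
proof -
  let ?B = "ball z r" and ?I = "\<lambda>f::real ^ 'n \<Rightarrow> real. \<integral>x. indicator (ball z r) x * f x \<partial>lborel"
  note int = integrable_indicator_ball[of z r]
  have cw: "continuous_on (cball z r) w" and cg: "continuous_on (cball z r) (grad w)"
    using w B by (auto intro: continuous_on_subset C1_on_continuous C1_on_grad)
  define V where "V = measure lborel ?B"
  define Q where "Q = ?I (\<lambda>x. (w x)\<^sup>2)"
  have V: "V > 0" unfolding V_def using content_ball_pos[OF B(2), of z] by simp
  have emV: "emeasure lborel ?B = ennreal V"
    unfolding V_def by (intro emeasure_eq_ennreal_measure) (use emeasure_bounded_finite[of ?B] in simp)
  have I1: "?I (\<lambda>_. c) = V * c" for c
    by (simp add: V_def)
  have sq: "?I (\<lambda>x. (w x - a)\<^sup>2) = Q - 2 * a * ?I w + V * a\<^sup>2" for a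
  proof -
    have "?I (\<lambda>x. (w x - a)\<^sup>2) = (\<integral>x. indicator ?B x * (w x)\<^sup>2 - (2 * a) * (indicator ?B x * w x) + indicator ?B x * a\<^sup>2 \<partial>lborel)"
      by (intro Bochner_Integration.integral_cong) (auto simp: power2_eq_square algebra_simps)
    also have "\<dots> = Q - 2 * a * ?I w + V * a\<^sup>2"
      unfolding Q_def
      by (subst Bochner_Integration.integral_add Bochner_Integration.integral_diff;
          (intro Bochner_Integration.integrable_diff integrable_mult_right int continuous_intros cw)?)+
         (simp only: I1 integral_mult_right_zero)
    finally show ?thesis .
  qed
  let ?a = "?I w / V"
  have Ia: "V * ?I (\<lambda>x. (w x - ?a)\<^sup>2) = V * Q - (?I w)\<^sup>2"
    unfolding sq using V by (simp add: field_simps power2_eq_square)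
  have inner: "(\<integral>\<^sup>+y. indicator ?B x * indicator ?B y * ennreal ((w x - w y)\<^sup>2) \<partial>lborel)
      = ennreal (indicator ?B x * (Q - 2 * w x * ?I w + V * (w x)\<^sup>2))" for x
  proof -
    have "(\<integral>\<^sup>+y. indicator ?B x * indicator ?B y * ennreal ((w x - w y)\<^sup>2) \<partial>lborel)
        = (\<integral>\<^sup>+y. ennreal (indicator ?B x * (indicator ?B y * (w y - w x)\<^sup>2)) \<partial>lborel)"
      by (intro nn_integral_cong) (auto simp: power2_commute split: split_indicator)
    also have "\<dots> = ennreal (\<integral>y. indicator ?B x * (indicator ?B y * (w y - w x)\<^sup>2) \<partial>lborel)"
      by (intro nn_integral_eq_integral integrable_mult_right int continuous_intros cw) auto
    also have "\<dots> = ennreal (indicator ?B x * (Q - 2 * w x * ?I w + V * (w x)\<^sup>2))"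
      using sq[of "w x"] by simp
    finally show ?thesis .
  qed
  have nn: "0 \<le> Q - 2 * a * ?I w + V * a\<^sup>2" for a
    unfolding sq[symmetric] by (intro Bochner_Integration.integral_nonneg) auto
  have "(\<integral>\<^sup>+x. (\<integral>\<^sup>+y. indicator ?B x * indicator ?B y * ennreal ((w x - w y)\<^sup>2) \<partial>lborel) \<partial>lborel)
      = ennreal (?I (\<lambda>x. Q - 2 * w x * ?I w + V * (w x)\<^sup>2))"
    unfolding inner by (intro nn_integral_eq_integral int continuous_intros cw) (auto simp: nn)
  also have "?I (\<lambda>x. Q - 2 * w x * ?I w + V * (w x)\<^sup>2)
      = (\<integral>x. indicator ?B x * Q - (2 * ?I w) * (indicator ?B x * w x) + V * (indicator ?B x * (w x)\<^sup>2) \<partial>lborel)"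
    by (intro Bochner_Integration.integral_cong) (auto simp: algebra_simps)
  also have "\<dots> = V * Q - 2 * ?I w * ?I w + V * Q"
    by (subst Bochner_Integration.integral_add Bochner_Integration.integral_diff;
        (intro Bochner_Integration.integrable_diff integrable_mult_right int continuous_intros cw)?)+
       (simp only: I1 integral_mult_right_zero Q_def)
  also have "\<dots> = 2 * (V * ?I (\<lambda>x. (w x - ?a)\<^sup>2))"
    unfolding Ia by (simp add: power2_eq_square)
  finally have "ennreal (2 * (V * ?I (\<lambda>x. (w x - ?a)\<^sup>2))) \<le> ennreal (4 * r\<^sup>2) * (2 ^ CARD('n) * emeasure lborel ?B *
      (\<integral>\<^sup>+x. indicator ?B x * ennreal ((norm (grad w x))\<^sup>2) \<partial>lborel))"
    using double_integral_square_diff_le[OF w subset_trans[OF ball_subset_cball B(1)] B(2)] by simp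
  also have "(\<integral>\<^sup>+x. indicator ?B x * ennreal ((norm (grad w x))\<^sup>2) \<partial>lborel) = ennreal (?I (\<lambda>x. (norm (grad w x))\<^sup>2))"
  proof -
    have "(\<integral>\<^sup>+x. indicator ?B x * ennreal ((norm (grad w x))\<^sup>2) \<partial>lborel)
        = (\<integral>\<^sup>+x. ennreal (indicator ?B x * (norm (grad w x))\<^sup>2) \<partial>lborel)"
      by (intro nn_integral_cong) (auto split: split_indicator)
    also have "\<dots> = ennreal (?I (\<lambda>x. (norm (grad w x))\<^sup>2))"
      by (intro nn_integral_eq_integral int continuous_intros cg) auto
    finally show ?thesis .
  qed
  also have "ennreal (4 * r\<^sup>2) * (2 ^ CARD('n) * emeasure lborel ?B * ennreal (?I (\<lambda>x. (norm (grad w x))\<^sup>2)))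
      = ennreal (4 * r\<^sup>2 * (2 ^ CARD('n) * V * ?I (\<lambda>x. (norm (grad w x))\<^sup>2)))"
    using V by (simp add: emV ennreal_mult' ennreal_mult'' flip: ennreal_power ennreal_numeral)
  finally have "2 * (V * ?I (\<lambda>x. (w x - ?a)\<^sup>2)) \<le> 4 * r\<^sup>2 * (2 ^ CARD('n) * V * ?I (\<lambda>x. (norm (grad w x))\<^sup>2))"
    using V by (subst (asm) ennreal_le_iff) (auto intro!: mult_nonneg_nonneg Bochner_Integration.integral_nonneg)
  then have "V * ?I (\<lambda>x. (w x - ?a)\<^sup>2) \<le> V * (2 ^ (CARD('n) + 1) * r\<^sup>2 * ?I (\<lambda>x. (norm (grad w x))\<^sup>2))"
    by (simp add: algebra_simps)
  then show ?thesis using V by (intro exI[of _ ?a]) (simp add: mult_le_cancel_left)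
qed

section \<open>Positive definite matrices, linear images of C^1 maps, powers of the positive
  part\<close>

lemma det_pos_of_pos_def:
  fixes M :: "real ^ 'n ^ 'n::finite"
  assumes pd: "\<And>v. v \<noteq> 0 \<Longrightarrow> v \<bullet> (M *v v) > 0"
  shows "det M > 0"
proof (rule ccontr)
  assume "\<not> det M > 0"
  \<comment> \<open>The segment from the identity to \<open>M\<close> consists of positive definite,
    hence invertible matrices, so the determinant cannot change sign on its way from 1 to
    \<open>det M\<close>.\<close>
  define N where "N t = (1 - t) *\<^sub>R mat 1 + t *\<^sub>R M" for t :: real
  have N: "det (N t) \<noteq> 0" if "0 \<le> t" "t \<le> 1" for t
  proof -
    have "v = 0" if "N t *v v = 0" for v
    proof (rule ccontr)
      assume v: "v \<noteq> 0"
      have "v \<bullet> (N t *v v) = (1 - t) * (v \<bullet> v) + t * (v \<bullet> (M *v v))"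
        by (simp add: N_def matrix_vector_mult_add_rdistrib inner_add_right scaleR_matrix_vector_assoc[symmetric])
      also have "\<dots> > 0"
        using pd[OF v] v \<open>0 \<le> t\<close> \<open>t \<le> 1\<close>
        by (cases "t = 0") (auto intro!: add_nonneg_pos mult_nonneg_nonneg)
      finally show False using that by simp
    qed
    then have "invertible (N t)"
      by (simp add: invertible_left_inverse matrix_left_invertible_ker)
    then show ?thesis by (simp add: invertible_det_nz)
  qed
  have "continuous_on {0..1} (\<lambda>t. det (N t))"
    unfolding det_def N_def by (intro continuous_intros)
  moreover have "det (N 0) = 1" "det (N 1) = det M" by (simp_all add: N_def)
  ultimately obtain t where "0 \<le> t" "t \<le> 1" "det (N t) = 0"
    using IVT2'[of "\<lambda>t. det (N t)" 1 0 0] \<open>\<not> det M > 0\<close> by auto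
  then show False using N by blast
qed

text \<open>Passes from the matrix-valued metric, whose smoothness is assumed as a whole, to its
  single entries.\<close>

lemma Ck_on_1_linear:
  fixes F :: "real ^ 'n::finite \<Rightarrow> 'b::real_normed_vector" and L :: "'b \<Rightarrow> real"
  assumes F: "Ck_on 1 F S" and L: "bounded_linear L"
  shows "C1_on (\<lambda>x. L (F x)) S"
proof (rule C1_onI[where D = "\<lambda>x. \<chi> i. L (partial_at (axis i 1) F x)"])
  fix x assume "x \<in> S"
  then have "F differentiable (at x)" using F by simp
  then have D: "(F has_derivative frechet_derivative F (at x)) (at x)"
    by (simp add: frechet_derivative_works)
  have lin: "linear (\<lambda>y. L (frechet_derivative F (at x) y))"
    using bounded_linear.linear[OF L] has_derivative_linear[OF D] linear_compose by (fastforce simp: o_def)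
  have "L (frechet_derivative F (at x) y) = (\<chi> i. L (partial_at (axis i 1) F x)) \<bullet> y" for y
  proof -
    have "L (frechet_derivative F (at x) y) = L (frechet_derivative F (at x) (\<Sum>i\<in>UNIV. (y $ i) *\<^sub>R axis i 1))"
      using basis_expansion[of y] by (simp add: scalar_mult_eq_scaleR)
    also have "\<dots> = (\<Sum>i\<in>UNIV. y $ i * L (frechet_derivative F (at x) (axis i 1)))"
      by (simp add: linear_sum[OF lin] linear_cmul[OF lin])
    finally show ?thesis by (simp add: partial_at_def inner_vec_def mult.commute)
  qed
  then show "((\<lambda>x. L (F x)) has_derivative (\<bullet>) (\<chi> i. L (partial_at (axis i 1) F x))) (at x)"
    using bounded_linear.has_derivative[OF L D] by (simp add: ext)
next
  have "continuous_on S (partial_at (axis i 1) F)" for i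
    using F by simp
  then show "continuous_on S (\<lambda>x. \<chi> i. L (partial_at (axis i 1) F x))"
    by (intro continuous_intros bounded_linear.continuous_on[OF L])
qed

text \<open>From the square on, powers of the positive part are C^1 across 0. The square gives bump
  functions; the cube, which even has a continuous second derivative, gives the minimum
  principle.\<close>

lemma has_real_derivative_pos_part_power:
  "((\<lambda>y. max 0 y ^ Suc (Suc n)) has_real_derivative real (Suc (Suc n)) * max 0 x ^ Suc n) (at x)"
proof (cases x "0 :: real" rule: linorder_cases)
  case less
  have "((\<lambda>y. 0) has_real_derivative 0) (at x)" by simp
  then have "((\<lambda>y. max 0 y ^ Suc (Suc n)) has_real_derivative 0) (at x)"
    by (rule has_field_derivative_transform_within_open[of _ _ _ "{..<0}"]) (use less in auto)
  then show ?thesis using less by simp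
next
  case equal
  have "((\<lambda>h. max 0 h ^ Suc n) \<longlongrightarrow> max 0 0 ^ Suc n) (at (0::real))"
    by (intro tendsto_intros)
  then have "((\<lambda>h. max 0 h ^ Suc n) \<longlongrightarrow> 0) (at (0::real))" by simp
  then have "((\<lambda>h. max 0 h ^ Suc (Suc n) / h) \<longlongrightarrow> 0) (at (0::real))"
    by (rule Lim_transform_eventually) (auto simp: eventually_at_filter max_def)
  then show ?thesis using equal by (simp add: has_field_derivative_iff)
next
  case greater
  have "((\<lambda>y. y ^ Suc (Suc n)) has_real_derivative real (Suc (Suc n)) * x ^ Suc n) (at x)"
    using DERIV_power[OF DERIV_ident, of "Suc (Suc n)"] by simp
  then have "((\<lambda>y. max 0 y ^ Suc (Suc n)) has_real_derivative real (Suc (Suc n)) * x ^ Suc n) (at x)"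
    by (rule has_field_derivative_transform_within_open[of _ _ _ "{0<..}"]) (use greater in auto)
  then show ?thesis using greater by simp
qed

section \<open>Gradients on a closed Riemannian manifold\<close>

locale closed_manifold =
  fixes A :: "('m::t2_space, 'n::finite) chart set" and g :: "('m, 'n) metric" and \<mu> :: "'m measure"
  assumes closed: "closed_riemannian_manifold A g"
    and volume: "riemannian_volume A g \<mu>"
    and total_volume: "emeasure \<mu> UNIV = 1"
begin

lemma chart:
  assumes "c \<in> A"
  shows open_dom: "open (dom_of c)" and open_cod: "open (cod_of c)"
    and continuous_coord: "continuous_on (dom_of c) (coord c)"
    and continuous_inv_coord: "continuous_on (cod_of c) (inv_coord c)"
    and coord_in: "p \<in> dom_of c \<Longrightarrow> coord c p \<in> cod_of c"
    and inv_coord_in: "x \<in> cod_of c \<Longrightarrow> inv_coord c x \<in> dom_of c"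
    and inv_coord_coord: "p \<in> dom_of c \<Longrightarrow> inv_coord c (coord c p) = p"
    and coord_inv_coord: "x \<in> cod_of c \<Longrightarrow> coord c (inv_coord c x) = x"
proof -
  have "is_chart c"
    using closed assms by (simp add: closed_riemannian_manifold_def smooth_atlas_def)
  then have 1: "open (dom_of c)" "open (cod_of c)"
    and h: "homeomorphism (dom_of c) (cod_of c) (coord c) (inv_coord c)"
    by (auto simp: is_chart_def)
  from 1 show "open (dom_of c)" "open (cod_of c)" .
  from h show "continuous_on (dom_of c) (coord c)" "continuous_on (cod_of c) (inv_coord c)"
    "p \<in> dom_of c \<Longrightarrow> coord c p \<in> cod_of c" "x \<in> cod_of c \<Longrightarrow> inv_coord c x \<in> dom_of c"
    "p \<in> dom_of c \<Longrightarrow> inv_coord c (coord c p) = p"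
    "x \<in> cod_of c \<Longrightarrow> coord c (inv_coord c x) = x"
    by (auto simp: homeomorphism_def)
qed

lemma compact_M: "compact (UNIV :: 'm set)"
  using closed by (simp add: closed_riemannian_manifold_def)

lemma chart_around: obtains c where "c \<in> A" "p \<in> dom_of c"
proof -
  have "p \<in> (\<Union>c\<in>A. dom_of c)"
    using closed by (simp add: closed_riemannian_manifold_def smooth_atlas_def)
  with that show thesis by blast
qed

lemma metric:
  assumes "c \<in> A"
  shows smooth_metric: "smooth_on (g c) (cod_of c)"
    and metric_sym: "x \<in> cod_of c \<Longrightarrow> transpose (g c x) = g c x"
    and metric_pos: "x \<in> cod_of c \<Longrightarrow> v \<noteq> 0 \<Longrightarrow> v \<bullet> (g c x *v v) > 0"
  using closed assms by (auto simp: closed_riemannian_manifold_def riemannian_metric_def)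

lemma det_metric: "c \<in> A \<Longrightarrow> x \<in> cod_of c \<Longrightarrow> det (g c x) > 0"
  by (intro det_pos_of_pos_def metric_pos)

lemma invertible_metric: "c \<in> A \<Longrightarrow> x \<in> cod_of c \<Longrightarrow> invertible (g c x)"
  using det_metric by (fastforce simp: invertible_det_nz)

lemma metric_mult_inv: "c \<in> A \<Longrightarrow> x \<in> cod_of c \<Longrightarrow> g c x *v (matrix_inv (g c x) *v a) = a"
  using matrix_inv_right[OF invertible_metric] by (simp add: matrix_vector_mul_assoc)

lemma metric_inner_sym:
  assumes "c \<in> A" "x \<in> cod_of c"
  shows "a \<bullet> (g c x *v b) = b \<bullet> (g c x *v a)"
proof -
  have "a \<bullet> (g c x *v b) = (transpose (g c x) *v a) \<bullet> b"
    by (simp add: dot_lmul_matrix transpose_matrix_vector)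
  then show ?thesis by (simp add: metric_sym[OF assms] inner_commute)
qed

lemma metric_inv_sym:
  assumes "c \<in> A" "x \<in> cod_of c"
  shows "a \<bullet> (matrix_inv (g c x) *v b) = b \<bullet> (matrix_inv (g c x) *v a)"
  using metric_inner_sym[OF assms, of "matrix_inv (g c x) *v b" "matrix_inv (g c x) *v a"]
  by (simp add: metric_mult_inv[OF assms] inner_commute)

text \<open>With z = \<open>matrix_inv (g c x) *v a\<close> the expression becomes the metric
  applied to the nonzero vector z.\<close>

lemma metric_inv_pos:
  assumes "c \<in> A" "x \<in> cod_of c" "a \<noteq> 0"
  shows "a \<bullet> (matrix_inv (g c x) *v a) > 0"
proof -
  have "matrix_inv (g c x) *v a \<noteq> 0"
    using metric_mult_inv[OF assms(1,2), of a] assms(3) by auto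
  from metric_pos[OF assms(1,2) this] show ?thesis
    by (simp add: metric_mult_inv[OF assms(1,2)] inner_commute)
qed

lemma C1_on_metric: "c \<in> A \<Longrightarrow> C1_on (\<lambda>x. g c x $ i $ j) (cod_of c)"
  using smooth_metric[of c] unfolding smooth_on_def
  by (intro Ck_on_1_linear[where L = "\<lambda>M. M $ i $ j"]
      bounded_linear_compose[OF bounded_linear_vec_nth bounded_linear_vec_nth]) auto

lemma C1_on_metric_inv: "c \<in> A \<Longrightarrow> C1_on (\<lambda>x. matrix_inv (g c x) $ i $ j) (cod_of c)"
  by (intro C1_on_matrix_inv open_cod C1_on_metric) (metis det_metric less_irrefl)+

lemma C1_on_sqrt_det: "c \<in> A \<Longrightarrow> C1_on (\<lambda>x. sqrt (det (g c x))) (cod_of c)"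
  by (rule C1_on_compose[OF C1_on_det[OF C1_on_metric], where F' = "\<lambda>y. inverse (sqrt y) / 2"])
     (use det_metric in \<open>fastforce intro!: DERIV_real_sqrt continuous_intros\<close>)+

section \<open>Change of charts\<close>

lemma smooth_transition:
  assumes "c \<in> A" "c' \<in> A"
  shows "open (coord c ` (dom_of c \<inter> dom_of c'))"
    and "smooth_on (transition c c') (coord c ` (dom_of c \<inter> dom_of c'))"
proof -
  have "coord c ` (dom_of c \<inter> dom_of c') = cod_of c \<inter> inv_coord c -` dom_of c'"
    using chart[OF assms(1)] by (force simp: cod_of_def)
  then show "open (coord c ` (dom_of c \<inter> dom_of c'))"
    using continuous_open_preimage[OF continuous_inv_coord open_cod open_dom] assms by simp
  show "smooth_on (transition c c') (coord c ` (dom_of c \<inter> dom_of c'))"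
    using closed assms by (simp add: closed_riemannian_manifold_def smooth_atlas_def)
qed

lemma transition_coord: "c \<in> A \<Longrightarrow> p \<in> dom_of c \<Longrightarrow> transition c c' (coord c p) = coord c' p"
  by (simp add: transition_def inv_coord_coord)

lemma has_derivative_transition:
  assumes "c \<in> A" "c' \<in> A" "p \<in> dom_of c" "p \<in> dom_of c'"
  shows "(transition c c' has_derivative
    (\<lambda>y. matrix (frechet_derivative (transition c c') (at (coord c p))) *v y)) (at (coord c p))"
proof -
  have "Ck_on 1 (transition c c') (coord c ` (dom_of c \<inter> dom_of c'))"
    using smooth_transition[OF assms(1,2)] by (simp only: smooth_on_def)
  then have "transition c c' differentiable (at (coord c p))"
    using assms by simp
  then have D: "(transition c c' has_derivative frechet_derivative (transition c c') (at (coord c p))) (at (coord c p))"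
    by (simp add: frechet_derivative_works)
  then show ?thesis
    by (simp add: matrix_works[OF iffD2[OF linear_matrix_vector_mul_eq has_derivative_linear[OF D]]])
qed

text \<open>Differentials are pulled back by the transposed Jacobian. This yields the chart
  independence of gradient products and lets a function built in one chart be recognised as C^1 in
  another.\<close>

lemma
  assumes cc: "c \<in> A" "c' \<in> A" and b: "C1_on b (cod_of c')"
  defines "D \<equiv> coord c ` (dom_of c \<inter> dom_of c')"
  shows C1_on_transition: "C1_on (\<lambda>x. b (transition c c' x)) D"
    and grad_transition: "p \<in> dom_of c \<inter> dom_of c' \<Longrightarrow> grad (\<lambda>x. b (transition c c' x)) (coord c p)
      = transpose (matrix (frechet_derivative (transition c c') (at (coord c p)))) *v grad b (coord c' p)"
proof -
  let ?J = "\<lambda>x. matrix (frechet_derivative (transition c c') (at x))"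
  have *: "((\<lambda>x. b (transition c c' x)) has_derivative
      (\<lambda>y. (transpose (?J (coord c p)) *v grad b (coord c' p)) \<bullet> y)) (at (coord c p))"
    if p: "p \<in> dom_of c \<inter> dom_of c'" for p
  proof -
    have "(b has_derivative (\<lambda>y. grad b (coord c' p) \<bullet> y)) (at (transition c c' (coord c p)))"
      using C1_onD[OF b coord_in[OF cc(2)], of p] p cc by (simp add: transition_coord)
    from has_derivative_compose[OF has_derivative_transition[OF cc] this] p show ?thesis
      by (simp add: dot_lmul_matrix transpose_matrix_vector)
  qed
  show "p \<in> dom_of c \<inter> dom_of c' \<Longrightarrow> grad (\<lambda>x. b (transition c c' x)) (coord c p)
      = transpose (?J (coord c p)) *v grad b (coord c' p)"
    by (rule grad_eqI[OF *])
  have T: "Ck_on 1 (transition c c') D"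
    using smooth_transition[OF cc] by (simp only: smooth_on_def D_def)
  have cJ: "continuous_on D (\<lambda>x. ?J x $ i $ j)" for i j
  proof -
    have "continuous_on D (partial_at (axis j 1) (transition c c'))" using T by simp
    then have "continuous_on D (\<lambda>x. partial_at (axis j 1) (transition c c') x $ i)"
      by (intro continuous_intros)
    then show ?thesis by (simp add: matrix_def partial_at_def)
  qed
  have cT: "continuous_on D (transition c c')"
    using T by (simp add: continuous_at_imp_continuous_on differentiable_imp_continuous_within)
  have sub: "transition c c' ` D \<subseteq> cod_of c'"
    using cc by (auto simp: D_def transition_coord coord_in)
  have cb: "continuous_on D (\<lambda>x. grad b (transition c c' x))"
    by (rule continuous_on_compose2[OF C1_on_grad[OF b] cT sub])
  show "C1_on (\<lambda>x. b (transition c c' x)) D"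
  proof (rule C1_onI[where D = "\<lambda>x. transpose (?J x) *v grad b (transition c c' x)"])
    show "((\<lambda>x. b (transition c c' x)) has_derivative
      (\<lambda>y. (transpose (?J x) *v grad b (transition c c' x)) \<bullet> y)) (at x)" if "x \<in> D" for x
      using * that cc by (auto simp: D_def transition_coord)
    show "continuous_on D (\<lambda>x. transpose (?J x) *v grad b (transition c c' x))"
    proof -
      have "continuous_on D (\<lambda>x. \<chi> i. \<Sum>j\<in>UNIV. ?J x $ j $ i * grad b (transition c c' x) $ j)"
        by (intro continuous_on_vec_lambda continuous_on_sum continuous_on_mult cJ
            continuous_on_component[OF cb])
      then show ?thesis by (simp add: matrix_vector_mult_def transpose_def)
    qed
  qed
qed

section \<open>C^1 functions on the manifold and the product of their gradients\<close>

definition C1 :: "('m \<Rightarrow> real) \<Rightarrow> bool"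
  where "C1 v \<longleftrightarrow> (\<forall>c\<in>A. C1_on (v \<circ> inv_coord c) (cod_of c))"

lemma C1_iff_Ck_function: "C1 v \<longleftrightarrow> Ck_function A 1 v"
  by (simp only: C1_def Ck_function_def Ck_on_1_iff)

text \<open>\<open>grad\<close> yields coordinate differentials, i.e. covectors, which are paired by
  the inverse of the metric.\<close>

definition gdot_in :: "('m, 'n) chart \<Rightarrow> ('m \<Rightarrow> real) \<Rightarrow> ('m \<Rightarrow> real) \<Rightarrow> real ^ 'n \<Rightarrow> real"
  where "gdot_in c v w x = grad (v \<circ> inv_coord c) x \<bullet> (matrix_inv (g c x) *v grad (w \<circ> inv_coord c) x)"

text \<open>\<open>\<langle>\<nabla>v, \<nabla>w\<rangle>\<^sub>g\<close>; for \<open>C\<^sup>1\<close> functions every chart around \<open>p\<close> gives the same value.\<close>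

definition gdot :: "('m \<Rightarrow> real) \<Rightarrow> ('m \<Rightarrow> real) \<Rightarrow> 'm \<Rightarrow> real"
  where "gdot v w p = (let c = (SOME c. c \<in> A \<and> p \<in> dom_of c) in gdot_in c v w (coord c p))"

text \<open>Differentials transform with the transposed Jacobian and the metric with the Jacobian on
  both sides; in the pairing by the inverse metric these factors cancel.\<close>

lemma gdot_in_chart_independent:
  assumes c: "c \<in> A" "c' \<in> A" and p: "p \<in> dom_of c" "p \<in> dom_of c'" and vw: "C1 v" "C1 w"
  shows "gdot_in c v w (coord c p) = gdot_in c' v w (coord c' p)"
proof -
  let ?D = "coord c ` (dom_of c \<inter> dom_of c')" and ?x = "coord c p" and ?x' = "coord c' p"
  define J where "J = matrix (frechet_derivative (transition c c') (at ?x))"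
  have x: "?x \<in> ?D" using p by blast
  have gr: "grad (h \<circ> inv_coord c) ?x = transpose J *v grad (h \<circ> inv_coord c') ?x'" if "C1 h" for h
  proof -
    have "grad (h \<circ> inv_coord c) ?x = grad (\<lambda>x. (h \<circ> inv_coord c') (transition c c' x)) ?x"
      by (rule grad_cong_open[OF smooth_transition(1)[OF c] x])
         (use c in \<open>auto simp: transition_def inv_coord_coord\<close>)
    also have "\<dots> = transpose J *v grad (h \<circ> inv_coord c') ?x'"
    proof -
      have "C1_on (h \<circ> inv_coord c') (cod_of c')" using that c by (simp only: C1_def)
      from grad_transition[OF c this] p show ?thesis unfolding J_def by blast
    qed
    finally show ?thesis .
  qed
  have gc: "g c ?x = transpose J ** g c' ?x' ** J"
  proof -
    have "g c ?x = transpose J ** g c' (transition c c' ?x) ** J"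
      using closed c x unfolding closed_riemannian_manifold_def riemannian_metric_def J_def Let_def by blast
    then show ?thesis using c p by (simp add: transition_coord)
  qed
  define a b where "a = grad (v \<circ> inv_coord c') ?x'" and "b = grad (w \<circ> inv_coord c') ?x'"
  let ?z = "matrix_inv (g c ?x) *v (transpose J *v b)"
  have xc: "?x \<in> cod_of c" "?x' \<in> cod_of c'" using c p by (auto intro: coord_in)
  \<comment> \<open>Invertibility of the Jacobian is read off from the transformation law, since
    \<open>g c\<close> has positive determinant.\<close>
  have detJ: "det (transpose J) \<noteq> 0"
  proof
    assume "det (transpose J) = 0"
    then have "det (g c ?x) = 0" by (simp add: gc det_mul)
    then show False using det_metric[OF c(1) xc(1)] by simp
  qed
  \<comment> \<open>\<open>?z\<close> is the gradient vector of w in the chart \<open>c\<close>; the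
    aim is that \<open>J\<close> maps it to the gradient vector in \<open>c'\<close>.\<close>
  have "transpose J *v (g c' ?x' *v (J *v ?z)) = g c ?x *v ?z"
    by (simp add: gc matrix_vector_mul_assoc matrix_mul_assoc)
  also have "\<dots> = transpose J *v b"
    by (rule metric_mult_inv[OF c(1) xc(1)])
  finally have eq: "transpose J *v (g c' ?x' *v (J *v ?z)) = transpose J *v b" .
  have "g c' ?x' *v (J *v ?z) = b"
    using eq matrix_inv_left[of "transpose J"] detJ
    by (metis invertible_det_nz matrix_vector_mul_assoc matrix_vector_mul_lid)
  then have "J *v ?z = matrix_inv (g c' ?x') *v b"
    using matrix_inv_left[OF invertible_metric[OF c(2) xc(2)]]
    by (metis matrix_vector_mul_assoc matrix_vector_mul_lid)
  then have "(transpose J *v a) \<bullet> ?z = a \<bullet> (matrix_inv (g c' ?x') *v b)"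
    by (simp add: dot_lmul_matrix transpose_matrix_vector)
  then show ?thesis
    by (simp add: gdot_in_def gr vw a_def b_def)
qed

lemma gdot_eq:
  assumes "c \<in> A" "p \<in> dom_of c" "C1 v" "C1 w"
  shows "gdot v w p = gdot_in c v w (coord c p)"
proof -
  define c' where "c' = (SOME c. c \<in> A \<and> p \<in> dom_of c)"
  have "c' \<in> A \<and> p \<in> dom_of c'"
    unfolding c'_def by (rule someI[of _ c]) (use assms in blast)
  then show ?thesis
    using gdot_in_chart_independent[of c' c p v w] assms
    unfolding gdot_def Let_def c'_def[symmetric] by simp
qed

lemma continuous_on_M:
  assumes "\<And>c. c \<in> A \<Longrightarrow> continuous_on (cod_of c) (F \<circ> inv_coord c)"
  shows "continuous_on (UNIV :: 'm set) F"
proof (rule continuous_at_imp_continuous_on, rule ballI)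
  fix p
  obtain c where c: "c \<in> A" "p \<in> dom_of c" by (rule chart_around)
  have "continuous_on (dom_of c) (\<lambda>q. (F \<circ> inv_coord c) (coord c q))"
    using c by (intro continuous_on_compose2[OF assms continuous_coord]) (auto intro: coord_in)
  then have "continuous_on (dom_of c) F"
    using c by (subst continuous_on_cong[OF refl, where g = "\<lambda>q. (F \<circ> inv_coord c) (coord c q)"])
      (auto simp: inv_coord_coord)
  then show "isCont F p"
    using c open_dom continuous_on_eq_continuous_at by blast
qed

lemma C1_continuous: "C1 v \<Longrightarrow> continuous_on UNIV v"
  by (intro continuous_on_M C1_on_continuous) (simp add: C1_def)

lemma continuous_on_gdot:
  assumes "C1 v" "C1 w"
  shows "continuous_on UNIV (gdot v w)"
proof (rule continuous_on_M)
  fix c assume c: "c \<in> A"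
  have "continuous_on (cod_of c) (grad (v \<circ> inv_coord c))" "continuous_on (cod_of c) (grad (w \<circ> inv_coord c))"
    using assms c by (auto simp: C1_def C1_on_def)
  moreover have "continuous_on (cod_of c) (\<lambda>x. \<chi> i j. matrix_inv (g c x) $ i $ j)"
    by (intro continuous_on_vec_lambda C1_on_continuous C1_on_metric_inv c)
  ultimately have "continuous_on (cod_of c) (gdot_in c v w)"
    unfolding gdot_in_def[abs_def] matrix_vector_mult_def
    by (intro continuous_intros) (simp_all add: vec_lambda_eta)
  then show "continuous_on (cod_of c) (gdot v w \<circ> inv_coord c)"
    using c assms by (subst continuous_on_cong[OF refl, where g = "gdot_in c v w"])
      (auto simp: gdot_eq inv_coord_in coord_inv_coord)
qed

lemma gdot_commute:
  assumes "C1 v" "C1 w"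
  shows "gdot v w p = gdot w v p"
proof -
  obtain c where c: "c \<in> A" "p \<in> dom_of c" by (rule chart_around)
  then show ?thesis
    using metric_inv_sym[OF c(1) coord_in] assms by (simp add: gdot_eq gdot_in_def)
qed

lemma gdot_nonneg:
  assumes "C1 v"
  shows "gdot v v p \<ge> 0"
proof -
  obtain c where c: "c \<in> A" "p \<in> dom_of c" by (rule chart_around)
  then show ?thesis
    using metric_inv_pos[OF c(1) coord_in[OF c], of "grad (v \<circ> inv_coord c) (coord c p)"] assms
    by (cases "grad (v \<circ> inv_coord c) (coord c p) = 0") (auto simp: gdot_eq gdot_in_def)
qed

lemma C1_const: "C1 (\<lambda>p. c)"
  by (auto simp: C1_def o_def intro: C1_on_const)

lemma
  assumes "C1 v" "C1 v'"
  shows C1_add: "C1 (\<lambda>p. v p + v' p)"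
    and gdot_add: "C1 w \<Longrightarrow> gdot (\<lambda>p. v p + v' p) w p = gdot v w p + gdot v' w p"
proof -
  show *: "C1 (\<lambda>p. v p + v' p)"
    using assms by (auto simp: C1_def o_def intro: C1_on_add)
  assume w: "C1 w"
  obtain c where c: "c \<in> A" "p \<in> dom_of c" by (rule chart_around)
  show "gdot (\<lambda>p. v p + v' p) w p = gdot v w p + gdot v' w p"
    using assms c coord_in[OF c] w
    by (auto simp: gdot_eq[OF c] * gdot_in_def C1_def o_def grad_add inner_add_left)
qed

lemma
  fixes F F' :: "real \<Rightarrow> real"
  assumes v: "C1 v" and F: "\<And>p. (F has_real_derivative F' (v p)) (at (v p))"
    and cont: "continuous_on (range v) F'"
  shows C1_compose: "C1 (\<lambda>p. F (v p))"
    and gdot_compose: "C1 w \<Longrightarrow> gdot (\<lambda>p. F (v p)) w p = F' (v p) * gdot v w p"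
proof -
  have sub: "continuous_on ((\<lambda>x. v (inv_coord c x)) ` S) F'" for c S
    by (rule continuous_on_subset[OF cont]) auto
  have v': "C1_on (\<lambda>x. v (inv_coord c x)) (cod_of c)" if "c \<in> A" for c
    using v that by (simp add: C1_def o_def)
  show *: "C1 (\<lambda>p. F (v p))"
    using C1_on_compose[OF v' F sub] by (simp add: C1_def o_def)
  assume w: "C1 w"
  obtain c where c: "c \<in> A" "p \<in> dom_of c" by (rule chart_around)
  show "gdot (\<lambda>p. F (v p)) w p = F' (v p) * gdot v w p"
    using grad_compose[OF v'[OF c(1)] F sub coord_in[OF c]] c
    by (simp add: gdot_eq[OF c] * w v gdot_in_def o_def inv_coord_coord)
qed

lemma C1_mult: "C1 v \<Longrightarrow> C1 w \<Longrightarrow> C1 (\<lambda>p. v p * w p)"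
  by (auto simp: C1_def o_def intro: C1_on_mult)

lemma C1_sum: "(\<And>i. i \<in> I \<Longrightarrow> C1 (v i)) \<Longrightarrow> C1 (\<lambda>p. \<Sum>i\<in>I. v i p)"
  by (induction I rule: infinite_finite_induct) (auto intro: C1_const C1_add)

text \<open>Applied to cut-off functions outside their support and to indicators of clopen
  sets.\<close>

lemma gdot_locally_const:
  assumes "C1 v" "C1 w" "open U" "p \<in> U" "\<And>q. q \<in> U \<Longrightarrow> v q = a"
  shows "gdot v w p = 0"
proof -
  obtain c where c: "c \<in> A" "p \<in> dom_of c" by (rule chart_around)
  have "open (cod_of c \<inter> inv_coord c -` U)"
    using c assms by (intro continuous_open_preimage continuous_inv_coord open_cod)
  then have "grad (v \<circ> inv_coord c) (coord c p) = grad (\<lambda>x. a) (coord c p)"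
    by (rule grad_cong_open) (use c assms coord_in[OF c] in \<open>auto simp: inv_coord_coord\<close>)
  then show ?thesis
    by (simp add: gdot_eq[OF c] assms gdot_in_def grad_const)
qed

section \<open>Riemannian volume and Green's identity\<close>

lemma sets_volume [measurable_cong]: "sets \<mu> = sets borel"
  using volume by (simp add: riemannian_volume_def)

lemma space_volume: "space \<mu> = UNIV"
  using sets_eq_imp_space_eq[OF sets_volume] by simp

sublocale finite_measure \<mu>
  by (rule finite_measureI) (simp add: space_volume total_volume)

lemma measure_UNIV: "measure \<mu> UNIV = 1"
  by (simp add: measure_def total_volume)

lemma borel_measurable_volume: "continuous_on UNIV F \<Longrightarrow> F \<in> borel_measurable \<mu>"
  for F :: "'m \<Rightarrow> real"
  using borel_measurable_continuous_onI[of F] measurable_cong_sets[OF sets_volume refl] by blast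

lemma integrable_continuous:
  fixes F :: "'m \<Rightarrow> real"
  assumes "continuous_on UNIV F"
  shows "integrable \<mu> F"
proof -
  have "bounded (range F)"
    by (intro compact_imp_bounded compact_continuous_image assms compact_M)
  then obtain B where "\<And>p. norm (F p) \<le> B"
    by (auto simp: bounded_iff)
  then show ?thesis
    by (intro integrable_const_bound[of _ B] borel_measurable_volume assms) auto
qed

lemma integrable_indicator_continuous:
  fixes F :: "'m \<Rightarrow> real"
  assumes "continuous_on UNIV F" "open U"
  shows "integrable \<mu> (\<lambda>p. indicator U p * F p)"
  using integrable_mult_indicator[OF _ integrable_continuous[OF assms(1)], of U] assms(2)
  by (simp add: sets_volume)

text \<open>The volume is specified only by its values on Borel sets within a chart; as an equation
  of measures this transfers integrals to Lebesgue measure.\<close>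

lemma distr_coord:
  assumes c: "c \<in> A"
  shows "distr (restrict_space \<mu> (dom_of c)) borel (coord c)
    = density lborel (\<lambda>x. ennreal (indicator (cod_of c) x * sqrt (det (g c x))))"
proof (rule measure_eqI)
  let ?f = "\<lambda>x. indicator (cod_of c) x * sqrt (det (g c x))"
  have dom: "dom_of c \<in> sets borel" and cod: "cod_of c \<in> sets borel"
    using open_dom[OF c] open_cod[OF c] by auto
  have [measurable]: "?f \<in> borel_measurable borel"
    using borel_measurable_continuous_on_indicator[OF cod C1_on_continuous[OF C1_on_sqrt_det[OF c]]] by simp
  fix X assume "X \<in> sets (distr (restrict_space \<mu> (dom_of c)) borel (coord c))"
  then have X: "X \<in> sets borel" by simp
  have coord: "coord c \<in> borel_measurable (restrict_space borel (dom_of c))"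
    by (intro borel_measurable_continuous_on_restrict continuous_coord c)
  define B where "B = coord c -` X \<inter> dom_of c"
  have "B \<in> sets (restrict_space borel (dom_of c))"
    using measurable_sets[OF coord X] by (simp add: B_def space_restrict_space)
  then have B: "B \<in> sets borel" "B \<subseteq> dom_of c"
    using dom by (auto simp: sets_restrict_space_iff B_def)
  have coord': "coord c \<in> borel_measurable (restrict_space \<mu> (dom_of c))"
    using coord measurable_cong_sets[OF sets_restrict_space_cong[OF sets_volume] refl] by blast
  have "emeasure (distr (restrict_space \<mu> (dom_of c)) borel (coord c)) X = emeasure \<mu> B"
    using X B dom by (simp add: emeasure_distr[OF coord'] emeasure_restrict_space space_restrict_space
        space_volume sets_volume B_def)
  also have "\<dots> = (\<integral>\<^sup>+ x \<in> coord c ` B. ennreal (sqrt (det (g c x))) \<partial>lborel)"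
    using volume c B by (simp add: riemannian_volume_def)
  also have "coord c ` B = X \<inter> cod_of c"
    by (auto simp: B_def cod_of_def)
  also have "(\<integral>\<^sup>+ x \<in> X \<inter> cod_of c. ennreal (sqrt (det (g c x))) \<partial>lborel)
      = (\<integral>\<^sup>+ x. ennreal (?f x) * indicator X x \<partial>lborel)"
    by (intro nn_integral_cong) (auto split: split_indicator)
  also have "\<dots> = emeasure (density lborel (\<lambda>x. ennreal (?f x))) X"
    using X by (subst emeasure_density) auto
  finally show "emeasure (distr (restrict_space \<mu> (dom_of c)) borel (coord c)) X
      = emeasure (density lborel (\<lambda>x. ennreal (?f x))) X" .
qed simp

lemma integral_chart:
  fixes F :: "'m \<Rightarrow> real"
  assumes c: "c \<in> A" and F: "F \<in> borel_measurable borel"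
  shows "(\<integral>p. indicator (dom_of c) p * F p \<partial>\<mu>)
    = (\<integral>x. indicator (cod_of c) x * (sqrt (det (g c x)) * F (inv_coord c x)) \<partial>lborel)"
proof -
  let ?f = "\<lambda>x. indicator (cod_of c) x * sqrt (det (g c x))"
  \<comment> \<open>\<open>inv_coord c\<close> has unspecified values off \<open>cod_of c\<close>;
    the cutoff makes \<open>?h\<close> Borel measurable on the whole space.\<close>
  let ?h = "\<lambda>x. indicator (cod_of c) x *\<^sub>R F (inv_coord c x)"
  have dom: "dom_of c \<in> sets borel" and cod: "cod_of c \<in> sets borel"
    using open_dom[OF c] open_cod[OF c] by auto
  have [measurable]: "?f \<in> borel_measurable borel"
    using borel_measurable_continuous_on_indicator[OF cod C1_on_continuous[OF C1_on_sqrt_det[OF c]]] by simp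
  have "(\<lambda>x. F (inv_coord c x)) \<in> borel_measurable (restrict_space borel (cod_of c))"
    by (rule measurable_compose[OF borel_measurable_continuous_on_restrict[OF continuous_inv_coord[OF c]] F])
  then have h: "?h \<in> borel_measurable borel"
    using cod by (subst (asm) borel_measurable_restrict_space_iff) auto
  have coord: "coord c \<in> borel_measurable (restrict_space \<mu> (dom_of c))"
    using borel_measurable_continuous_on_restrict[OF continuous_coord[OF c]]
      measurable_cong_sets[OF sets_restrict_space_cong[OF sets_volume] refl] by blast
  have "(\<integral>p. indicator (dom_of c) p * F p \<partial>\<mu>) = (\<integral>p. F p \<partial>restrict_space \<mu> (dom_of c))"
    using dom by (subst integral_restrict_space) (auto simp: sets_volume space_volume)
  also have "\<dots> = (\<integral>p. ?h (coord c p) \<partial>restrict_space \<mu> (dom_of c))"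
    using c by (intro Bochner_Integration.integral_cong)
      (auto simp: space_restrict_space coord_in inv_coord_coord)
  also have "\<dots> = (\<integral>x. ?h x \<partial>distr (restrict_space \<mu> (dom_of c)) borel (coord c))"
    by (rule integral_distr[OF coord h, symmetric])
  also have "\<dots> = (\<integral>x. ?f x *\<^sub>R ?h x \<partial>lborel)"
    unfolding distr_coord[OF c]
    using h det_metric[OF c] by (intro integral_density) (auto split: split_indicator intro!: AE_I2 less_imp_le)
  also have "\<dots> = (\<integral>x. indicator (cod_of c) x * (sqrt (det (g c x)) * F (inv_coord c x)) \<partial>lborel)"
    by (intro Bochner_Integration.integral_cong) (auto split: split_indicator)
  finally show ?thesis .
qed

lemma chart_ball:
  obtains c r where "c \<in> A" "p \<in> dom_of c" "r > 0" "cball (coord c p) r \<subseteq> cod_of c"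
proof -
  obtain c where c: "c \<in> A" "p \<in> dom_of c" by (rule chart_around)
  then obtain r where "r > 0" "cball (coord c p) r \<subseteq> cod_of c"
    using open_contains_cball open_cod coord_in by metis
  with c that show thesis by blast
qed

lemma open_inv_coord_image:
  assumes c: "c \<in> A" and B: "open B" "B \<subseteq> cod_of c"
  shows "open (inv_coord c ` B)"
proof -
  have "inv_coord c ` B = dom_of c \<inter> coord c -` B"
    using chart[OF c] B(2) by force
  then show ?thesis
    using continuous_open_preimage[OF continuous_coord open_dom] c B by simp
qed

text \<open>In a chart the volume has the strictly positive density
  \<open>sqrt (det (g c x))\<close>, and the chart image of a nonempty open set contains a
  ball.\<close>

lemma measure_open_pos:
  assumes U: "open U" "U \<noteq> {}"
  shows "measure \<mu> U > 0"
proof (rule ccontr)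
  assume "\<not> measure \<mu> U > 0"
  then have U0: "emeasure \<mu> U = 0"
    by (metis emeasure_eq_measure ennreal_0 measure_nonneg not_less order_antisym)
  obtain p where p: "p \<in> U" using U by blast
  obtain c where c: "c \<in> A" "p \<in> dom_of c" by (rule chart_around)
  define B where "B = dom_of c \<inter> U"
  have B: "open B" "B \<subseteq> dom_of c" "p \<in> B"
    using U open_dom[OF c(1)] c p by (auto simp: B_def)
  have "coord c ` B = cod_of c \<inter> inv_coord c -` B"
    using chart[OF c(1)] B(2) by force
  then have oB: "open (coord c ` B)"
    using continuous_open_preimage[OF continuous_inv_coord open_cod B(1)] c by simp
  have sub: "coord c ` B \<subseteq> cod_of c" using B(2) by (auto simp: cod_of_def)
  have "emeasure \<mu> B \<le> emeasure \<mu> U"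
    using U by (intro emeasure_mono) (auto simp: B_def sets_volume)
  then have "emeasure \<mu> B = 0" using U0 by simp
  moreover have "emeasure \<mu> B = (\<integral>\<^sup>+ x \<in> coord c ` B. ennreal (sqrt (det (g c x))) \<partial>lborel)"
    using volume c B by (simp add: riemannian_volume_def)
  moreover have "(\<lambda>x. ennreal (sqrt (det (g c x))) * indicator (coord c ` B) x) \<in> borel_measurable borel"
  proof -
    have "(\<lambda>x. indicator (coord c ` B) x *\<^sub>R sqrt (det (g c x))) \<in> borel_measurable borel"
      using oB continuous_on_subset[OF C1_on_continuous[OF C1_on_sqrt_det[OF c(1)]] sub]
      by (intro borel_measurable_continuous_on_indicator) auto
    then have "(\<lambda>x. ennreal (indicator (coord c ` B) x *\<^sub>R sqrt (det (g c x)))) \<in> borel_measurable borel"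
      by measurable
    also have "(\<lambda>x. ennreal (indicator (coord c ` B) x *\<^sub>R sqrt (det (g c x))))
        = (\<lambda>x. ennreal (sqrt (det (g c x))) * indicator (coord c ` B) x)"
      by (auto split: split_indicator)
    finally show ?thesis .
  qed
  ultimately have "AE x in lborel. ennreal (sqrt (det (g c x))) * indicator (coord c ` B) x = 0"
    by (subst nn_integral_0_iff_AE[symmetric]) auto
  moreover have "sqrt (det (g c x)) > 0" if "x \<in> coord c ` B" for x
    using det_metric[OF c(1)] sub that by auto
  ultimately have "AE x in lborel. x \<notin> coord c ` B"
    by (auto elim!: eventually_mono split: split_indicator_asm) fastforce
  moreover obtain r where r: "r > 0" "ball (coord c p) r \<subseteq> coord c ` B"
    using oB B(3) open_contains_ball by (metis imageI)
  ultimately have "AE x in lborel. x \<notin> ball (coord c p) r"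
    by (auto elim!: eventually_mono)
  then have "emeasure lborel (ball (coord c p) r) = 0"
    by (subst (asm) AE_iff_measurable[where N = "ball (coord c p) r"]) auto
  then show False
    using content_ball_pos[OF r(1), of "coord c p"] by (simp add: measure_def)
qed

text \<open>The set where \<open>F\<close> is nonzero is open and a null set, and nonempty open sets
  have positive volume.\<close>

lemma continuous_integral_eq_0:
  fixes F :: "'m \<Rightarrow> real"
  assumes F: "continuous_on UNIV F" "\<And>p. F p \<ge> 0" and "(\<integral>p. F p \<partial>\<mu>) = 0"
  shows "F p = 0"
proof (rule ccontr)
  assume p: "F p \<noteq> 0"
  have "AE p in \<mu>. F p = 0"
    using integral_nonneg_eq_0_iff_AE[OF integrable_continuous[OF F(1)]] assms by simp
  moreover have op: "open {p. F p \<noteq> 0}"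
    using open_Collect_neq[OF F(1) continuous_on_const] by simp
  ultimately have "emeasure \<mu> {p. F p \<noteq> 0} = 0"
    by (subst (asm) AE_iff_measurable[where N = "{p. F p \<noteq> 0}"]) (auto simp: sets_volume space_volume)
  then show False
    using measure_open_pos[OF op] p by (auto simp: measure_def)
qed

section \<open>Functions defined piecewise: indicators of clopen sets and bump functions\<close>

lemma C1_in_open_cover:
  assumes c: "c \<in> A" and UV: "open U" "open V" "U \<union> V = UNIV"
    and "C1_on (v \<circ> inv_coord c) (cod_of c \<inter> inv_coord c -` U)"
    and "C1_on (v \<circ> inv_coord c) (cod_of c \<inter> inv_coord c -` V)"
  shows "C1_on (v \<circ> inv_coord c) (cod_of c)"
proof -
  have "cod_of c = (cod_of c \<inter> inv_coord c -` U) \<union> (cod_of c \<inter> inv_coord c -` V)"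
    using UV(3) by blast
  moreover have "open (cod_of c \<inter> inv_coord c -` W)" if "open W" for W
    by (intro continuous_open_preimage continuous_inv_coord open_cod c that)
  ultimately show ?thesis
    using C1_on_union assms by metis
qed

lemma C1_on_locally_const:
  assumes c: "c \<in> A" and U: "open U" "\<And>q. q \<in> U \<Longrightarrow> v q = a"
  shows "C1_on (v \<circ> inv_coord c) (cod_of c \<inter> inv_coord c -` U)"
proof (rule C1_on_cong)
  show "open (cod_of c \<inter> inv_coord c -` U)"
    by (intro continuous_open_preimage continuous_inv_coord open_cod c U)
qed (use U C1_on_const[of a] in auto)

text \<open>Both \<open>V\<close> and its complement are open, so the indicator is locally constant.
  These are the test functions that reveal the conserved masses of the heat flow.\<close>

lemma
  assumes V: "open V" "closed V"
  shows C1_indicator: "C1 (indicator V)"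
    and gdot_indicator: "C1 w \<Longrightarrow> gdot (indicator V) w p = 0"
proof -
  show *: "C1 (indicator V)"
    unfolding C1_def
  proof
    fix c assume c: "c \<in> A"
    show "C1_on (indicator V \<circ> inv_coord c) (cod_of c)"
      by (rule C1_in_open_cover[OF c, of V "- V"]; (rule C1_on_locally_const[OF c])?)
         (use V in \<open>auto simp: open_Compl\<close>)
  qed
  assume w: "C1 w"
  show "gdot (indicator V) w p = 0"
  proof (cases "p \<in> V")
    case True
    then show ?thesis by (intro gdot_locally_const[OF * w V(1), of p 1]) auto
  next
    case False
    then show ?thesis
      by (intro gdot_locally_const[OF * w open_Compl[OF V(2)], of p 0]) auto
  qed
qed

text \<open>The building block of a partition of unity: a profile on a coordinate ball, extended by
  zero.\<close>

lemma bump: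
  obtains c K b where "c \<in> A" "compact K" "K \<subseteq> dom_of c" "C1 b" "b p > 0"
    "\<And>q. b q \<ge> 0" "\<And>q. q \<notin> K \<Longrightarrow> b q = 0"
proof -
  obtain c r where c: "c \<in> A" "p \<in> dom_of c" and r: "r > 0" "cball (coord c p) r \<subseteq> cod_of c"
    by (rule chart_ball)
  \<comment> \<open>Squaring the positive part makes the profile C^1 across the sphere of radius
    \<open>r\<close>.\<close>
  define \<beta> where "\<beta> x = (max 0 (r\<^sup>2 - (x - coord c p) \<bullet> (x - coord c p)))\<^sup>2" for x
  define b where "b q = (if q \<in> dom_of c then \<beta> (coord c q) else 0)" for q
  define K where "K = inv_coord c ` cball (coord c p) r"
  have \<beta>: "C1_on \<beta> S" for S
    unfolding \<beta>_def
  proof (rule C1_on_compose[where F = "\<lambda>y. (max 0 y)\<^sup>2" and F' = "\<lambda>y. 2 * max 0 y"])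
    show "C1_on (\<lambda>x. r\<^sup>2 - (x - coord c p) \<bullet> (x - coord c p)) S"
      by (rule C1_onI[where D = "\<lambda>x. (- 2) *\<^sub>R (x - coord c p)"])
         (auto intro!: derivative_eq_intros continuous_intros simp: inner_commute)
    show "((\<lambda>y. (max 0 y)\<^sup>2) has_real_derivative 2 * max 0 y) (at y)" for y :: real
      using has_real_derivative_pos_part_power[of 0 y] by (simp add: numeral_2_eq_2)
  qed (intro continuous_intros)
  have K: "compact K"
    unfolding K_def
    by (intro compact_continuous_image continuous_on_subset[OF continuous_inv_coord[OF c(1)] r(2)]) simp
  have b0: "b q = 0" if "q \<notin> K" for q
  proof (cases "q \<in> dom_of c")
    case True
    then have "coord c q \<notin> cball (coord c p) r"
      using that inv_coord_coord[OF c(1)] by (force simp: K_def)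
    then have "r < norm (coord c q - coord c p)" by (simp add: dist_norm norm_minus_commute)
    then have "r\<^sup>2 < (norm (coord c q - coord c p))\<^sup>2"
      using r by (intro power_strict_mono) auto
    then show ?thesis by (simp add: b_def \<beta>_def power2_norm_eq_inner)
  qed (simp add: b_def)
  have "C1 b"
    unfolding C1_def
  proof
    fix c' assume c': "c' \<in> A"
    show "C1_on (b \<circ> inv_coord c') (cod_of c')"
    \<comment> \<open>\<open>K\<close> is compact, hence closed in a Hausdorff space, and lies in
      \<open>dom_of c\<close>. So \<open>dom_of c\<close> and \<open>- K\<close> form an open cover;
      on the first \<open>b\<close> is \<open>\<beta>\<close> in coordinates, on the second it is
      zero.\<close>
    proof (rule C1_in_open_cover[OF c', of "dom_of c" "- K"])
      show "C1_on (b \<circ> inv_coord c') (cod_of c' \<inter> inv_coord c' -` (- K))"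
        by (rule C1_on_locally_const[OF c' _ b0]) (use K in \<open>auto simp: compact_imp_closed open_Compl\<close>)
      have eq: "cod_of c' \<inter> inv_coord c' -` dom_of c = coord c' ` (dom_of c' \<inter> dom_of c)"
        using chart[OF c'] by (force simp: cod_of_def)
      have "C1_on (\<lambda>x. \<beta> (transition c' c x)) (coord c' ` (dom_of c' \<inter> dom_of c))"
        by (rule C1_on_transition[OF c' c(1) \<beta>])
      then show "C1_on (b \<circ> inv_coord c') (cod_of c' \<inter> inv_coord c' -` dom_of c)"
        unfolding eq
        by (rule C1_on_cong[OF smooth_transition(1)[OF c' c(1)], rotated])
           (auto simp: b_def transition_def inv_coord_coord[OF c'])
      show "dom_of c \<union> - K = UNIV"
        using inv_coord_in[OF c(1)] r(2) by (auto simp: K_def)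
    qed (use K open_dom[OF c(1)] in \<open>auto simp: compact_imp_closed open_Compl\<close>)
  qed
  moreover have "b p > 0" using c r by (simp add: b_def \<beta>_def)
  moreover have "K \<subseteq> dom_of c" using inv_coord_in[OF c(1)] r(2) by (auto simp: K_def)
  ultimately show thesis
    using that[of c K b] c K b0 by (auto simp: b_def \<beta>_def)
qed

text \<open>One continuous function represents the Laplacian in all charts, so independence of the
  chart is built into the predicate. For the heat flow \<open>L\<close> is twice the time
  derivative.\<close>

definition laplacian_of :: "('m \<Rightarrow> real) \<Rightarrow> ('m \<Rightarrow> real) \<Rightarrow> bool"
  where "laplacian_of w L \<longleftrightarrow> Ck_function A 2 w \<and> continuous_on UNIV L \<and>
    (\<forall>c\<in>A. \<forall>p\<in>dom_of c. L p = laplace_beltrami g c w p)"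

lemma laplacian_of_C1: "laplacian_of w L \<Longrightarrow> C1 w"
  using Ck_on_2D(1) by (auto simp: laplacian_of_def Ck_function_def C1_def)

text \<open>The divergence theorem for v times the gradient of w: the field has compact support in
  one chart, so its divergence integrates to zero.\<close>

lemma green_in_chart:
  assumes c: "c \<in> A" and K: "compact K" "K \<subseteq> dom_of c" "\<And>q. q \<notin> K \<Longrightarrow> v q = 0"
    and v: "C1 v" and w: "laplacian_of w L"
  shows "(\<integral>p. v p * L p \<partial>\<mu>) = - (\<integral>p. gdot v w p \<partial>\<mu>)"
proof -
  let ?S = "cod_of c" and ?v = "v \<circ> inv_coord c" and ?w = "w \<circ> inv_coord c"
  let ?r = "\<lambda>x. sqrt (det (g c x))" and ?G = "\<lambda>x. matrix_inv (g c x)"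
  have cw: "C1 w" by (rule laplacian_of_C1[OF w])
  have w2: "Ck_on 2 ?w ?S" and L: "continuous_on UNIV L"
    using w c by (auto simp: laplacian_of_def Ck_function_def)
  \<comment> \<open>The gradient of w multiplied by the volume density; its Euclidean divergence is
    \<open>?r\<close> times the Laplacian.\<close>
  define X where "X i x = (\<Sum>j\<in>UNIV. ?r x * ?G x $ i $ j * partial j ?w x)" for i x
  have X: "C1_on (X i) ?S" for i
    unfolding X_def
    by (intro C1_on_sum C1_on_mult C1_on_sqrt_det C1_on_metric_inv c Ck_on_2D(2)[OF w2])
  have v': "C1_on ?v ?S" using v c by (simp only: C1_def)
  define Y where "Y i x = (if x \<in> ?S then ?v x * X i x else 0)" for i x
  define Y' where "Y' i x = (if x \<in> ?S then ?v x * partial i (X i) x + X i x * partial i ?v x else 0)" for i x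
  \<comment> \<open>\<open>?S\<close> and \<open>T\<close> form an open cover of the coordinate
    space; where they overlap, v and its gradient vanish, so the extensions by zero \<open>Y\<close>
    and \<open>Y'\<close> are continuous everywhere.\<close>
  define T where "T = - (coord c ` K)"
  have cK: "compact (coord c ` K)"
    by (intro compact_continuous_image continuous_on_subset[OF continuous_coord[OF c] K(2)] K(1))
  then have T: "open T" by (simp add: T_def compact_imp_closed open_Compl)
  have cover: "?S \<union> T = UNIV" using K(2) by (auto simp: T_def cod_of_def)
  have v0: "?v x = 0" if "x \<in> ?S" "x \<in> T" for x
    using that K(3)[of "inv_coord c x"] coord_inv_coord[OF c] by (force simp: T_def)
  have gv0: "grad ?v x = 0" if "x \<in> ?S" "x \<in> T" for x
    using grad_cong_open[of "?S \<inter> T" x ?v "\<lambda>_. 0"] that v0 T open_cod[OF c] by (auto simp: grad_const)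
  have Y0: "Y i x = 0" "Y' i x = 0" if "x \<in> T" for i x
    using v0[of x] gv0[of x] that by (auto simp: Y_def Y'_def grad_nth[symmetric])
  have int0: "integral\<^sup>L lborel (Y' i) = 0" for i
  proof (rule integral_directional_derivative_eq_0[where Y = "Y i" and K = "coord c ` K" and b = "axis i 1"])
    show "((\<lambda>t. Y i (x + t *\<^sub>R axis i 1)) has_real_derivative Y' i x) (at 0)" for x
    proof -
      have "(Y i has_derivative (\<lambda>y. (if x \<in> ?S then grad (\<lambda>x. ?v x * X i x) x else 0) \<bullet> y)) (at x)"
      proof (cases "x \<in> ?S")
        case True
        have "(Y i has_derivative (\<lambda>y. grad (\<lambda>x. ?v x * X i x) x \<bullet> y)) (at x)"
          by (rule has_derivative_transform_within_open[OF C1_onD[OF C1_on_mult[OF v' X]]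
                open_cod[OF c] True]) (use True in \<open>auto simp: Y_def\<close>)
        then show ?thesis using True by simp
      next
        case False
        then have xT: "x \<in> T" using cover by blast
        have "((\<lambda>_. 0) has_derivative (\<lambda>y. 0)) (at x)" by simp
        then have "(Y i has_derivative (\<lambda>y. 0)) (at x)"
          by (rule has_derivative_transform_within_open[OF _ T xT]) (use Y0 in auto)
        then show ?thesis using False by simp
      qed
      moreover have "(if x \<in> ?S then grad (\<lambda>x. ?v x * X i x) x else 0) $ i = Y' i x"
        using grad_mult[OF v' X, of x i] by (simp add: Y'_def grad_nth)
      ultimately obtain d where D: "(Y i has_derivative (\<lambda>y. d \<bullet> y)) (at x)" and d: "d $ i = Y' i x"
        by blast
      have l: "((\<lambda>t::real. x + t *\<^sub>R axis i 1) has_derivative (\<lambda>t. t *\<^sub>R axis i 1)) (at 0)"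
        by (auto intro!: derivative_eq_intros)
      have "(Y i has_derivative (\<lambda>y. d \<bullet> y)) (at (x + 0 *\<^sub>R axis i 1))"
        using D by simp
      from has_derivative_compose[OF l this]
      have "((\<lambda>t. Y i (x + t *\<^sub>R axis i 1)) has_derivative (\<lambda>t. d \<bullet> (t *\<^sub>R axis i 1))) (at 0)" .
      moreover have "(\<lambda>t. d \<bullet> (t *\<^sub>R axis i 1)) = (*) (Y' i x)"
        using d by (auto simp: inner_axis)
      ultimately show ?thesis by (simp add: has_field_derivative_def)
    qed
    have "continuous_on ?S (Y i)"
      by (rule continuous_on_eq[OF C1_on_continuous[OF C1_on_mult[OF v' X[of i]]]]) (simp add: Y_def)
    moreover have "continuous_on T (Y i)"
      by (rule continuous_on_eq[OF continuous_on_const[of _ 0]]) (simp add: Y0)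
    ultimately show "continuous_on UNIV (Y i)"
      using continuous_on_open_Un[OF open_cod[OF c] T] cover by simp
    have "continuous_on ?S (\<lambda>x. ?v x * grad (X i) x $ i + X i x * grad ?v x $ i)"
      by (intro continuous_intros C1_on_continuous[OF v'] C1_on_continuous[OF X] C1_on_grad[OF X] C1_on_grad[OF v'])
    then have "continuous_on ?S (Y' i)"
      by (rule continuous_on_eq) (simp add: Y'_def grad_nth)
    moreover have "continuous_on T (Y' i)"
      by (rule continuous_on_eq[OF continuous_on_const[of _ 0]]) (simp add: Y0)
    ultimately show "continuous_on UNIV (Y' i)"
      using continuous_on_open_Un[OF open_cod[OF c] T] cover by simp
  qed (use cK Y0 in \<open>auto simp: T_def\<close>)
  have Y'_int: "integrable lborel (Y' i)" for i
  proof -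
    have "continuous_on ?S (\<lambda>x. ?v x * grad (X i) x $ i + X i x * grad ?v x $ i)"
      by (intro continuous_intros C1_on_continuous[OF v'] C1_on_continuous[OF X] C1_on_grad[OF X] C1_on_grad[OF v'])
    then have "continuous_on (coord c ` K) (Y' i)"
      by (rule continuous_on_eq[OF continuous_on_subset])
         (use K(2) coord_in[OF c] in \<open>auto simp: Y'_def grad_nth\<close>)
    from borel_integrable_compact[OF cK this]
    show ?thesis
      by (rule Bochner_Integration.integrable_cong[THEN iffD1, rotated -1])
         (use Y0 in \<open>auto simp: T_def split: split_indicator\<close>)
  qed
  let ?H = "\<lambda>p. v p * L p + gdot v w p"
  have H: "continuous_on UNIV ?H"
    by (intro continuous_intros C1_continuous v L continuous_on_gdot cw)
  \<comment> \<open>The product rule: differentiating \<open>X\<close> produces the Laplacian,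
    differentiating v the product of gradients, both times the volume density.\<close>
  have sumY: "(\<Sum>i\<in>UNIV. Y' i x) = indicator ?S x * (?r x * ?H (inv_coord c x))" for x
  proof (cases "x \<in> ?S")
    case True
    then have p: "inv_coord c x \<in> dom_of c" "coord c (inv_coord c x) = x"
      using c by (auto intro: inv_coord_in coord_inv_coord)
    have r: "?r x \<noteq> 0" using det_metric[OF c True] by simp
    have "L (inv_coord c x) = laplacian_coord (g c) ?w x"
      using w c p by (simp add: laplacian_of_def laplace_beltrami_def)
    also have "\<dots> = (\<Sum>i\<in>UNIV. partial i (X i) x) / ?r x"
      by (simp add: laplacian_coord_def X_def[abs_def])
    finally have 1: "?r x * L (inv_coord c x) = (\<Sum>i\<in>UNIV. partial i (X i) x)"
      using r by simp
    have "gdot v w (inv_coord c x) = gdot_in c v w x"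
      using gdot_eq[OF c p(1) v cw] p by simp
    also have "\<dots> = (\<Sum>i\<in>UNIV. partial i ?v x * (\<Sum>j\<in>UNIV. ?G x $ i $ j * partial j ?w x))"
      by (simp add: gdot_in_def inner_vec_def matrix_vector_mult_def grad_nth)
    finally have 2: "?r x * gdot v w (inv_coord c x) = (\<Sum>i\<in>UNIV. X i x * partial i ?v x)"
      by (simp add: X_def sum_distrib_left sum_distrib_right mult_ac)
    have "(\<Sum>i\<in>UNIV. Y' i x) = ?v x * (\<Sum>i\<in>UNIV. partial i (X i) x) + (\<Sum>i\<in>UNIV. X i x * partial i ?v x)"
      using True by (simp add: Y'_def sum.distrib sum_distrib_left)
    then show ?thesis using True by (simp add: 1[symmetric] 2[symmetric] algebra_simps)
  qed (simp add: Y'_def)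
  have "0 = (\<Sum>i\<in>UNIV. integral\<^sup>L lborel (Y' i))" by (simp add: int0)
  also have "\<dots> = (\<integral>x. (\<Sum>i\<in>UNIV. Y' i x) \<partial>lborel)"
    by (rule Bochner_Integration.integral_sum[symmetric]) (rule Y'_int)
  also have "\<dots> = (\<integral>p. indicator (dom_of c) p * ?H p \<partial>\<mu>)"
    unfolding sumY by (rule integral_chart[symmetric, OF c borel_measurable_continuous_onI[OF H]])
  also have "\<dots> = (\<integral>p. ?H p \<partial>\<mu>)"
  proof (intro Bochner_Integration.integral_cong refl)
    fix p
    have "?H p = 0" if "p \<notin> dom_of c"
    proof -
      have "p \<in> - K" using that K(2) by blast
      then show ?thesis
        using K(3) gdot_locally_const[OF v cw open_Compl[OF compact_imp_closed[OF K(1)]], of p 0] by auto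
    qed
    then show "indicator (dom_of c) p * ?H p = ?H p" by (auto split: split_indicator)
  qed
  also have "\<dots> = (\<integral>p. v p * L p \<partial>\<mu>) + (\<integral>p. gdot v w p \<partial>\<mu>)"
    by (intro Bochner_Integration.integral_add integrable_continuous continuous_intros C1_continuous v L
        continuous_on_gdot cw)
  finally show ?thesis by simp
qed

text \<open>By compactness finitely many bump functions have a positive sum. Dividing by this sum
  splits v into C^1 pieces, each supported in one chart, and both sides are linear in v.\<close>

lemma green:
  assumes v: "C1 v" and w: "laplacian_of w L"
  shows "(\<integral>p. v p * L p \<partial>\<mu>) = - (\<integral>p. gdot v w p \<partial>\<mu>)"
proof -
  have cw: "C1 w" by (rule laplacian_of_C1[OF w])
  have "\<exists>c K b. c \<in> A \<and> compact K \<and> K \<subseteq> dom_of c \<and> C1 b \<and> b p > 0 \<and>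
      (\<forall>q. b q \<ge> 0) \<and> (\<forall>q. q \<notin> K \<longrightarrow> b q = 0)" for p
    by (rule bump[of p]) blast
  then obtain c K b where b: "\<And>p. c p \<in> A" "\<And>p. compact (K p)" "\<And>p. K p \<subseteq> dom_of (c p)" "\<And>p. C1 (b p)"
    "\<And>p. b p p > 0" "\<And>p q. b p q \<ge> 0" "\<And>p q. q \<notin> K p \<Longrightarrow> b p q = (0 :: real)"
    by metis
  have op: "open {q. b p q > 0}" for p
    using open_Collect_less[OF continuous_on_const C1_continuous[OF b(4)]] by simp
  have cover: "UNIV \<subseteq> (\<Union>p\<in>UNIV. {q. b p q > 0})"
    using b(5) by auto
  obtain I where I: "finite I" "UNIV \<subseteq> (\<Union>p\<in>I. {q. b p q > 0})"
    by (rule compactE_image[OF compact_M op cover]) (rule that)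
  define s where "s q = (\<Sum>p\<in>I. b p q)" for q
  have s: "s q > 0" for q
  proof -
    obtain p where "p \<in> I" "b p q > 0" using I(2) by blast
    then show ?thesis unfolding s_def using I(1) b(6) by (intro sum_pos2)
  qed
  have "C1 s" unfolding s_def by (intro C1_sum b)
  then have "C1 (\<lambda>q. inverse (s q))"
    by (rule C1_compose[where F' = "\<lambda>y. - inverse (y\<^sup>2)"])
       (use s in \<open>auto intro!: derivative_eq_intros continuous_intros simp: power2_eq_square less_imp_neq[symmetric]\<close>)
  define v' where "v' p q = b p q * (v q * inverse (s q))" for p q
  have v': "C1 (v' p)" for p
    unfolding v'_def by (intro C1_mult b v \<open>C1 (\<lambda>q. inverse (s q))\<close>)
  have vsum: "v = (\<lambda>q. \<Sum>p\<in>I. v' p q)"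
  proof
    fix q
    have "(\<Sum>p\<in>I. v' p q) = s q * (v q * inverse (s q))"
      by (simp add: v'_def s_def sum_distrib_right)
    also have "\<dots> = v q" using s[of q] by simp
    finally show "v q = (\<Sum>p\<in>I. v' p q)" by simp
  qed
  have gsum: "gdot (\<lambda>q. \<Sum>p\<in>J. v' p q) w q = (\<Sum>p\<in>J. gdot (v' p) w q)" if "finite J" for J q
    using that
  proof (induction J)
    case empty
    show ?case using gdot_locally_const[OF C1_const cw open_UNIV, of q 0] by simp
  next
    case (insert p J)
    then show ?case by (simp add: gdot_add[OF v' C1_sum[OF v'] cw])
  qed
  have L: "continuous_on UNIV L" using w by (simp add: laplacian_of_def)
  have "(\<integral>p. v p * L p \<partial>\<mu>) = (\<integral>q. (\<Sum>p\<in>I. v' p q * L q) \<partial>\<mu>)"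
    by (subst vsum) (simp add: sum_distrib_right)
  also have "\<dots> = (\<Sum>p\<in>I. \<integral>q. v' p q * L q \<partial>\<mu>)"
    by (intro Bochner_Integration.integral_sum integrable_continuous continuous_intros C1_continuous v' L)
  also have "\<dots> = (\<Sum>p\<in>I. - (\<integral>q. gdot (v' p) w q \<partial>\<mu>))"
  proof (intro sum.cong refl)
    show "(\<integral>q. v' p q * L q \<partial>\<mu>) = - (\<integral>q. gdot (v' p) w q \<partial>\<mu>)" for p
      using green_in_chart[OF b(1)[of p] b(2)[of p] b(3)[of p] _ v' w] by (simp add: v'_def b(7))
  qed
  also have "\<dots> = - (\<integral>q. (\<Sum>p\<in>I. gdot (v' p) w q) \<partial>\<mu>)"
    by (subst Bochner_Integration.integral_sum)
       (auto simp: sum_negf intro!: integrable_continuous continuous_on_gdot v' cw)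
  also have "\<dots> = - (\<integral>q. gdot v w q \<partial>\<mu>)"
  proof -
    have "gdot v w q = (\<Sum>p\<in>I. gdot (v' p) w q)" for q
      using arg_cong[OF vsum, of "\<lambda>v. gdot v w q"] gsum[OF I(1)] by simp
    then show ?thesis by simp
  qed
  finally show ?thesis .
qed

section \<open>The Poincare inequality\<close>

definition dirichlet :: "('m \<Rightarrow> real) \<Rightarrow> ('m \<Rightarrow> real) \<Rightarrow> real"
  where "dirichlet v w = (\<integral>p. gdot v w p \<partial>\<mu>)"

lemma dirichlet_nonneg: "C1 v \<Longrightarrow> dirichlet v v \<ge> 0"
  by (simp add: dirichlet_def gdot_nonneg)

lemma dirichlet_commute: "C1 v \<Longrightarrow> C1 w \<Longrightarrow> dirichlet v w = dirichlet w v"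
  by (simp add: dirichlet_def gdot_commute)

text \<open>The constant \<open>a\<close> is free rather than the mean over \<open>U\<close>, and
  the energy is taken over the whole manifold; this makes the property easy to pass on to
  overlapping unions.\<close>

definition poincare_set :: "'m set \<Rightarrow> bool"
  where "poincare_set U \<longleftrightarrow>
    (\<exists>C\<ge>0. \<forall>v. C1 v \<longrightarrow> (\<exists>a. (\<integral>p. indicator U p * (v p - a)\<^sup>2 \<partial>\<mu>) \<le> C * dirichlet v v))"

text \<open>The minimum over \<open>K\<close> times the unit sphere is attained and positive;
  homogeneity of degree 2 extends the bound to all vectors.\<close>

lemma metric_inv_lower_bound:
  assumes c: "c \<in> A" and K: "compact K" "K \<subseteq> cod_of c"
  obtains l where "l > 0"
    "\<And>x a. x \<in> K \<Longrightarrow> l * (norm a)\<^sup>2 \<le> sqrt (det (g c x)) * (a \<bullet> (matrix_inv (g c x) *v a))"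
proof (cases "K = {}")
  case True
  with that[of 1] show thesis by simp
next
  case False
  define Q where "Q = (\<lambda>(x, a). sqrt (det (g c x)) * (a \<bullet> (matrix_inv (g c x) *v a)))"
  let ?D = "K \<times> sphere (0 :: real ^ 'n) 1"
  have sd: "continuous_on ?D (\<lambda>z. sqrt (det (g c (fst z))))"
    using K(2) by (intro continuous_on_compose2[OF C1_on_continuous[OF C1_on_sqrt_det[OF c]] continuous_on_fst])
      (auto intro: continuous_on_id)
  have mi: "continuous_on ?D (\<lambda>z. matrix_inv (g c (fst z)) $ i $ j)" for i j
    using K(2) by (intro continuous_on_compose2[OF C1_on_continuous[OF C1_on_metric_inv[OF c]] continuous_on_fst])
      (auto intro: continuous_on_id)
  have "continuous_on ?D
      (\<lambda>z. sqrt (det (g c (fst z))) * (\<Sum>i\<in>UNIV. snd z $ i * (\<Sum>j\<in>UNIV. matrix_inv (g c (fst z)) $ i $ j * snd z $ j)))"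
    by (intro continuous_on_mult continuous_on_sum sd mi
        continuous_on_component[OF continuous_on_snd[OF continuous_on_id]])
  then have "continuous_on ?D Q"
    by (simp add: Q_def inner_vec_def matrix_vector_mult_def case_prod_beta')
  moreover have "compact ?D" by (intro compact_Times K compact_sphere)
  moreover have "?D \<noteq> {}"
  proof -
    have "axis undefined 1 \<in> sphere (0 :: real ^ 'n) 1" by (simp add: norm_axis_1)
    then show ?thesis using False by blast
  qed
  ultimately obtain z where z: "z \<in> ?D" "\<And>y. y \<in> ?D \<Longrightarrow> Q z \<le> Q y"
    using continuous_attains_inf[of ?D Q] by metis
  show thesis
  proof (rule that[of "Q z"])
    show "Q z > 0"
      using z(1) metric_inv_pos[OF c] det_metric[OF c] K(2)
      by (auto simp: Q_def intro!: mult_pos_pos) (metis norm_zero zero_neq_one subsetD)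
    show "Q z * (norm a)\<^sup>2 \<le> sqrt (det (g c x)) * (a \<bullet> (matrix_inv (g c x) *v a))" if x: "x \<in> K" for x a
    proof (cases "a = 0")
      case False
      define b where "b = inverse (norm a) *\<^sub>R a"
      have b: "norm b = 1" "a = norm a *\<^sub>R b" using False by (auto simp: b_def)
      have "Q z \<le> Q (x, b)" using x b by (intro z(2)) auto
      then have "Q z * (norm a)\<^sup>2 \<le> Q (x, b) * (norm a)\<^sup>2" by (intro mult_right_mono) auto
      also have "Q (x, b) * (norm a)\<^sup>2 = sqrt (det (g c x)) * (a \<bullet> (matrix_inv (g c x) *v a))"
      proof -
        have "Q (x, b) * (norm a)\<^sup>2
            = sqrt (det (g c x)) * ((norm a *\<^sub>R b) \<bullet> (matrix_inv (g c x) *v (norm a *\<^sub>R b)))"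
          by (simp add: Q_def matrix_vector_mult_scaleR power2_eq_square)
        then show ?thesis by (simp flip: b(2))
      qed
      finally show ?thesis .
    qed simp
  qed
qed

text \<open>On a closed coordinate ball the volume density is at most \<open>R\<close>, and the
  density times the inverse metric is at least \<open>l\<close>. The Euclidean inequality therefore
  carries over with its constant multiplied by \<open>R / l\<close>.\<close>

lemma poincare_set_local:
  obtains U where "open U" "p \<in> U" "poincare_set U"
proof -
  obtain c r where c: "c \<in> A" "p \<in> dom_of c" and r: "r > 0" "cball (coord c p) r \<subseteq> cod_of c"
    by (rule chart_ball)
  let ?B = "ball (coord c p) r" and ?K = "cball (coord c p) r" and ?r = "\<lambda>x. sqrt (det (g c x))"
  define U where "U = inv_coord c ` ?B"
  have BK: "?B \<subseteq> cod_of c" using r(2) ball_subset_cball by blast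
  have U: "open U" unfolding U_def by (intro open_inv_coord_image c BK) simp
  have pU: "p \<in> U"
    unfolding U_def using r(1) inv_coord_coord[OF c] by (intro image_eqI[of _ _ "coord c p"]) auto
  have Udom: "U \<subseteq> dom_of c" using BK inv_coord_in[OF c(1)] by (auto simp: U_def)
  \<comment> \<open>Injectivity of \<open>inv_coord c\<close> on \<open>cod_of c\<close>.\<close>
  have indU: "indicator U (inv_coord c x) = (indicator ?B x :: real)" if "x \<in> cod_of c" for x
  proof -
    have "inv_coord c x \<in> U \<longleftrightarrow> x \<in> ?B"
    proof
      assume "inv_coord c x \<in> U"
      then obtain y where y: "y \<in> ?B" "inv_coord c x = inv_coord c y" by (auto simp: U_def)
      then have yc: "y \<in> cod_of c" using BK by blast
      have "x = coord c (inv_coord c x)" by (rule coord_inv_coord[OF c(1) that, symmetric])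
      also have "\<dots> = coord c (inv_coord c y)" by (simp only: y(2))
      also have "\<dots> = y" by (rule coord_inv_coord[OF c(1) yc])
      finally show "x \<in> ?B" using y(1) by simp
    qed (simp add: U_def)
    then show ?thesis by (simp add: indicator_def)
  qed
  have to_chart: "(\<integral>p. indicator U p * F p \<partial>\<mu>) = (\<integral>x. indicator ?B x * (?r x * F (inv_coord c x)) \<partial>lborel)"
    if F: "continuous_on UNIV F" for F :: "'m \<Rightarrow> real"
  proof -
    have [measurable]: "F \<in> borel_measurable borel" "U \<in> sets borel"
      using F U by (auto intro: borel_measurable_continuous_onI)
    have "(\<integral>p. indicator U p * F p \<partial>\<mu>) = (\<integral>p. indicator (dom_of c) p * (indicator U p * F p) \<partial>\<mu>)"
      using Udom by (intro Bochner_Integration.integral_cong) (auto split: split_indicator)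
    also have "\<dots> = (\<integral>x. indicator (cod_of c) x * (?r x * (indicator U (inv_coord c x) * F (inv_coord c x))) \<partial>lborel)"
      by (rule integral_chart[OF c(1)]) measurable
    also have "\<dots> = (\<integral>x. indicator ?B x * (?r x * F (inv_coord c x)) \<partial>lborel)"
    proof (intro Bochner_Integration.integral_cong refl)
      show "indicator (cod_of c) x * (?r x * (indicator U (inv_coord c x) * F (inv_coord c x)))
          = indicator ?B x * (?r x * F (inv_coord c x))" for x
      proof (cases "x \<in> cod_of c")
        case True
        then show ?thesis by (simp add: indU)
      next
        case False
        then have "x \<notin> ?B" using BK by blast
        then show ?thesis using False by simp
      qed
    qed
    finally show ?thesis .
  qed
  have cr: "continuous_on ?K ?r"
    by (intro continuous_on_subset[OF C1_on_continuous[OF C1_on_sqrt_det[OF c(1)]] r(2)])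
  have "bounded (?r ` ?K)"
    by (intro compact_imp_bounded compact_continuous_image cr compact_cball)
  then obtain R where R: "R > 0" "\<And>x. x \<in> ?K \<Longrightarrow> ?r x \<le> R"
    by (force simp: bounded_pos)
  obtain l where l: "l > 0"
    "\<And>x a. x \<in> ?K \<Longrightarrow> l * (norm a)\<^sup>2 \<le> ?r x * (a \<bullet> (matrix_inv (g c x) *v a))"
    by (rule metric_inv_lower_bound[OF c(1) compact_cball r(2)]) (rule that)
  let ?C = "2 ^ (CARD('n) + 1) * r\<^sup>2"
  have "\<exists>a. (\<integral>p. indicator U p * (v p - a)\<^sup>2 \<partial>\<mu>) \<le> (R * ?C / l) * dirichlet v v" if v: "C1 v" for v
  proof -
    let ?v = "v \<circ> inv_coord c"
    have v': "C1_on ?v (cod_of c)" using v c by (simp only: C1_def)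
    have cv: "continuous_on ?K ?v" and cg: "continuous_on ?K (grad ?v)"
      using continuous_on_subset[OF C1_on_continuous[OF v'] r(2)]
        continuous_on_subset[OF C1_on_grad[OF v'] r(2)] by auto
    obtain a where a: "(\<integral>x. indicator ?B x * (?v x - a)\<^sup>2 \<partial>lborel)
        \<le> ?C * (\<integral>x. indicator ?B x * (norm (grad ?v x))\<^sup>2 \<partial>lborel)"
      using poincare_ball[OF v' r(2,1)] by blast
    have cgd: "continuous_on UNIV (gdot v v)" by (rule continuous_on_gdot[OF v v])
    have "continuous_on ?K (\<lambda>x. gdot v v (inv_coord c x))"
      by (rule continuous_on_compose2[OF cgd continuous_on_subset[OF continuous_inv_coord[OF c(1)] r(2)]]) simp
    have cgi: "continuous_on ?K (\<lambda>x. ?r x * gdot v v (inv_coord c x))"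
      by (intro continuous_on_mult cr) fact
    have "(\<integral>p. indicator U p * (v p - a)\<^sup>2 \<partial>\<mu>) = (\<integral>x. indicator ?B x * (?r x * (?v x - a)\<^sup>2) \<partial>lborel)"
      using to_chart[of "\<lambda>p. (v p - a)\<^sup>2"] C1_continuous[OF v] by (simp add: continuous_intros)
    also have "\<dots> \<le> (\<integral>x. R * (indicator ?B x * (?v x - a)\<^sup>2) \<partial>lborel)"
    proof (rule integral_mono)
      show "integrable lborel (\<lambda>x. indicator ?B x * (?r x * (?v x - a)\<^sup>2))"
        by (intro integrable_indicator_ball continuous_intros cr cv)
      show "integrable lborel (\<lambda>x. R * (indicator ?B x * (?v x - a)\<^sup>2))"
        by (intro integrable_mult_right integrable_indicator_ball continuous_intros cv)
      show "indicator ?B x * (?r x * (?v x - a)\<^sup>2) \<le> R * (indicator ?B x * (?v x - a)\<^sup>2)" for x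
        using R(2)[of x] by (auto split: split_indicator intro!: mult_right_mono)
    qed
    also have "\<dots> = R * (\<integral>x. indicator ?B x * (?v x - a)\<^sup>2 \<partial>lborel)" by simp
    also have "\<dots> \<le> R * (?C * (\<integral>x. indicator ?B x * (norm (grad ?v x))\<^sup>2 \<partial>lborel))"
      using R(1) by (intro mult_left_mono a) auto
    also have "\<dots> = (R * ?C / l) * (\<integral>x. l * (indicator ?B x * (norm (grad ?v x))\<^sup>2) \<partial>lborel)"
      using l(1) by simp
    also have "\<dots> \<le> (R * ?C / l) * (\<integral>x. indicator ?B x * (?r x * gdot v v (inv_coord c x)) \<partial>lborel)"
    proof (intro mult_left_mono integral_mono)
      show "integrable lborel (\<lambda>x. l * (indicator ?B x * (norm (grad ?v x))\<^sup>2))"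
        by (intro integrable_mult_right integrable_indicator_ball continuous_intros cg)
      show "integrable lborel (\<lambda>x. indicator ?B x * (?r x * gdot v v (inv_coord c x)))"
        by (intro integrable_indicator_ball cgi)
      show "l * (indicator ?B x * (norm (grad ?v x))\<^sup>2) \<le> indicator ?B x * (?r x * gdot v v (inv_coord c x))" for x
      proof (cases "x \<in> ?B")
        case True
        then have x: "x \<in> cod_of c" "x \<in> ?K" using BK by auto
        then show ?thesis
          using l(2)[OF x(2), of "grad ?v x"] True
          by (simp add: gdot_eq[OF c(1) inv_coord_in[OF c(1)] v v] gdot_in_def coord_inv_coord[OF c(1)])
      qed simp
    qed (use R l in auto)
    also have "(\<integral>x. indicator ?B x * (?r x * gdot v v (inv_coord c x)) \<partial>lborel) = (\<integral>p. indicator U p * gdot v v p \<partial>\<mu>)"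
      by (rule to_chart[OF cgd, symmetric])
    also have "(R * ?C / l) * \<dots> \<le> (R * ?C / l) * dirichlet v v"
      unfolding dirichlet_def
      using R l gdot_nonneg[OF v]
      by (intro mult_left_mono integral_mono integrable_indicator_continuous integrable_continuous cgd U)
         (auto split: split_indicator)
    finally show ?thesis by blast
  qed
  moreover have "R * ?C / l \<ge> 0" using R l by simp
  ultimately have "poincare_set U" unfolding poincare_set_def by blast
  with that U pU show thesis by blast
qed

section \<open>Gluing local Poincare inequalities\<close>

lemma poincare_set_Un:
  assumes U: "poincare_set U" "open U" and V: "poincare_set V" "open V" and UV: "U \<inter> V \<noteq> {}"
  shows "poincare_set (U \<union> V)"
proof -
  obtain C where C: "C \<ge> 0" "\<And>v. C1 v \<Longrightarrow> \<exists>a. (\<integral>p. indicator U p * (v p - a)\<^sup>2 \<partial>\<mu>) \<le> C * dirichlet v v"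
    using U(1) unfolding poincare_set_def by blast
  obtain C' where C': "C' \<ge> 0" "\<And>v. C1 v \<Longrightarrow> \<exists>a. (\<integral>p. indicator V p * (v p - a)\<^sup>2 \<partial>\<mu>) \<le> C' * dirichlet v v"
    using V(1) unfolding poincare_set_def by blast
  \<comment> \<open>On the overlap v is close to both a and b, which bounds (a - b)^2 times the
    measure of the overlap; positivity of this measure allows the division.\<close>
  define m where "m = measure \<mu> (U \<inter> V)"
  have m: "m > 0" unfolding m_def using U V UV by (intro measure_open_pos) auto
  have "\<exists>a. (\<integral>p. indicator (U \<union> V) p * (v p - a)\<^sup>2 \<partial>\<mu>) \<le> (C + 2 * C' + 4 * (C + C') / m) * dirichlet v v"
    if v: "C1 v" for v
  proof -
    let ?E = "dirichlet v v"
    obtain a where a: "(\<integral>p. indicator U p * (v p - a)\<^sup>2 \<partial>\<mu>) \<le> C * ?E" using C(2)[OF v] by blast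
    obtain b where b: "(\<integral>p. indicator V p * (v p - b)\<^sup>2 \<partial>\<mu>) \<le> C' * ?E" using C'(2)[OF v] by blast
    have int: "integrable \<mu> (\<lambda>p. indicator W p * (v p - d)\<^sup>2)" if "open W" for W d
      by (intro integrable_indicator_continuous continuous_intros C1_continuous v that)
    \<comment> \<open>By the parallelogram law the two sides differ by
      \<open>(2 * z - x - y)\<^sup>2\<close>.\<close>
    have sq: "(x - y)\<^sup>2 \<le> 2 * (z - x)\<^sup>2 + 2 * (z - y)\<^sup>2" for x y z :: real
      using zero_le_power2[of "2 * z - x - y"] by (simp add: power2_eq_square algebra_simps)
    have "(a - b)\<^sup>2 * m = (\<integral>p. indicator (U \<inter> V) p * (a - b)\<^sup>2 \<partial>\<mu>)"
      using U V by (simp add: m_def sets_volume space_volume)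
    also have "\<dots> \<le> (\<integral>p. 2 * (indicator U p * (v p - a)\<^sup>2) + 2 * (indicator V p * (v p - b)\<^sup>2) \<partial>\<mu>)"
      by (intro integral_mono integrable_indicator_continuous Bochner_Integration.integrable_add
          integrable_mult_right int continuous_intros U V open_Int)
         (auto split: split_indicator intro: sq)
    also have "\<dots> = 2 * (\<integral>p. indicator U p * (v p - a)\<^sup>2 \<partial>\<mu>) + 2 * (\<integral>p. indicator V p * (v p - b)\<^sup>2 \<partial>\<mu>)"
      by (subst Bochner_Integration.integral_add) (auto intro!: integrable_mult_right int U V)
    also have "\<dots> \<le> 2 * (C + C') * ?E" using a b by (simp add: algebra_simps)
    finally have ab: "(a - b)\<^sup>2 \<le> 2 * (C + C') * ?E / m"
      using m by (simp add: field_simps)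
    \<comment> \<open>On \<open>V\<close> the constant b is replaced by a; the price
      \<open>2 * (a - b)\<^sup>2\<close> is integrated over the whole manifold, which has volume
      1.\<close>
    have "(\<integral>p. indicator (U \<union> V) p * (v p - a)\<^sup>2 \<partial>\<mu>)
        \<le> (\<integral>p. indicator U p * (v p - a)\<^sup>2 + (2 * (indicator V p * (v p - b)\<^sup>2) + 2 * (a - b)\<^sup>2) \<partial>\<mu>)"
    proof (intro integral_mono Bochner_Integration.integrable_add integrable_mult_right int U V open_Un integrable_const)
      show "indicator (U \<union> V) p * (v p - a)\<^sup>2
          \<le> indicator U p * (v p - a)\<^sup>2 + (2 * (indicator V p * (v p - b)\<^sup>2) + 2 * (a - b)\<^sup>2)" for p
        using sq[of "v p" a b] by (auto split: split_indicator simp: power2_commute)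
    qed
    also have "\<dots> = (\<integral>p. indicator U p * (v p - a)\<^sup>2 \<partial>\<mu>) + (2 * (\<integral>p. indicator V p * (v p - b)\<^sup>2 \<partial>\<mu>) + 2 * (a - b)\<^sup>2)"
      by (simp add: int U V measure_UNIV space_volume)
    also have "\<dots> \<le> C * ?E + (2 * (C' * ?E) + 2 * (2 * (C + C') * ?E / m))"
      using a b ab by (intro add_mono mult_left_mono) auto
    also have "\<dots> = (C + 2 * C' + 4 * (C + C') / m) * ?E"
      by (simp add: algebra_simps add_divide_distrib)
    finally show ?thesis by blast
  qed
  moreover have "C + 2 * C' + 4 * (C + C') / m \<ge> 0" using C(1) C'(1) m by simp
  ultimately show ?thesis unfolding poincare_set_def by blast
qed

text \<open>Members of \<open>W\<close> may be disjoint from each other, but each meets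
  \<open>U\<close>, which remains part of the growing union.\<close>

lemma poincare_set_star:
  assumes "finite W" "\<And>V. V \<in> W \<Longrightarrow> open V \<and> poincare_set V \<and> U \<inter> V \<noteq> {}" "open U" "poincare_set U"
  shows "open (U \<union> \<Union>W) \<and> poincare_set (U \<union> \<Union>W)"
  using assms(1,2)
proof (induction W)
  case empty
  then show ?case using assms by simp
next
  case (insert V W)
  have "open (U \<union> \<Union>W) \<and> poincare_set (U \<union> \<Union>W)"
    by (rule insert.IH) (use insert.prems in simp)
  moreover have "open V \<and> poincare_set V \<and> U \<inter> V \<noteq> {}"
    by (rule insert.prems) simp
  moreover from this have "(U \<union> \<Union>W) \<inter> V \<noteq> {}" by blast
  ultimately have "open ((U \<union> \<Union>W) \<union> V)" "poincare_set ((U \<union> \<Union>W) \<union> V)"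
    by (auto intro: poincare_set_Un)
  then show ?case by (simp add: Un_ac)
qed

text \<open>A new set is merged with all members that it meets; the remaining members are disjoint
  from the merged set. The resulting pieces take the place of connected components.\<close>

lemma disjoint_poincare_cover:
  assumes "finite \<U>" "\<And>U. U \<in> \<U> \<Longrightarrow> open U \<and> poincare_set U"
  shows "\<exists>\<V>. finite \<V> \<and> (\<forall>V\<in>\<V>. open V \<and> poincare_set V) \<and> pairwise disjnt \<V> \<and> \<Union>\<V> = \<Union>\<U>"
  using assms
proof (induction \<U>)
  case empty
  then show ?case by (intro exI[of _ "{}"]) auto
next
  case (insert U \<U>)
  then obtain \<V> where V: "finite \<V>" "\<And>V. V \<in> \<V> \<Longrightarrow> open V \<and> poincare_set V" "pairwise disjnt \<V>"
    "\<Union>\<V> = \<Union>\<U>" by (metis insertCI)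
  define W where "W = {V \<in> \<V>. U \<inter> V \<noteq> {}}"
  have 1: "open (U \<union> \<Union>W) \<and> poincare_set (U \<union> \<Union>W)"
    using V insert by (intro poincare_set_star) (auto simp: W_def)
  have "disjnt (U \<union> \<Union>W) V" if "V \<in> \<V> - W" for V
    using that V(3) by (auto simp: W_def disjnt_def pairwise_def)
  then have "pairwise disjnt (insert (U \<union> \<Union>W) (\<V> - W))"
    using V(3) by (auto simp: pairwise_insert disjnt_sym intro: pairwise_subset)
  moreover have "\<Union>(insert (U \<union> \<Union>W) (\<V> - W)) = \<Union>(insert U \<U>)"
    using V(4) by (auto simp: W_def)
  ultimately show ?case
    using V(1,2) 1 by (intro exI[of _ "insert (U \<union> \<Union>W) (\<V> - W)"]) auto
qed

text \<open>The manifold need not be connected, so the mean value has to be taken separately on each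
  of finitely many clopen pieces.\<close>

lemma poincare_inequality:
  obtains \<V> C where "finite \<V>" "\<And>V. V \<in> \<V> \<Longrightarrow> open V \<and> closed V" "C > 0"
    "\<And>v. C1 v \<Longrightarrow> (\<integral>p. (v p)\<^sup>2 \<partial>\<mu>) - (\<Sum>V\<in>\<V>. (\<integral>p. indicator V p * v p \<partial>\<mu>)\<^sup>2 / measure \<mu> V)
      \<le> C * dirichlet v v"
    "\<And>v. C1 v \<Longrightarrow> (\<integral>p. (v p)\<^sup>2 \<partial>\<mu>) - (\<Sum>V\<in>\<V>. (\<integral>p. indicator V p * v p \<partial>\<mu>)\<^sup>2 / measure \<mu> V) \<ge> 0"
proof -
  have "\<exists>U. open U \<and> p \<in> U \<and> poincare_set U" for p
    by (rule poincare_set_local[of p]) blast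
  then obtain U where U: "\<And>p. open (U p)" "\<And>p. p \<in> U p" "\<And>p. poincare_set (U p)"
    by metis
  have cov: "UNIV \<subseteq> (\<Union>p\<in>UNIV. U p)" using U(2) by auto
  obtain I where I: "finite I" "UNIV \<subseteq> (\<Union>p\<in>I. U p)"
    by (rule compactE_image[OF compact_M U(1) cov]) (rule that)
  have UN: "\<Union>(U ` I) = UNIV" using I(2) by blast
  have "\<exists>\<W>. finite \<W> \<and> (\<forall>V\<in>\<W>. open V \<and> poincare_set V) \<and> pairwise disjnt \<W> \<and> \<Union>\<W> = \<Union>(U ` I)"
    by (rule disjoint_poincare_cover) (use I(1) U in auto)
  then obtain \<W> where W: "finite \<W>" "\<And>V. V \<in> \<W> \<Longrightarrow> open V \<and> poincare_set V" "pairwise disjnt \<W>" "\<Union>\<W> = UNIV"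
    unfolding UN by metis
  \<comment> \<open>Without the empty set every piece has positive measure, so that the means over
    the pieces make sense.\<close>
  define \<V> where "\<V> = \<W> - {{}}"
  have V: "finite \<V>" "\<And>V. V \<in> \<V> \<Longrightarrow> open V" "\<And>V. V \<in> \<V> \<Longrightarrow> poincare_set V" "pairwise disjnt \<V>" "\<Union>\<V> = UNIV"
    "\<And>V. V \<in> \<V> \<Longrightarrow> V \<noteq> {}"
    using W by (auto simp: \<V>_def intro: pairwise_subset)
  have clopen: "open V \<and> closed V" if "V \<in> \<V>" for V
  proof -
    \<comment> \<open>The pieces are open, disjoint and cover the space, so the complement of one is
      the union of the others.\<close>
    have "- V = \<Union>(\<V> - {V})"
      using V(4,5) that by (auto simp: pairwise_def disjnt_def)
    then have "open (- V)" using V(2) by auto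
    then show ?thesis using V(2)[OF that] by (simp add: closed_def)
  qed
  have "\<forall>V\<in>\<V>. \<exists>C\<ge>0. \<forall>v. C1 v \<longrightarrow> (\<exists>a. (\<integral>p. indicator V p * (v p - a)\<^sup>2 \<partial>\<mu>) \<le> C * dirichlet v v)"
    using V(3) by (simp add: poincare_set_def)
  then obtain C where C: "\<And>V. V \<in> \<V> \<Longrightarrow> C V \<ge> 0"
    "\<And>V v. V \<in> \<V> \<Longrightarrow> C1 v \<Longrightarrow> \<exists>a. (\<integral>p. indicator V p * (v p - a)\<^sup>2 \<partial>\<mu>) \<le> C V * dirichlet v v"
    unfolding bchoice_iff by blast
  have part: "(\<Sum>V\<in>\<V>. indicator V p) = (1 :: real)" for p
  proof -
    have "disjoint_family_on (\<lambda>V. V) \<V>"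
      using V(4) by (auto simp: disjoint_family_on_def pairwise_def disjnt_def)
    from indicator_UN_disjoint[OF V(1) this, of p] show ?thesis
      using V(5) by simp
  qed
  have sq: "(\<integral>p. indicator V p * (v p - a)\<^sup>2 \<partial>\<mu>) = (\<integral>p. indicator V p * (v p)\<^sup>2 \<partial>\<mu>)
      - 2 * a * (\<integral>p. indicator V p * v p \<partial>\<mu>) + measure \<mu> V * a\<^sup>2" if v: "C1 v" and VV: "open V" for v a V
  proof -
    have "(\<integral>p. indicator V p * (v p - a)\<^sup>2 \<partial>\<mu>)
        = (\<integral>p. indicator V p * (v p)\<^sup>2 - (2 * a) * (indicator V p * v p) + indicator V p * a\<^sup>2 \<partial>\<mu>)"
      by (intro Bochner_Integration.integral_cong) (auto simp: power2_eq_square algebra_simps)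
    also have "\<dots> = (\<integral>p. indicator V p * (v p)\<^sup>2 \<partial>\<mu>) - (2 * a) * (\<integral>p. indicator V p * v p \<partial>\<mu>)
        + (\<integral>p. indicator V p * a\<^sup>2 \<partial>\<mu>)"
      by (subst Bochner_Integration.integral_add Bochner_Integration.integral_diff;
          (intro Bochner_Integration.integrable_diff integrable_mult_right integrable_indicator_continuous
            continuous_intros C1_continuous v VV)?)+
         (simp only: integral_mult_right_zero)
    finally show ?thesis using VV by (simp add: sets_volume space_volume)
  qed
  have total: "(\<integral>p. (v p)\<^sup>2 \<partial>\<mu>) = (\<Sum>V\<in>\<V>. \<integral>p. indicator V p * (v p)\<^sup>2 \<partial>\<mu>)" if v: "C1 v" for v
  proof -
    have "(\<integral>p. (v p)\<^sup>2 \<partial>\<mu>) = (\<integral>p. (\<Sum>V\<in>\<V>. indicator V p * (v p)\<^sup>2) \<partial>\<mu>)"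
      by (simp add: part flip: sum_distrib_right)
    also have "\<dots> = (\<Sum>V\<in>\<V>. \<integral>p. indicator V p * (v p)\<^sup>2 \<partial>\<mu>)"
      by (intro Bochner_Integration.integral_sum integrable_indicator_continuous continuous_intros C1_continuous v V)
    finally show ?thesis .
  qed
  have mean: "(\<integral>p. indicator V p * (v p)\<^sup>2 \<partial>\<mu>) - (\<integral>p. indicator V p * v p \<partial>\<mu>)\<^sup>2 / measure \<mu> V
      \<in> {0..C V * dirichlet v v}" if v: "C1 v" and VV: "V \<in> \<V>" for v V
  proof -
    let ?Q = "\<integral>p. indicator V p * (v p)\<^sup>2 \<partial>\<mu>" and ?I = "\<integral>p. indicator V p * v p \<partial>\<mu>" and ?m = "measure \<mu> V"
    have m: "?m > 0" using V VV by (intro measure_open_pos) auto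
    obtain a where a: "(\<integral>p. indicator V p * (v p - a)\<^sup>2 \<partial>\<mu>) \<le> C V * dirichlet v v"
      using C(2)[OF VV v] by blast
    \<comment> \<open>As a function of \<open>a\<close> the integral is a quadratic with minimum at
      the mean \<open>?I / ?m\<close>, so passing from the given \<open>a\<close> to the mean only
      lowers it.\<close>
    have "0 \<le> ?m * (a - ?I / ?m)\<^sup>2" using m by simp
    also have "\<dots> = (?Q - 2 * a * ?I + ?m * a\<^sup>2) - (?Q - ?I\<^sup>2 / ?m)"
      using m by (simp add: field_simps power2_eq_square)
    finally have "?Q - ?I\<^sup>2 / ?m \<le> C V * dirichlet v v"
      using a sq[OF v V(2)[OF VV], of a] by simp
    moreover have "0 \<le> (\<integral>p. indicator V p * (v p - ?I / ?m)\<^sup>2 \<partial>\<mu>)"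
      by (intro Bochner_Integration.integral_nonneg) auto
    moreover have "\<dots> = ?Q - ?I\<^sup>2 / ?m"
      unfolding sq[OF v V(2)[OF VV]] using m by (simp add: field_simps power2_eq_square)
    ultimately show ?thesis by simp
  qed
  show thesis
  proof (rule that[OF V(1) clopen, of "sum C \<V> + 1"])
    \<comment> \<open>The summand 1 keeps the constant positive even if every \<open>C V\<close> is
      zero.\<close>
    show "sum C \<V> + 1 > 0" using C(1) by (simp add: add_nonneg_pos sum_nonneg)
    fix v assume v: "C1 v"
    let ?D = "\<lambda>V. (\<integral>p. indicator V p * (v p)\<^sup>2 \<partial>\<mu>) - (\<integral>p. indicator V p * v p \<partial>\<mu>)\<^sup>2 / measure \<mu> V"
    have eq: "(\<integral>p. (v p)\<^sup>2 \<partial>\<mu>) - (\<Sum>V\<in>\<V>. (\<integral>p. indicator V p * v p \<partial>\<mu>)\<^sup>2 / measure \<mu> V) = (\<Sum>V\<in>\<V>. ?D V)"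
      by (simp add: total[OF v] sum_subtractf)
    have "(\<Sum>V\<in>\<V>. ?D V) \<le> (\<Sum>V\<in>\<V>. C V * dirichlet v v)"
      using mean[OF v] by (intro sum_mono) auto
    also have "\<dots> \<le> (sum C \<V> + 1) * dirichlet v v"
      using dirichlet_nonneg[OF v] by (simp add: sum_distrib_right distrib_right)
    finally show "(\<integral>p. (v p)\<^sup>2 \<partial>\<mu>) - (\<Sum>V\<in>\<V>. (\<integral>p. indicator V p * v p \<partial>\<mu>)\<^sup>2 / measure \<mu> V)
        \<le> (sum C \<V> + 1) * dirichlet v v"
      unfolding eq .
    show "(\<integral>p. (v p)\<^sup>2 \<partial>\<mu>) - (\<Sum>V\<in>\<V>. (\<integral>p. indicator V p * v p \<partial>\<mu>)\<^sup>2 / measure \<mu> V) \<ge> 0"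
      unfolding eq using mean[OF v] by (intro sum_nonneg) auto
  qed
qed

section \<open>The heat flow\<close>

text \<open>Expand the nonnegative square of the gradient of v - w. The bound serves to compare
  energies at different times.\<close>

lemma dirichlet_le:
  assumes v: "C1 v" and w: "C1 w"
  shows "dirichlet v w \<le> (dirichlet v v + dirichlet w w) / 2"
proof -
  have "gdot v w p \<le> (gdot v v p + gdot w w p) / 2" for p
  proof -
    obtain c where c: "c \<in> A" "p \<in> dom_of c" by (rule chart_around)
    note x = coord_in[OF c]
    define a b M where "a = grad (v \<circ> inv_coord c) (coord c p)" and "b = grad (w \<circ> inv_coord c) (coord c p)"
      and "M = matrix_inv (g c (coord c p))"
    have "0 \<le> (a - b) \<bullet> (M *v (a - b))"
      using metric_inv_pos[OF c(1) x, of "a - b"] by (cases "a = b") (auto simp: M_def)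
    also have "\<dots> = a \<bullet> (M *v a) + b \<bullet> (M *v b) - a \<bullet> (M *v b) - b \<bullet> (M *v a)"
      by (simp add: matrix_vector_mult_diff_distrib inner_diff_left inner_diff_right)
    also have "b \<bullet> (M *v a) = a \<bullet> (M *v b)"
      unfolding M_def by (rule metric_inv_sym[OF c(1) x])
    finally show ?thesis
      by (simp add: gdot_eq[OF c] v w gdot_in_def a_def b_def M_def)
  qed
  then have "dirichlet v w \<le> (\<integral>p. (gdot v v p + gdot w w p) / 2 \<partial>\<mu>)"
    unfolding dirichlet_def
    by (intro integral_mono integrable_continuous continuous_intros continuous_on_gdot v w) auto
  also have "\<dots> = (dirichlet v v + dirichlet w w) / 2"
    unfolding dirichlet_def
    by (simp add: integrable_continuous continuous_on_gdot v w)
  finally show ?thesis .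
qed

section \<open>Integrals over the manifold that depend on time\<close>

lemma continuous_on_slice:
  fixes H :: "real \<Rightarrow> 'm \<Rightarrow> real"
  assumes "continuous_on (S \<times> UNIV) (\<lambda>(t, p). H t p)" "t \<in> S"
  shows "continuous_on UNIV (H t)"
proof -
  have "continuous_on UNIV (\<lambda>p. (t, p))"
    by (intro continuous_on_Pair continuous_on_const continuous_on_id)
  from continuous_on_compose2[OF assms(1) this] assms(2) show ?thesis by auto
qed

text \<open>Dominated convergence with a constant bound, which exists because \<open>S\<close> and
  the manifold are compact. Time 0 may belong to \<open>S\<close>.\<close>

lemma continuous_on_integral:
  fixes H :: "real \<Rightarrow> 'm \<Rightarrow> real"
  assumes S: "compact S" and H: "continuous_on (S \<times> UNIV) (\<lambda>(t, p). H t p)"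
  shows "continuous_on S (\<lambda>t. \<integral>p. H t p \<partial>\<mu>)"
proof -
  have "bounded ((\<lambda>(t, p). H t p) ` (S \<times> UNIV))"
    by (intro compact_imp_bounded compact_continuous_image H compact_Times S compact_M)
  then obtain B where B: "\<And>t p. t \<in> S \<Longrightarrow> \<bar>H t p\<bar> \<le> B"
    by (fastforce simp: bounded_iff)
  have Ht: "continuous_on UNIV (H t)" if "t \<in> S" for t
    by (rule continuous_on_slice[OF H that])
  show ?thesis
    unfolding continuous_on_sequentially
  proof (intro allI ballI impI, elim conjE)
    fix x :: "nat \<Rightarrow> real" and a assume a: "a \<in> S" and x: "\<forall>n. x n \<in> S" "x \<longlonglongrightarrow> a"
    have "(\<lambda>n. H (x n) p) \<longlonglongrightarrow> H a p" for p
    proof -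
      have "continuous_on S (\<lambda>t. (t, p))"
        by (intro continuous_on_Pair continuous_on_const continuous_on_id)
      from continuous_on_compose2[OF H this] have "continuous_on S (\<lambda>t. H t p)" by auto
      from continuous_on_tendsto_compose[OF this x(2) a] x(1) show ?thesis by auto
    qed
    then have "(\<lambda>n. \<integral>p. H (x n) p \<partial>\<mu>) \<longlonglongrightarrow> (\<integral>p. H a p \<partial>\<mu>)"
      using a x B by (intro integral_dominated_convergence[where w = "\<lambda>_. B"] borel_measurable_volume Ht) auto
    then show "((\<lambda>t. \<integral>p. H t p \<partial>\<mu>) \<circ> x) \<longlonglongrightarrow> (\<integral>p. H a p \<partial>\<mu>)"
      by (simp add: o_def)
  qed
qed

text \<open>Near t the mean value theorem bounds the difference quotients by a bound for
  \<open>H'\<close> on a compact time interval times the manifold; dominated convergence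
  applies.\<close>

lemma has_real_derivative_integral:
  fixes H H' :: "real \<Rightarrow> 'm \<Rightarrow> real"
  assumes S: "open S" "t \<in> S"
    and deriv: "\<And>s p. s \<in> S \<Longrightarrow> ((\<lambda>s. H s p) has_real_derivative H' s p) (at s)"
    and cont: "\<And>s. s \<in> S \<Longrightarrow> continuous_on UNIV (H s)"
    and H': "continuous_on (S \<times> UNIV) (\<lambda>(s, p). H' s p)"
  shows "((\<lambda>s. \<integral>p. H s p \<partial>\<mu>) has_real_derivative (\<integral>p. H' t p \<partial>\<mu>)) (at t)"
proof -
  obtain r where r: "r > 0" "cball t r \<subseteq> S" using S open_contains_cball by blast
  have "bounded ((\<lambda>(s, p). H' s p) ` (cball t r \<times> UNIV))"
    using r(2) by (intro compact_imp_bounded compact_continuous_image compact_Times compact_M compact_cball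
        continuous_on_subset[OF H']) auto
  then obtain B where B: "\<And>s p. s \<in> cball t r \<Longrightarrow> \<bar>H' s p\<bar> \<le> B"
    by (fastforce simp: bounded_iff)
  have H't: "continuous_on UNIV (H' t)"
    by (rule continuous_on_slice[OF H' S(2)])
  \<comment> \<open>Increments are confined to \<open>ball 0 r\<close> so that \<open>t + h\<close>
    stays in \<open>S\<close>; as the ball is an open neighbourhood of 0, this is the full
    limit.\<close>
  have "((\<lambda>h. ((\<integral>p. H (t + h) p \<partial>\<mu>) - (\<integral>p. H t p \<partial>\<mu>)) / h) \<longlongrightarrow> (\<integral>p. H' t p \<partial>\<mu>)) (at 0 within ball 0 r)"
    unfolding tendsto_at_iff_sequentially
  proof (intro allI impI)
    fix X :: "nat \<Rightarrow> real" assume X: "\<forall>i. X i \<in> ball 0 r - {0}" "X \<longlonglongrightarrow> 0"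
    have Xt: "t + X n \<in> cball t r" "X n \<noteq> 0" for n
      using X(1) by (auto simp: dist_norm less_imp_le)
    then have XS: "t + X n \<in> S" for n using r(2) by blast
    have "(\<lambda>n. \<integral>p. (H (t + X n) p - H t p) / X n \<partial>\<mu>) \<longlonglongrightarrow> (\<integral>p. H' t p \<partial>\<mu>)"
    proof (rule integral_dominated_convergence[where w = "\<lambda>_. B"])
      show "AE p in \<mu>. (\<lambda>n. (H (t + X n) p - H t p) / X n) \<longlonglongrightarrow> H' t p"
      proof (rule AE_I2)
        fix p
        have lim: "((\<lambda>h. (H (t + h) p - H t p) / h) \<longlongrightarrow> H' t p) (at 0)"
          using deriv[OF S(2), of p] by (simp add: DERIV_def)
        have "filterlim X (at 0) sequentially"
          unfolding filterlim_at using X Xt by auto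
        from filterlim_compose[OF lim this]
        show "(\<lambda>n. (H (t + X n) p - H t p) / X n) \<longlonglongrightarrow> H' t p" .
      qed
      show "AE p in \<mu>. norm ((H (t + X n) p - H t p) / X n) \<le> B" for n
      proof (rule AE_I2)
        fix p
        have "norm (H (t + X n) p - H t p) \<le> B * norm ((t + X n) - t)"
        proof (rule field_differentiable_bound[where S = "cball t r" and f' = "\<lambda>s. H' s p"])
          show "((\<lambda>s. H s p) has_real_derivative H' s p) (at s within cball t r)" if "s \<in> cball t r" for s
            by (rule has_field_derivative_at_within[OF deriv[OF subsetD[OF r(2) that]]])
        qed (use B Xt r in auto)
        then show "norm ((H (t + X n) p - H t p) / X n) \<le> B"
          using Xt(2)[of n] by (simp add: abs_divide divide_le_eq)
      qed
    qed (use XS Xt cont S in \<open>auto intro!: borel_measurable_volume continuous_intros H't\<close>)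
    moreover have "(\<integral>p. (H (t + X n) p - H t p) / X n \<partial>\<mu>)
        = ((\<integral>p. H (t + X n) p \<partial>\<mu>) - (\<integral>p. H t p \<partial>\<mu>)) / X n" for n
      by (simp add: integrable_continuous cont XS S)
    ultimately show "((\<lambda>h. ((\<integral>p. H (t + h) p \<partial>\<mu>) - (\<integral>p. H t p \<partial>\<mu>)) / h) \<circ> X) \<longlonglongrightarrow> (\<integral>p. H' t p \<partial>\<mu>)"
      by (simp only: o_def)
  qed
  then show ?thesis
    using r(1) by (simp add: DERIV_def at_within_open[of 0 "ball 0 r"])
qed

end

locale heat_flow = closed_manifold A g \<mu>
  for A :: "('m::t2_space, 'n::finite) chart set" and g :: "('m, 'n) metric" and \<mu> :: "'m measure" +
  fixes f :: "'m \<Rightarrow> real" and u :: "real \<Rightarrow> 'm \<Rightarrow> real"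
  assumes initial_C1: "Ck_function A 1 f"
    and initial_pos: "f p > 0"
    and heat: "heat_solution A g f u"
begin

text \<open>Written with \<open>deriv\<close> because the joint continuity in
  \<open>C12_function\<close> concerns exactly this expression.\<close>

definition udot :: "real \<Rightarrow> 'm \<Rightarrow> real"
  where "udot t p = deriv (\<lambda>s. u s p) t"

lemma u_0: "u 0 = f"
  using heat by (simp add: heat_solution_def)

lemma continuous_on_u: "S \<subseteq> {0..} \<Longrightarrow> continuous_on (S \<times> UNIV) (\<lambda>(t, p). u t p)"
  using heat by (auto simp: heat_solution_def intro: continuous_on_subset)

lemma continuous_on_u_compose:
  assumes "continuous_on S a" "continuous_on S b" "\<And>x. x \<in> S \<Longrightarrow> a x \<ge> 0"
  shows "continuous_on S (\<lambda>x. u (a x) (b x))"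
  using continuous_on_compose2[OF continuous_on_u[of "{0..}"], of S "\<lambda>x. (a x, b x)"] assms
  by (auto intro!: continuous_on_Pair)

lemma continuous_u: "t \<ge> 0 \<Longrightarrow> continuous_on UNIV (u t)"
  using continuous_on_u_compose[of UNIV "\<lambda>_. t" "\<lambda>p. p"] by (simp add: continuous_on_id)

lemma half_laplacian:
  assumes "t > 0" "c \<in> A" "p \<in> dom_of c"
  shows "((\<lambda>s. u s p) has_real_derivative udot t p) (at t)"
    and "laplace_beltrami g c (u t) p = 2 * udot t p"
proof -
  have D: "((\<lambda>s. u s p) has_real_derivative (1 / 2 * laplace_beltrami g c (u t) p)) (at t)"
    using heat assms by (simp add: heat_solution_def)
  then have eq: "udot t p = 1 / 2 * laplace_beltrami g c (u t) p"
    unfolding udot_def by (rule DERIV_imp_deriv)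
  show "((\<lambda>s. u s p) has_real_derivative udot t p) (at t)"
    unfolding eq by (rule D)
  show "laplace_beltrami g c (u t) p = 2 * udot t p"
    by (simp add: eq)
qed

lemma deriv_u: "t > 0 \<Longrightarrow> ((\<lambda>s. u s p) has_real_derivative udot t p) (at t)"
  by (rule chart_around[of p]) (rule half_laplacian)

lemma continuous_on_udot: "continuous_on ({0<..} \<times> UNIV) (\<lambda>(t, p). udot t p)"
proof -
  have "continuous_on ({0<..} \<times> dom_of c) (\<lambda>(t, p). udot t p)" if c: "c \<in> A" for c
  proof -
    have "continuous_on ({0<..} \<times> cod_of c) (\<lambda>(t, x). deriv (\<lambda>s. (u s \<circ> inv_coord c) x) t)"
      using heat c by (simp add: heat_solution_def C12_function_def Let_def)
    then have "continuous_on ({0<..} \<times> cod_of c) (\<lambda>(t, x). udot t (inv_coord c x))"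
      by (simp add: udot_def)
    moreover have "continuous_on ({0<..} \<times> dom_of c) (\<lambda>(t, p). (t, coord c p))"
      unfolding case_prod_beta
      by (intro continuous_on_Pair continuous_on_fst continuous_on_id
          continuous_on_compose2[OF continuous_coord[OF c] continuous_on_snd]) auto
    ultimately have "continuous_on ({0<..} \<times> dom_of c)
        (\<lambda>z. (\<lambda>(t, x). udot t (inv_coord c x)) ((\<lambda>(t, p). (t, coord c p)) z))"
      by (rule continuous_on_compose2) (auto intro: coord_in c)
    then show ?thesis
      by (rule continuous_on_eq) (auto simp: inv_coord_coord[OF c])
  qed
  then have "continuous_on (\<Union>c\<in>A. {0<..} \<times> dom_of c) (\<lambda>(t, p). udot t p)"
    by (intro continuous_on_open_UN open_Times open_dom) auto
  moreover have "(\<Union>c\<in>A. {0<..} \<times> dom_of c) = {0::real<..} \<times> UNIV"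
    using chart_around by blast
  ultimately show ?thesis by simp
qed

lemma continuous_on_udot_compose:
  assumes "continuous_on S a" "continuous_on S b" "\<And>x. x \<in> S \<Longrightarrow> a x > 0"
  shows "continuous_on S (\<lambda>x. udot (a x) (b x))"
  using continuous_on_compose2[OF continuous_on_udot, of S "\<lambda>x. (a x, b x)"] assms
  by (auto intro!: continuous_on_Pair)

lemma continuous_udot: "t > 0 \<Longrightarrow> continuous_on UNIV (udot t)"
  using continuous_on_udot_compose[of UNIV "\<lambda>_. t" "\<lambda>p. p"] by (simp add: continuous_on_id)

lemma laplacian_of_u: "t > 0 \<Longrightarrow> laplacian_of (u t) (\<lambda>p. 2 * udot t p)"
  using heat half_laplacian(2)
  by (auto simp: laplacian_of_def heat_solution_def C12_function_def Ck_function_def Let_def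
      intro!: continuous_intros continuous_udot)

text \<open>For positive times this comes from C^2 regularity, at time 0 from the hypothesis on the
  initial value.\<close>

lemma C1_u: "t \<ge> 0 \<Longrightarrow> C1 (u t)"
  using laplacian_of_C1[OF laplacian_of_u, of t] initial_C1
  by (cases "t = 0") (auto simp: u_0 C1_iff_Ck_function)

section \<open>The weak form of the heat equation and derivatives of integrals along the
  flow\<close>

lemma integral_mult_udot:
  assumes v: "C1 v" and t: "t > 0"
  shows "(\<integral>p. v p * udot t p \<partial>\<mu>) = - dirichlet v (u t) / 2"
proof -
  have "(\<integral>p. v p * (2 * udot t p) \<partial>\<mu>) = - dirichlet v (u t)"
    unfolding dirichlet_def by (rule green[OF v laplacian_of_u[OF t]])
  moreover have "(\<integral>p. v p * (2 * udot t p) \<partial>\<mu>) = 2 * (\<integral>p. v p * udot t p \<partial>\<mu>)"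
    by (subst integral_mult_right_zero[symmetric]) (simp add: mult_ac)
  ultimately show ?thesis by simp
qed

lemma deriv_integral_mult:
  assumes v: "C1 v" and t: "t > 0"
  shows "((\<lambda>s. \<integral>p. v p * u s p \<partial>\<mu>) has_real_derivative - dirichlet v (u t) / 2) (at t)"
proof -
  have "((\<lambda>s. \<integral>p. v p * u s p \<partial>\<mu>) has_real_derivative (\<integral>p. v p * udot t p \<partial>\<mu>)) (at t)"
  proof (rule has_real_derivative_integral[of "{0<..}"])
    show "continuous_on ({0<..} \<times> UNIV) (\<lambda>(s, p). v p * udot s p)"
      unfolding case_prod_beta
      by (intro continuous_on_mult continuous_on_compose2[OF C1_continuous[OF v]]
          continuous_on_udot_compose continuous_on_fst continuous_on_snd continuous_on_id) auto
  qed (use t in \<open>auto intro!: DERIV_cmult deriv_u continuous_on_mult C1_continuous[OF v] continuous_u\<close>)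
  then show ?thesis by (simp only: integral_mult_udot[OF v t])
qed

text \<open>Differentiate under the integral, replace \<open>udot\<close> by half the Laplacian and
  integrate by parts; the chain rule for \<open>F'\<close> produces \<open>F''\<close>. This one
  formula covers the minimum principle, the integral of the square and the entropy. \<open>J\<close>
  holds the values of the solution on which \<open>F\<close> has to be regular.\<close>

lemma deriv_integral_compose:
  fixes F F' F'' :: "real \<Rightarrow> real"
  assumes t: "t > 0" and J: "\<And>s p. s > 0 \<Longrightarrow> u s p \<in> J"
    and F: "\<And>y. y \<in> J \<Longrightarrow> (F has_real_derivative F' y) (at y)"
    and F': "\<And>y. y \<in> J \<Longrightarrow> (F' has_real_derivative F'' y) (at y)"
    and F'': "continuous_on J F''"
  shows "((\<lambda>s. \<integral>p. F (u s p) \<partial>\<mu>) has_real_derivative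
    - (\<integral>p. F'' (u t p) * gdot (u t) (u t) p \<partial>\<mu>) / 2) (at t)"
proof -
  have cF: "continuous_on J F" and cF': "continuous_on J F'"
    using F F' by (meson DERIV_continuous continuous_at_imp_continuous_on)+
  have C: "C1 (\<lambda>p. F' (u t p))"
    by (rule C1_compose[OF C1_u F']) (use t J in \<open>auto intro: continuous_on_subset[OF F'']\<close>)
  have "((\<lambda>s. \<integral>p. F (u s p) \<partial>\<mu>) has_real_derivative (\<integral>p. F' (u t p) * udot t p \<partial>\<mu>)) (at t)"
  proof (rule has_real_derivative_integral[of "{0<..}"])
    show "((\<lambda>s. F (u s p)) has_real_derivative F' (u s p) * udot s p) (at s)" if "s \<in> {0<..}" for s p
      using DERIV_chain2[OF F[OF J] deriv_u] that by simp
    show "continuous_on UNIV (\<lambda>p. F (u s p))" if "s \<in> {0<..}" for s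
      using that J by (intro continuous_on_compose2[OF cF continuous_u]) auto
    show "continuous_on ({0<..} \<times> UNIV) (\<lambda>(s, p). F' (u s p) * udot s p)"
      unfolding case_prod_beta
      by (intro continuous_on_mult continuous_on_compose2[OF cF'] continuous_on_u_compose
          continuous_on_udot_compose continuous_on_fst continuous_on_snd continuous_on_id) (use J in auto)
  qed (use t in auto)
  also have "(\<integral>p. F' (u t p) * udot t p \<partial>\<mu>) = - dirichlet (\<lambda>p. F' (u t p)) (u t) / 2"
    by (rule integral_mult_udot[OF C t])
  also have "dirichlet (\<lambda>p. F' (u t p)) (u t) = (\<integral>p. F'' (u t p) * gdot (u t) (u t) p \<partial>\<mu>)"
    unfolding dirichlet_def
    by (intro Bochner_Integration.integral_cong refl gdot_compose[OF C1_u F'])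
       (use t J in \<open>auto intro: continuous_on_subset[OF F''] C1_u\<close>)
  finally show ?thesis .
qed

text \<open>The minimum principle, obtained from the decay of the integral of \<open>max 0 (m - u) ^ 3\<close>.\<close>

lemma lower_bound:
  obtains m where "m > 0" "\<And>t p. t \<ge> 0 \<Longrightarrow> m \<le> u t p"
proof -
  have "(UNIV :: 'm set) \<noteq> {}" by simp
  then obtain p0 where p0: "\<And>p. f p0 \<le> f p"
    using continuous_attains_inf[OF compact_M, of f] continuous_u[of 0] by (auto simp: u_0)
  define m where "m = f p0"
  \<comment> \<open>The cube has the continuous second derivative \<open>6 * max 0 (m - y)\<close>;
    it is nonnegative, so the integral of \<open>?F\<close> cannot increase along the flow.\<close>
  let ?F = "\<lambda>y. max 0 (m - y) ^ 3"
  have "m \<le> u T p" if "T \<ge> 0" for T p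
  proof (cases "T = 0")
    case True
    then show ?thesis using p0 by (simp add: u_0 m_def)
  next
    case False
    then have T: "T > 0" using that by simp
    let ?I = "\<lambda>t. \<integral>p. ?F (u t p) \<partial>\<mu>"
    have d: "((\<lambda>y. max 0 (m - y) ^ Suc (Suc n)) has_real_derivative
        - (real (Suc (Suc n)) * max 0 (m - y) ^ Suc n)) (at y)" for n y
    proof -
      have "((\<lambda>y. m - y) has_real_derivative - 1) (at y)"
        by (auto intro!: derivative_eq_intros)
      from DERIV_chain2[where f = "\<lambda>y. max 0 y ^ Suc (Suc n)", OF has_real_derivative_pos_part_power this]
      show ?thesis by simp
    qed
    have d1: "(?F has_real_derivative - 3 * max 0 (m - y) ^ 2) (at y)" for y
      using d[of 1 y] by (simp add: numeral_3_eq_3 numeral_2_eq_2)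
    have d2: "((\<lambda>y. - 3 * max 0 (m - y) ^ 2) has_real_derivative 6 * max 0 (m - y)) (at y)" for y
      using DERIV_cmult[OF d[of 0 y], of "- 3"] by (simp add: numeral_2_eq_2)
    \<comment> \<open>The derivative is available for positive times only; at time 0 continuity of
      the integral suffices.\<close>
    have "?I T \<le> ?I 0"
    proof (rule DERIV_nonpos_imp_decreasing_open[OF less_imp_le[OF T]])
      fix t assume t: "0 < t" "t < T"
      have "(?I has_real_derivative - (\<integral>p. 6 * max 0 (m - u t p) * gdot (u t) (u t) p \<partial>\<mu>) / 2) (at t)"
        by (rule deriv_integral_compose[of t UNIV, OF _ _ d1 d2]) (use t in \<open>auto intro!: continuous_intros\<close>)
      moreover have "(\<integral>p. 6 * max 0 (m - u t p) * gdot (u t) (u t) p \<partial>\<mu>) \<ge> 0"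
        using t gdot_nonneg[OF C1_u[of t]] by (intro Bochner_Integration.integral_nonneg) auto
      ultimately show "\<exists>y. (?I has_real_derivative y) (at t) \<and> y \<le> 0"
        by (intro exI conjI) auto
    next
      show "continuous_on {0..T} ?I"
        unfolding case_prod_beta
        by (rule continuous_on_integral)
           (auto simp: case_prod_beta intro!: continuous_intros continuous_on_u_compose)
    qed
    moreover have "?I 0 = 0" using p0 by (simp add: u_0 m_def)
    moreover have "?I T \<ge> 0" by (intro Bochner_Integration.integral_nonneg) simp
    ultimately have "?I T = 0" by linarith
    moreover have "continuous_on UNIV (\<lambda>p. ?F (u T p))"
      using T by (intro continuous_intros continuous_u) simp
    ultimately have "?F (u T p) = 0"
      by (intro continuous_integral_eq_0[where F = "\<lambda>p. ?F (u T p)"]) simp_all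
    then show ?thesis by simp
  qed
  with that[of m] initial_pos show thesis by (auto simp: m_def)
qed

section \<open>Dissipation identities for the integral of the square and the energy\<close>

abbreviation mass2 :: "real \<Rightarrow> real"
  where "mass2 t \<equiv> \<integral>p. (u t p)\<^sup>2 \<partial>\<mu>"

abbreviation energy :: "real \<Rightarrow> real"
  where "energy t \<equiv> dirichlet (u t) (u t)"

lemma deriv_mass2: "t > 0 \<Longrightarrow> (mass2 has_real_derivative - energy t) (at t)"
proof -
  assume t: "t > 0"
  have "(mass2 has_real_derivative - (\<integral>p. 2 * gdot (u t) (u t) p \<partial>\<mu>) / 2) (at t)"
    by (rule deriv_integral_compose[of t UNIV "\<lambda>y. y\<^sup>2" "\<lambda>y. 2 * y" "\<lambda>_. 2"])
       (use t in \<open>auto intro!: derivative_eq_intros\<close>)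
  then show ?thesis by (simp add: dirichlet_def)
qed

text \<open>When one time grows and the other shrinks, the two contributions to the derivative
  cancel by symmetry of the Dirichlet form. Continuity down to time 0 brings in the initial
  value.\<close>

lemma integral_u_u:
  assumes \<sigma>: "0 < \<sigma>" "\<sigma> < T"
  shows "(\<integral>p. u \<sigma> p * u (T - \<sigma>) p \<partial>\<mu>) = (\<integral>p. f p * u T p \<partial>\<mu>)"
proof -
  let ?b = "\<lambda>s. \<integral>p. u s p * u (T - s) p \<partial>\<mu>"
  have "?b \<sigma> = ?b 0"
  proof (rule DERIV_isconst_end[OF \<sigma>(1)])
    show "continuous_on {0..\<sigma>} ?b"
      using \<sigma> by (intro continuous_on_integral)
        (auto simp: case_prod_beta intro!: continuous_intros continuous_on_u_compose)
    fix s assume s: "0 < s" "s < \<sigma>"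
    have "(?b has_real_derivative (\<integral>p. u (T - s) p * udot s p - u s p * udot (T - s) p \<partial>\<mu>)) (at s)"
    proof (rule has_real_derivative_integral[of "{0<..<T}"])
      show "((\<lambda>s. u s p * u (T - s) p) has_real_derivative u (T - s) p * udot s p - u s p * udot (T - s) p) (at s)"
        if "s \<in> {0<..<T}" for s p
      proof -
        have "((\<lambda>s. u (T - s) p) has_real_derivative udot (T - s) p * (- 1)) (at s)"
          using that by (intro DERIV_chain2[OF deriv_u]) (auto intro!: derivative_eq_intros)
        from DERIV_mult[OF deriv_u this, of p] that show ?thesis by (simp add: algebra_simps)
      qed
      show "continuous_on ({0<..<T} \<times> UNIV) (\<lambda>(s, p). u (T - s) p * udot s p - u s p * udot (T - s) p)"
        by (auto simp: case_prod_beta intro!: continuous_intros continuous_on_u_compose continuous_on_udot_compose)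
      show "continuous_on UNIV (\<lambda>p. u s p * u (T - s) p)" if "s \<in> {0<..<T}" for s
        using that by (intro continuous_intros continuous_u) auto
    qed (use s \<sigma> in auto)
    also have "(\<integral>p. u (T - s) p * udot s p - u s p * udot (T - s) p \<partial>\<mu>)
        = (\<integral>p. u (T - s) p * udot s p \<partial>\<mu>) - (\<integral>p. u s p * udot (T - s) p \<partial>\<mu>)"
      using s \<sigma> by (intro Bochner_Integration.integral_diff integrable_continuous continuous_intros
          continuous_u continuous_udot) auto
    also have "\<dots> = 0"
      using s \<sigma> by (simp add: integral_mult_udot C1_u dirichlet_commute[of "u (T - s)"])
    finally show "(?b has_real_derivative 0) (at s)" .
  qed
  then show ?thesis by (simp add: u_0)
qed

text \<open>The integral of f times \<open>u s\<close> equals \<open>mass2 (s / 2)\<close>.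
  Differentiating it at \<open>T\<close>, once with f as a fixed test function and once through
  \<open>mass2\<close>, gives the two sides up to the common factor -1/2.\<close>

lemma dirichlet_initial:
  assumes T: "T > 0"
  shows "dirichlet f (u T) = energy (T / 2)"
proof -
  have eq: "mass2 (s / 2) = (\<integral>p. f p * u s p \<partial>\<mu>)" if "s > 0" for s
    using integral_u_u[of "s / 2" s] that by (simp add: power2_eq_square)
  have "((\<lambda>s. mass2 (s / 2)) has_real_derivative - energy (T / 2) * (1 / 2)) (at T)"
    by (rule DERIV_chain2[OF deriv_mass2]) (use T in \<open>auto intro!: derivative_eq_intros\<close>)
  then have "((\<lambda>s. \<integral>p. f p * u s p \<partial>\<mu>) has_real_derivative - energy (T / 2) * (1 / 2)) (at T)"
    by (rule has_field_derivative_transform_within_open[of _ _ _ "{0<..}"]) (use T eq in auto)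
  moreover have "((\<lambda>s. \<integral>p. f p * u s p \<partial>\<mu>) has_real_derivative - dirichlet f (u T) / 2) (at T)"
    by (rule deriv_integral_mult[OF _ T]) (use C1_u[of 0] in \<open>simp add: u_0\<close>)
  ultimately show ?thesis using DERIV_unique by fastforce
qed

text \<open>With s fixed, the integrals of \<open>u s * u t\<close> and \<open>f * u (s + t)\<close>
  agree for all t > 0, hence so do their derivatives in t.\<close>

lemma dirichlet_u_u:
  assumes s: "s > 0" and t: "t > 0"
  shows "dirichlet (u s) (u t) = energy ((s + t) / 2)"
proof -
  have f: "C1 f" using C1_u[of 0] by (simp add: u_0)
  have eq: "(\<integral>p. f p * u (s + t) p \<partial>\<mu>) = (\<integral>p. u s p * u t p \<partial>\<mu>)" if "t > 0" for t
    using integral_u_u[of s "s + t"] s that by simp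
  have "((\<lambda>t. \<integral>p. f p * u (s + t) p \<partial>\<mu>) has_real_derivative - dirichlet f (u (s + t)) / 2 * 1) (at t)"
    by (rule DERIV_chain2[OF deriv_integral_mult[OF f]]) (use s t in \<open>auto intro!: derivative_eq_intros\<close>)
  then have "((\<lambda>t. \<integral>p. u s p * u t p \<partial>\<mu>) has_real_derivative - dirichlet f (u (s + t)) / 2 * 1) (at t)"
    by (rule has_field_derivative_transform_within_open[of _ _ _ "{0<..}"]) (use t eq in auto)
  moreover have "((\<lambda>t. \<integral>p. u s p * u t p \<partial>\<mu>) has_real_derivative - dirichlet (u s) (u t) / 2) (at t)"
    by (rule deriv_integral_mult[OF C1_u t]) (use s in simp)
  ultimately have "dirichlet (u s) (u t) = dirichlet f (u (s + t))" using DERIV_unique by fastforce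
  then show ?thesis using dirichlet_initial[of "s + t"] s t by simp
qed

text \<open>Direct differentiation would meet the time derivative of a gradient. With s fixed, the
  energy at t is instead the Dirichlet form at times \<open>2 * t - s\<close> and s, hence an
  integral in which t enters only through \<open>u (2 * t - s)\<close>.\<close>

lemma deriv_energy:
  assumes s: "s > 0"
  shows "(energy has_real_derivative - 4 * (\<integral>p. (udot s p)\<^sup>2 \<partial>\<mu>)) (at s)"
proof -
  \<comment> \<open>The range t > s / 2 keeps \<open>2 * t - s\<close> positive and is a
    neighbourhood of s. At t = s both factors become \<open>udot s\<close>; the inner derivative 2
    and the factor -2 combine to -4.\<close>
  have eq: "- 2 * (\<integral>p. u (2 * t - s) p * udot s p \<partial>\<mu>) = energy t" if "t > s / 2" for t
    using integral_mult_udot[OF C1_u s, of "2 * t - s"] dirichlet_u_u[of "2 * t - s" s] that s by simp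
  have "((\<lambda>t. \<integral>p. u (2 * t - s) p * udot s p \<partial>\<mu>) has_real_derivative
      (\<integral>p. 2 * udot (2 * s - s) p * udot s p \<partial>\<mu>)) (at s)"
  proof (rule has_real_derivative_integral[of "{s / 2<..}" s _ "\<lambda>t p. 2 * udot (2 * t - s) p * udot s p"])
    show "((\<lambda>t. u (2 * t - s) p * udot s p) has_real_derivative 2 * udot (2 * t - s) p * udot s p) (at t)"
      if "t \<in> {s / 2<..}" for t p
    proof -
      have "((\<lambda>t. u (2 * t - s) p) has_real_derivative udot (2 * t - s) p * 2) (at t)"
        using that by (intro DERIV_chain2[OF deriv_u]) (auto intro!: derivative_eq_intros)
      from DERIV_cmult_right[OF this, of "udot s p"] show ?thesis by (simp add: mult_ac)
    qed
    show "continuous_on UNIV (\<lambda>p. u (2 * t - s) p * udot s p)" if "t \<in> {s / 2<..}" for t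
      using that s by (intro continuous_intros continuous_u continuous_udot) auto
    show "continuous_on ({s / 2<..} \<times> UNIV) (\<lambda>(t, p). 2 * udot (2 * t - s) p * udot s p)"
      using s by (auto simp: case_prod_beta intro!: continuous_intros continuous_on_udot_compose)
  qed (use s in auto)
  then have "((\<lambda>t. - 2 * (\<integral>p. u (2 * t - s) p * udot s p \<partial>\<mu>)) has_real_derivative
      - 2 * (\<integral>p. 2 * udot (2 * s - s) p * udot s p \<partial>\<mu>)) (at s)"
    by (rule DERIV_cmult)
  then have "(energy has_real_derivative - 2 * (\<integral>p. 2 * udot (2 * s - s) p * udot s p \<partial>\<mu>)) (at s)"
    by (rule has_field_derivative_transform_within_open[of _ _ _ "{s / 2<..}"]) (use s eq in auto)
  then show ?thesis by (simp add: power2_eq_square mult.assoc)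
qed

lemma energy_antimono:
  assumes "0 < s" "s \<le> t"
  shows "energy t \<le> energy s"
proof (rule DERIV_nonpos_imp_nonincreasing[OF assms(2)])
  show "\<exists>y. (energy has_real_derivative y) (at x) \<and> y \<le> 0" if "s \<le> x" "x \<le> t" for x
    using deriv_energy[of x] that assms by (intro exI conjI) auto
qed

lemma energy_nonneg: "t \<ge> 0 \<Longrightarrow> energy t \<ge> 0"
  by (intro dirichlet_nonneg C1_u)

text \<open>The energy e satisfies e(t) \<le> (e(0) + e(2t)) / 2 \<le> (e(0) + e(t)) / 2, which is
  solved for e(t). No limit of gradients as t -> 0 enters.\<close>

lemma energy_le_initial:
  assumes t: "t > 0"
  shows "energy t \<le> energy 0"
proof -
  have "energy t = dirichlet f (u (2 * t))"
    using dirichlet_initial[of "2 * t"] t by simp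
  also have "\<dots> \<le> (dirichlet f f + energy (2 * t)) / 2"
    using dirichlet_le[OF C1_u[of 0] C1_u[of "2 * t"]] t by (simp add: u_0)
  finally have "energy t \<le> (dirichlet f f + energy (2 * t)) / 2" .
  moreover have "energy (2 * t) \<le> energy t" using t by (intro energy_antimono) auto
  ultimately show ?thesis by (simp add: u_0)
qed

text \<open>The mean value theorem yields an energy at an intermediate time, which is at least the
  energy at the later end point. This turns bounds for \<open>mass2\<close> into pointwise bounds
  for the energy.\<close>

lemma mass2_decrease:
  assumes "0 < s" "s < t"
  shows "(t - s) * energy t \<le> mass2 s - mass2 t"
proof -
  obtain z where z: "s < z" "z < t" "mass2 t - mass2 s = (t - s) * (- energy z)"
    using MVT2[OF assms(2), of mass2 "\<lambda>z. - energy z"] deriv_mass2 assms(1) by force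
  then have "(t - s) * energy t \<le> (t - s) * energy z"
    using assms by (intro mult_left_mono energy_antimono) auto
  then show ?thesis using z(3) by simp
qed

section \<open>Decay of the energy\<close>

lemma energy_le_inverse:
  assumes t: "t \<ge> 2"
  shows "energy t \<le> 2 * mass2 1 / t"
proof -
  \<comment> \<open>The window from t / 2 to t has length proportional to t, which gives the rate
    1/t; \<open>t \<ge> 2\<close> places it after time 1.\<close>
  have "(t - t / 2) * energy t \<le> mass2 (t / 2) - mass2 t"
    using t by (intro mass2_decrease) auto
  also have "\<dots> \<le> mass2 (t / 2)" by simp
  also have "\<dots> \<le> mass2 1"
  proof (cases "t = 2")
    case False
    then have "(t / 2 - 1) * energy (t / 2) \<le> mass2 1 - mass2 (t / 2)"
      using t by (intro mass2_decrease) auto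
    moreover have "(t / 2 - 1) * energy (t / 2) \<ge> 0"
      using t by (intro mult_nonneg_nonneg energy_nonneg) auto
    ultimately show ?thesis by simp
  qed simp
  finally show ?thesis using t by (simp add: field_simps)
qed

text \<open>\<open>W\<close> is \<open>mass2\<close> minus its conserved part. Its derivative is
  minus the energy, and the Poincare inequality bounds it by \<open>C\<close> times the energy, so
  it decays like exp (-t / C). Monotonicity transfers this to the energy.\<close>

lemma energy_exponential_decay:
  obtains K c where "K > 0" "c > 0" "\<And>t. t > 0 \<Longrightarrow> energy t \<le> K * exp (- c * t)"
proof -
  obtain \<V> C where V: "finite \<V>" "\<And>V. V \<in> \<V> \<Longrightarrow> open V \<and> closed V" and C: "C > 0"
    and P: "\<And>v. C1 v \<Longrightarrow> (\<integral>p. (v p)\<^sup>2 \<partial>\<mu>) - (\<Sum>V\<in>\<V>. (\<integral>p. indicator V p * v p \<partial>\<mu>)\<^sup>2 / measure \<mu> V)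
      \<le> C * dirichlet v v"
    "\<And>v. C1 v \<Longrightarrow> (\<integral>p. (v p)\<^sup>2 \<partial>\<mu>) - (\<Sum>V\<in>\<V>. (\<integral>p. indicator V p * v p \<partial>\<mu>)\<^sup>2 / measure \<mu> V) \<ge> 0"
    by (rule poincare_inequality) (rule that)
  define m0 where "m0 = (\<Sum>V\<in>\<V>. (\<integral>p. indicator V p * u 1 p \<partial>\<mu>)\<^sup>2 / measure \<mu> V)"
  have const: "(\<integral>p. indicator V p * u t p \<partial>\<mu>) = (\<integral>p. indicator V p * u 1 p \<partial>\<mu>)" if "V \<in> \<V>" "t > 0" for V t
  proof -
    \<comment> \<open>The indicator of a clopen set has vanishing gradient; as a test function it
      shows that the mass on \<open>V\<close> is conserved.\<close>
    have "((\<lambda>s. \<integral>p. indicator V p * u s p \<partial>\<mu>) has_real_derivative 0) (at s within {0<..})" if "s \<in> {0<..}" for s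
    proof -
      have "dirichlet (indicator V) (u s) = 0"
        using gdot_indicator[of V "u s"] V(2)[OF \<open>V \<in> \<V>\<close>] C1_u[of s] that by (simp add: dirichlet_def)
      moreover have "C1 (indicator V)"
        using V(2)[OF \<open>V \<in> \<V>\<close>] by (intro C1_indicator) auto
      ultimately show ?thesis
        using deriv_integral_mult[of "indicator V" s] that by (auto intro: has_field_derivative_at_within)
    qed
    then obtain k where "\<And>s. s \<in> {0<..} \<Longrightarrow> (\<integral>p. indicator V p * u s p \<partial>\<mu>) = k"
      using has_field_derivative_zero_constant[of "{0<..}" "\<lambda>s. \<integral>p. indicator V p * u s p \<partial>\<mu>"]
      by (auto simp: convex_real_interval)
    then show ?thesis using that by simp
  qed
  have mean: "(\<Sum>V\<in>\<V>. (\<integral>p. indicator V p * u t p \<partial>\<mu>)\<^sup>2 / measure \<mu> V) = m0" if "t > 0" for t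
    unfolding m0_def by (intro sum.cong refl) (simp only: const[OF _ that])
  define W where "W t = mass2 t - m0" for t
  have W: "W t \<le> C * energy t" "W t \<ge> 0" if "t > 0" for t
    using P[OF C1_u, of t] mean[OF that] that by (simp_all add: W_def)
  \<comment> \<open>The derivative of \<open>W\<close> is at most \<open>- W / C\<close>, so
    multiplying by exp (t / C) gives a nonincreasing function.\<close>
  have W_exp: "exp (t / C) * W t \<le> exp (1 / C) * W 1" if "t \<ge> 1" for t
  proof (rule DERIV_nonpos_imp_nonincreasing[OF that])
    fix s assume s: "1 \<le> s" "s \<le> t"
    have dW: "(W has_real_derivative - energy s) (at s)"
      unfolding W_def using deriv_mass2[of s] s by (auto intro!: derivative_eq_intros)
    have "((\<lambda>t. exp (t / C)) has_real_derivative exp (s / C) * (1 / C)) (at s)"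
      using C by (auto intro!: derivative_eq_intros)
    from DERIV_mult[OF this dW]
    have "((\<lambda>t. exp (t / C) * W t) has_real_derivative exp (s / C) * (W s / C - energy s)) (at s)"
      by (simp add: algebra_simps)
    moreover have "W s / C - energy s \<le> 0"
      using W(1)[of s] C s by (simp add: field_simps)
    ultimately show "\<exists>y. ((\<lambda>t. exp (t / C) * W t) has_real_derivative y) (at s) \<and> y \<le> 0"
      by (intro exI conjI) (auto intro: mult_nonneg_nonpos)
  qed
  \<comment> \<open>The energy at t is at most the drop of \<open>W\<close> on the unit interval
    before t. The shift by 1 and the start of \<open>W_exp\<close> at time 1 each cost exp (1 / C),
    hence exp (2 / C).\<close>
  have late: "energy t \<le> W 1 * exp (2 / C) * exp (- (1 / C) * t)" if t: "t \<ge> 2" for t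
  proof -
    have "energy t \<le> mass2 (t - 1) - mass2 t"
      using mass2_decrease[of "t - 1" t] t by simp
    also have "\<dots> = W (t - 1) - W t" by (simp add: W_def)
    also have "\<dots> \<le> W (t - 1)" using W(2)[of t] t by simp
    also have "\<dots> \<le> exp (- ((t - 1) / C)) * (exp (1 / C) * W 1)"
      using W_exp[of "t - 1"] t by (simp add: exp_minus field_simps)
    also have "\<dots> = W 1 * exp (2 / C) * exp (- (1 / C) * t)"
      by (simp add: exp_add[symmetric] mult_ac) (simp add: algebra_simps add_divide_distrib diff_divide_distrib flip: exp_add)
    finally show ?thesis .
  qed
  \<comment> \<open>Up to time 2 the initial energy is a sufficient bound, because exp (2 / C)
    compensates the decaying factor.\<close>
  have early: "energy t \<le> energy 0 * exp (2 / C) * exp (- (1 / C) * t)" if t: "0 < t" "t \<le> 2" for t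
  proof -
    have "1 \<le> exp (2 / C - t / C)" using t C by (simp add: divide_right_mono)
    then have "energy 0 * 1 \<le> energy 0 * exp (2 / C - t / C)"
      by (intro mult_left_mono energy_nonneg) auto
    moreover have "exp (2 / C - t / C) = exp (2 / C) * exp (- (1 / C) * t)"
      by (simp flip: exp_add)
    ultimately show ?thesis using energy_le_initial[OF t(1)] by (simp add: mult.assoc)
  qed
  have W1: "W 1 \<ge> 0" and E0: "energy 0 \<ge> 0" using W(2)[of 1] energy_nonneg[of 0] by auto
  show thesis
  \<comment> \<open>The summand 1 keeps the constant positive when \<open>W 1\<close> and
    \<open>energy 0\<close> vanish, as they do for a constant solution.\<close>
  proof (rule that[of "(W 1 + energy 0 + 1) * exp (2 / C)" "1 / C"])
    show "energy t \<le> (W 1 + energy 0 + 1) * exp (2 / C) * exp (- (1 / C) * t)" if t: "t > 0" for t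
    proof -
      let ?x = "exp (2 / C) * exp (- (1 / C) * t)"
      have "energy t \<le> W 1 * ?x \<or> energy t \<le> energy 0 * ?x"
        using early[of t] late[of t] t by (cases "t \<le> 2") (auto simp: mult.assoc)
      moreover have "W 1 * ?x \<le> (W 1 + energy 0 + 1) * ?x" "energy 0 * ?x \<le> (W 1 + energy 0 + 1) * ?x"
        using W1 E0 by (intro mult_right_mono; simp)+
      ultimately have "energy t \<le> (W 1 + energy 0 + 1) * ?x" by linarith
      then show ?thesis by (simp only: mult.assoc)
    qed
  qed (use C W1 E0 in auto)
qed

section \<open>Entropy production\<close>

lemma deriv_Ent:
  assumes t: "t > 0"
  shows "((\<lambda>s. Ent \<mu> (u s)) has_real_derivative (\<integral>p. inverse (u t p) * gdot (u t) (u t) p \<partial>\<mu>) / 2) (at t)"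
proof -
  obtain m where m: "m > 0" "\<And>t p. t \<ge> 0 \<Longrightarrow> m \<le> u t p" by (rule lower_bound) (rule that)
  \<comment> \<open>The second derivative of y ln y is 1/y. The uniform lower bound keeps all values
    in \<open>{0<..}\<close>, where the logarithm is smooth.\<close>
  have "((\<lambda>s. \<integral>p. u s p * ln (u s p) \<partial>\<mu>) has_real_derivative
      - (\<integral>p. inverse (u t p) * gdot (u t) (u t) p \<partial>\<mu>) / 2) (at t)"
  proof (rule deriv_integral_compose[of t "{0<..}" "\<lambda>y. y * ln y" "\<lambda>y. ln y + 1" inverse])
    show "u s p \<in> {0<..}" if "s > 0" for s p
      using m(2)[of s p] m(1) that by simp
  qed (use t in \<open>auto intro!: derivative_eq_intros continuous_intros simp: field_simps\<close>)
  from DERIV_minus[OF this] show ?thesis by (simp add: Ent_def)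
qed

text \<open>The weight \<open>inverse (u t p)\<close> is at most \<open>inverse m\<close> at all
  times, so the entropy production inherits every decay rate of the energy.\<close>

lemma Ent_rate_le:
  obtains m where "m > 0" "\<And>t. t > 0 \<Longrightarrow> deriv (\<lambda>s. Ent \<mu> (u s)) t \<le> energy t / (2 * m)"
proof -
  obtain m where m: "m > 0" "\<And>t p. t \<ge> 0 \<Longrightarrow> m \<le> u t p" by (rule lower_bound) (rule that)
  have "deriv (\<lambda>s. Ent \<mu> (u s)) t \<le> energy t / (2 * m)" if t: "t > 0" for t
  proof -
    have C: "C1 (u t)" using t by (intro C1_u) simp
    have pos: "u t p > 0" for p using m(1) m(2)[of t p] t by linarith
    have "(\<integral>p. inverse (u t p) * gdot (u t) (u t) p \<partial>\<mu>) \<le> (\<integral>p. inverse m * gdot (u t) (u t) p \<partial>\<mu>)"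
    proof (rule integral_mono)
      show "integrable \<mu> (\<lambda>p. inverse (u t p) * gdot (u t) (u t) p)"
        using pos t by (intro integrable_continuous continuous_intros continuous_on_gdot C continuous_u)
          (auto simp: less_imp_neq[symmetric])
      show "integrable \<mu> (\<lambda>p. inverse m * gdot (u t) (u t) p)"
        by (intro integrable_continuous continuous_intros continuous_on_gdot C)
      show "inverse (u t p) * gdot (u t) (u t) p \<le> inverse m * gdot (u t) (u t) p" for p
        using m t by (intro mult_right_mono le_imp_inverse_le gdot_nonneg C) auto
    qed
    also have "\<dots> = inverse m * energy t" by (simp add: dirichlet_def)
    finally show ?thesis
      using DERIV_imp_deriv[OF deriv_Ent[OF t]] m(1) by (simp add: field_simps)
  qed
  with m(1) that show thesis by blast
qed

end

theorem corollary2p4: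
  fixes A :: "('m::t2_space, 'n::finite) chart set"
    and g :: "('m, 'n) metric"
    and \<mu> :: "'m measure"
    and f :: "'m \<Rightarrow> real"
    and u :: "real \<Rightarrow> 'm \<Rightarrow> real"
    and k :: real
  assumes "closed_riemannian_manifold A g"
    and "riemannian_volume A g \<mu>"
    and "emeasure \<mu> UNIV = 1"
    and "Ck_function A 1 f"
    and "\<And>p. f p > 0"
    and "(\<integral>p. f p \<partial>\<mu>) = 1"
    and "heat_solution A g f u"
    and "ricci_bounded_below A g k"
  shows "(\<forall>t>0. (\<lambda>s. Ent \<mu> (u s)) differentiable (at t)) \<and>
    (k > 0 \<longrightarrow> (\<exists>C c. C > 0 \<and> c > 0 \<and>
       (\<forall>t>0. deriv (\<lambda>s. Ent \<mu> (u s)) t \<le> C * exp (- c * t)))) \<and>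
    (k < 0 \<longrightarrow> Limsup at_top (\<lambda>t. ereal (deriv (\<lambda>s. Ent \<mu> (u s)) t))
       \<le> ereal (- (real CARD('n) * k / 2)))"
proof (intro conjI impI allI)
  interpret heat_flow A g \<mu> f u
    by unfold_locales (use assms in auto)
  obtain m where m: "m > 0" "\<And>t. t > 0 \<Longrightarrow> deriv (\<lambda>s. Ent \<mu> (u s)) t \<le> energy t / (2 * m)"
    by (rule Ent_rate_le) (rule that)
  show "(\<lambda>s. Ent \<mu> (u s)) differentiable (at t)" if "t > 0" for t
    using deriv_Ent[OF that] real_differentiable_def by blast
  show "\<exists>C c. C > 0 \<and> c > 0 \<and> (\<forall>t>0. deriv (\<lambda>s. Ent \<mu> (u s)) t \<le> C * exp (- c * t))"
  proof -
    obtain K c where K: "K > 0" "c > 0" "\<And>t. t > 0 \<Longrightarrow> energy t \<le> K * exp (- c * t)"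
      by (rule energy_exponential_decay) (rule that)
    have "deriv (\<lambda>s. Ent \<mu> (u s)) t \<le> K / (2 * m) * exp (- c * t)" if "t > 0" for t
    proof -
      have "energy t / (2 * m) \<le> (K * exp (- c * t)) / (2 * m)"
        using K(3)[OF that] m(1) by (intro divide_right_mono) auto
      then show ?thesis using m(2)[OF that] by simp
    qed
    then show ?thesis
      using K m(1) by (intro exI[of _ "K / (2 * m)"] exI[of _ c]) auto
  qed
  show "Limsup at_top (\<lambda>t. ereal (deriv (\<lambda>s. Ent \<mu> (u s)) t)) \<le> ereal (- (real CARD('n) * k / 2))"
    if k: "k < 0"
  proof (rule Limsup_bounded)
    define b where "b = - (real CARD('n) * k / 2)"
    have b: "b > 0" using k by (simp add: b_def mult_pos_neg)
    \<comment> \<open>From time 2 on the 1/t bound for the energy is available, and t \<ge>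
      \<open>mass2 1 / (m * b)\<close> makes the resulting \<open>mass2 1 / (t * m)\<close> at most
      \<open>b\<close>.\<close>
    have "deriv (\<lambda>s. Ent \<mu> (u s)) t \<le> b" if t: "t \<ge> max 2 (mass2 1 / (m * b))" for t
    proof -
      have "deriv (\<lambda>s. Ent \<mu> (u s)) t \<le> energy t / (2 * m)" using t by (intro m(2)) auto
      also have "\<dots> \<le> (2 * mass2 1 / t) / (2 * m)"
        using t m(1) by (intro divide_right_mono energy_le_inverse) auto
      also have "\<dots> \<le> b"
        using t m(1) b by (simp add: field_simps)
      finally show ?thesis .
    qed
    then show "\<forall>\<^sub>F t in at_top. ereal (deriv (\<lambda>s. Ent \<mu> (u s)) t) \<le> ereal (- (real CARD('n) * k / 2))"
      unfolding b_def[symmetric]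
      by (intro eventually_mono[OF eventually_ge_at_top[of "max 2 (mass2 1 / (m * b))"]]) simp
  qed
qed

end
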